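(* The problem \[ M\Big(\iint_{\mathbb{R}^6}\frac{|u(x)-u(y)|^2}{|x-y|^{3+2s}}dxdy+\int_{\mathbb{R}^3}V_0u^2dx\Big)\big[(-\Delta)^su+V_0u\big]=f(u)\quad\text{in }\mathbb{R}^3 \] admits a positive solution.
   Context: $s\in(\frac34,1)$, $(-\Delta)^s$ is the fractional Laplacian on $\mathbb{R}^3$, $V_0>0$ is a constant; solutions are weak solutions in $H^s(\mathbb{R}^3)$. $M:[0,\infty)\to[0,\infty)$ continuous with $(M_1)$ $M(t)\ge m_0>0$ for $t\ge0$; $(M_2)$ $M$ increasing; $(M_3)$ $\frac{M(t_1)}{t_1}-\frac{M(t_2)}{t_2}\le m_0(\frac1{t_1}-\frac1{t_2})$ for $t_1\ge t_2>0$. $f:\mathbb{R}\to\mathbb{R}$ continuous, $f=0$ on $(-\infty,0)$, $F(t)=\int_0^tf$, with $(f_1)$ $f(t)/t^3\to0$ as $t\to0^+$; $(f_2)$ $f(t)/t^{q-1}\to0$ as $t\to\infty$ for some $q\in(4,\frac6{3-2s})$; $(f_3)$ $0<\vartheta F(t)\le f(t)t$ for $t>0$, some $\vartheta\in(4,\frac6{3-2s})$; $(f_4)$ $f(t)/t^3$ nondecreasing on $(0,\infty)$. *)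

theory Defs
  imports "HOL-Analysis.Analysis"
begin

text \<open>Functions on R^3 are modelled as real ^ 3 \<Rightarrow> real; Lebesgue measure is lborel
  (every L^2 class has a Borel representative).\<close>

definition gagliardo_kernel :: "real \<Rightarrow> (real^3 \<Rightarrow> real) \<Rightarrow> (real^3 \<Rightarrow> real) \<Rightarrow> ((real^3) \<times> (real^3)) \<Rightarrow> real" where
  "gagliardo_kernel s u v = (\<lambda>(x, y). (u x - u y) * (v x - v y) / norm (x - y) powr (3 + 2 * s))"

definition Hs :: "real \<Rightarrow> (real^3 \<Rightarrow> real) set" where
  "Hs s = {u. u \<in> borel_measurable lborel
             \<and> integrable lborel (\<lambda>x. (u x)\<^sup>2)
             \<and> integrable (lborel \<Otimes>\<^sub>M lborel) (gagliardo_kernel s u u)}"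

definition Hs_energy :: "real \<Rightarrow> real \<Rightarrow> (real^3 \<Rightarrow> real) \<Rightarrow> real" where
  "Hs_energy s V0 u =
     (\<integral>z. gagliardo_kernel s u u z \<partial>(lborel \<Otimes>\<^sub>M lborel)) + (\<integral>x. V0 * (u x)\<^sup>2 \<partial>lborel)"

definition weak_solution ::
  "real \<Rightarrow> real \<Rightarrow> (real \<Rightarrow> real) \<Rightarrow> (real \<Rightarrow> real) \<Rightarrow> (real^3 \<Rightarrow> real) \<Rightarrow> bool" where
  "weak_solution s V0 M f u \<longleftrightarrow>
     u \<in> Hs s \<and>
     (\<forall>\<phi>\<in>Hs s.
        integrable (lborel \<Otimes>\<^sub>M lborel) (gagliardo_kernel s u \<phi>) \<and>
        integrable lborel (\<lambda>x. u x * \<phi> x) \<and>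
        integrable lborel (\<lambda>x. f (u x) * \<phi> x) \<and>
        M (Hs_energy s V0 u) *
          ((\<integral>z. gagliardo_kernel s u \<phi> z \<partial>(lborel \<Otimes>\<^sub>M lborel)) + (\<integral>x. V0 * u x * \<phi> x \<partial>lborel))
        = (\<integral>x. f (u x) * \<phi> x \<partial>lborel))"

end

theory Submission
  imports Defs "HOL-Complex_Analysis.Great_Picard"
begin

text \<open>
  The solution minimizes the energy over the radial part of the Nehari set. Everything rests on
  comparing \<open>u x\<close> with the average of \<open>u\<close> over a cube containing \<open>x\<close>: the squared difference is at most
  a constant times \<open>r\<^sup>2\<^sup>s\<close> times the inner Gagliardo integral at \<open>x\<close>, \<open>r\<close> being the side. Letting \<open>r\<close> depend on
  \<open>\<bar>u x\<bar>\<close> and iterating gives the subcritical Sobolev embedding; letting \<open>r\<close> tend to \<open>0\<close> gives local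
  compactness; and since a radial function has little mass on a far away cube, it also gives
  tightness. Hence bounded radial sequences have subsequences that converge almost everywhere and
  along which the nonlinear integrals converge, so a minimizer exists. Projecting perturbations back to
  the Nehari set shows that it is critical for radial directions, without differentiability of
  the nonlinearity; criticality in all directions follows from the uniqueness of elements of least
  energy in a rotation invariant affine hyperplane. Testing with the negative part, and with truncations
  concentrated on the zero set, yields positivity.
\<close>

section \<open>The space and its energy form\<close>

text \<open>The number 4 organises the proof. The ratio condition on \<open>M\<close> lets the
  Kirchhoff term \<open>M (E u) * E u\<close> grow at most like t^4 along a ray t u with t \<ge> 1,
  while the monotonicity of f(t)/t^3 makes \<open>g (t * x)\<close>, with g(t) = f(t) t, grow at
  least like t^4. So the sign of \<open>J\<close> changes exactly once on the ray through a
  minimizer, where \<open>I\<close> is largest, and subtracting \<open>J / 4\<close> from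
  \<open>I\<close> leaves two nonnegative terms that increase along rays. The assumption s > 3/4
  says that 6/(3 - 2s) > 4, so growth of order above 4 can still be subcritical. The nonlocal
  coefficient is the obstacle to passing to limits: energy may be lost in an almost everywhere
  limit, and then \<open>M (E u)\<close> does not converge to its value at the limit. Monotonicity
  decides the direction of the error: losing energy lowers \<open>M (E u) * E u\<close>, hence keeps
  \<open>J \<le> 0\<close>, and lowers \<open>G\<close>. A minimizer with \<open>J < 0\<close> is
  then excluded by shrinking it.\<close>

type_synonym point = "real^3"

abbreviation lborel2 :: "(point \<times> point) measure" where
  "lborel2 \<equiv> lborel \<Otimes>\<^sub>M lborel"

definition Hs_form :: "real \<Rightarrow> real \<Rightarrow> (point \<Rightarrow> real) \<Rightarrow> (point \<Rightarrow> real) \<Rightarrow> real" where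
  "Hs_form s V0 u v = (\<integral>z. gagliardo_kernel s u v z \<partial>lborel2) + V0 * (\<integral>x. u x * v x \<partial>lborel)"

lemma Hs_energy_eq_form: "Hs_energy s V0 u = Hs_form s V0 u u"
  by (simp add: Hs_energy_def Hs_form_def power2_eq_square)

lemma abs_mult_le_squares: "\<bar>a * b\<bar> \<le> a\<^sup>2 + b\<^sup>2" for a b :: real
proof -
  have "0 \<le> (\<bar>a\<bar> - \<bar>b\<bar>)\<^sup>2" by simp
  then have "2 * (\<bar>a\<bar> * \<bar>b\<bar>) \<le> a\<^sup>2 + b\<^sup>2" by (simp add: power2_diff)
  moreover have "0 \<le> \<bar>a\<bar> * \<bar>b\<bar>" by simp
  ultimately show ?thesis unfolding abs_mult by linarith
qed

lemma square_sum_le: "(a + b)\<^sup>2 \<le> 2 * a\<^sup>2 + 2 * b\<^sup>2" for a b :: real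
proof -
  have "0 \<le> (a - b)\<^sup>2" by simp
  then show ?thesis by (simp add: power2_sum power2_diff)
qed

lemma borel_measurable_gagliardo_kernel [measurable]:
  fixes u v :: "point \<Rightarrow> real"
  assumes [measurable]: "u \<in> borel_measurable borel" "v \<in> borel_measurable borel"
  shows "gagliardo_kernel s u v \<in> borel_measurable lborel2"
  unfolding gagliardo_kernel_def by measurable

lemma integrable_mult_squares:
  fixes f g :: "'a \<Rightarrow> real"
  assumes [measurable]: "f \<in> borel_measurable M" "g \<in> borel_measurable M"
    and "integrable M (\<lambda>x. (f x)\<^sup>2)" "integrable M (\<lambda>x. (g x)\<^sup>2)"
  shows "integrable M (\<lambda>x. f x * g x)"
proof (rule Bochner_Integration.integrable_bound)
  show "integrable M (\<lambda>x. (f x)\<^sup>2 + (g x)\<^sup>2)" using assms by simp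
  show "AE x in M. norm (f x * g x) \<le> norm ((f x)\<^sup>2 + (g x)\<^sup>2)"
    using abs_mult_le_squares by (intro AE_I2) (fastforce intro: order_trans)
qed measurable

text \<open>The singular factor of the kernel. On the diagonal \<open>0 powr a = 0\<close> and
  division by zero make it 0, so kernel identities reduce to algebra of differences without
  excluding x = y.\<close>

definition weight :: "real \<Rightarrow> point \<times> point \<Rightarrow> real" where
  "weight s z = 1 / norm (fst z - snd z) powr (3 + 2 * s)"

lemma weight_nonneg [simp]: "0 \<le> weight s z" by (simp add: weight_def)

lemma gagliardo_kernel_weight:
  "gagliardo_kernel s u v z = (u (fst z) - u (snd z)) * (v (fst z) - v (snd z)) * weight s z"
  by (simp add: gagliardo_kernel_def weight_def case_prod_beta)

lemma gagliardo_kernel_nonneg [simp]: "0 \<le> gagliardo_kernel s u u z"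
  by (simp add: gagliardo_kernel_weight)

lemma HsD:
  assumes "u \<in> Hs s"
  shows Hs_borel: "u \<in> borel_measurable borel"
    and Hs_square: "integrable lborel (\<lambda>x. (u x)\<^sup>2)"
    and Hs_gagliardo: "integrable lborel2 (gagliardo_kernel s u u)"
  using assms by (auto simp: Hs_def)

lemma Hs_integrable_mult:
  assumes "u \<in> Hs s" "v \<in> Hs s"
  shows "integrable lborel (\<lambda>x. u x * v x)"
  using assms by (intro integrable_mult_squares) (auto dest: HsD)

lemma Hs_integrable_kernel:
  assumes "u \<in> Hs s" "v \<in> Hs s"
  shows "integrable lborel2 (gagliardo_kernel s u v)"
proof (rule Bochner_Integration.integrable_bound)
  note [measurable] = assms[THEN Hs_borel]
  show "integrable lborel2 (\<lambda>z. gagliardo_kernel s u u z + gagliardo_kernel s v v z)"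
    using assms by (simp add: Hs_gagliardo)
  show "gagliardo_kernel s u v \<in> borel_measurable lborel2" by measurable
  have "\<bar>gagliardo_kernel s u v z\<bar> \<le> gagliardo_kernel s u u z + gagliardo_kernel s v v z" for z
    using mult_right_mono[OF abs_mult_le_squares[of "u (fst z) - u (snd z)" "v (fst z) - v (snd z)"],
        of "weight s z"]
    unfolding gagliardo_kernel_weight
    by (simp add: abs_mult power2_eq_square distrib_right)
  then show "AE z in lborel2. norm (gagliardo_kernel s u v z)
      \<le> norm (gagliardo_kernel s u u z + gagliardo_kernel s v v z)"
    by (intro AE_I2) (fastforce intro: order_trans)
qed

lemma gagliardo_kernel_lincomb:
  "gagliardo_kernel s (\<lambda>x. a * u x + b * v x) w z
    = a * gagliardo_kernel s u w z + b * gagliardo_kernel s v w z"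
  by (simp add: gagliardo_kernel_weight algebra_simps)

lemma gagliardo_kernel_commute: "gagliardo_kernel s u v = gagliardo_kernel s v u"
  by (auto simp: gagliardo_kernel_weight mult_ac)

lemma gagliardo_kernel_lincomb2:
  "gagliardo_kernel s (\<lambda>x. a * u x + b * v x) (\<lambda>x. a * u x + b * v x) z
    = a\<^sup>2 * gagliardo_kernel s u u z + 2 * a * b * gagliardo_kernel s u v z + b\<^sup>2 * gagliardo_kernel s v v z"
  by (simp add: gagliardo_kernel_weight algebra_simps power2_eq_square)

lemma Hs_lincomb:
  assumes "u \<in> Hs s" "v \<in> Hs s"
  shows "(\<lambda>x. a * u x + b * v x) \<in> Hs s"
proof -
  note [measurable] = assms[THEN Hs_borel]
  have "integrable lborel (\<lambda>x. a\<^sup>2 * (u x)\<^sup>2 + 2 * a * b * (u x * v x) + b\<^sup>2 * (v x)\<^sup>2)"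
    using assms by (simp add: Hs_square Hs_integrable_mult)
  also have "(\<lambda>x. a\<^sup>2 * (u x)\<^sup>2 + 2 * a * b * (u x * v x) + b\<^sup>2 * (v x)\<^sup>2) = (\<lambda>x. (a * u x + b * v x)\<^sup>2)"
    by (auto simp: power2_eq_square algebra_simps)
  finally have 1: "integrable lborel (\<lambda>x. (a * u x + b * v x)\<^sup>2)" .
  have 2: "integrable lborel2 (gagliardo_kernel s (\<lambda>x. a * u x + b * v x) (\<lambda>x. a * u x + b * v x))"
    unfolding gagliardo_kernel_lincomb2[abs_def]
    using assms by (simp add: Hs_gagliardo Hs_integrable_kernel)
  show ?thesis unfolding Hs_def using 1 2 by simp
qed

lemma Hs_scale: "u \<in> Hs s \<Longrightarrow> (\<lambda>x. a * u x) \<in> Hs s"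
  using Hs_lincomb[of u s u a 0] by simp

lemma Hs_diff: "u \<in> Hs s \<Longrightarrow> v \<in> Hs s \<Longrightarrow> (\<lambda>x. u x - v x) \<in> Hs s"
  using Hs_lincomb[of u s v 1 "-1"] by simp

lemma Hs_form_commute: "Hs_form s V0 u v = Hs_form s V0 v u"
  unfolding Hs_form_def by (subst gagliardo_kernel_commute) (simp add: mult.commute)

lemma Hs_form_lincomb:
  assumes "u \<in> Hs s" "v \<in> Hs s" "w \<in> Hs s"
  shows "Hs_form s V0 (\<lambda>x. a * u x + b * v x) w = a * Hs_form s V0 u w + b * Hs_form s V0 v w"
proof -
  have "(\<integral>x. (a * u x + b * v x) * w x \<partial>lborel) = (\<integral>x. a * (u x * w x) + b * (v x * w x) \<partial>lborel)"
    by (simp add: algebra_simps)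
  then show ?thesis
    using assms by (simp add: Hs_form_def gagliardo_kernel_lincomb[abs_def] Hs_integrable_kernel
        Hs_integrable_mult algebra_simps)
qed

lemma Hs_energy_lincomb:
  assumes "u \<in> Hs s" "v \<in> Hs s"
  shows "Hs_energy s V0 (\<lambda>x. a * u x + b * v x)
    = a\<^sup>2 * Hs_energy s V0 u + 2 * a * b * Hs_form s V0 u v + b\<^sup>2 * Hs_energy s V0 v"
proof -
  have "Hs_energy s V0 (\<lambda>x. a * u x + b * v x)
    = a * Hs_form s V0 (\<lambda>x. a * u x + b * v x) u + b * Hs_form s V0 (\<lambda>x. a * u x + b * v x) v"
    unfolding Hs_energy_eq_form
    by (subst Hs_form_lincomb)
      (auto simp: assms Hs_lincomb Hs_form_commute[of _ _ _ "\<lambda>x. a * u x + b * v x"])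
  also have "\<dots> = a\<^sup>2 * Hs_energy s V0 u + 2 * a * b * Hs_form s V0 u v + b\<^sup>2 * Hs_energy s V0 v"
    unfolding Hs_energy_eq_form
    by (simp add: Hs_form_lincomb assms Hs_form_commute[of _ _ v u] power2_eq_square algebra_simps)
  finally show ?thesis .
qed

lemma Hs_energy_scale: "u \<in> Hs s \<Longrightarrow> Hs_energy s V0 (\<lambda>x. a * u x) = a\<^sup>2 * Hs_energy s V0 u"
  using Hs_energy_lincomb[of u s u V0 a 0] by simp

lemma Hs_energy_diff:
  "u \<in> Hs s \<Longrightarrow> v \<in> Hs s \<Longrightarrow> Hs_energy s V0 (\<lambda>x. u x - v x)
    = Hs_energy s V0 u - 2 * Hs_form s V0 u v + Hs_energy s V0 v"
  using Hs_energy_lincomb[of u s v V0 1 "-1"] by simp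

text \<open>If the midpoint cannot have energy below an infimum, this identity bounds the distance
  of two near-minimizers by their excess energy.\<close>

lemma Hs_energy_parallelogram:
  "u \<in> Hs s \<Longrightarrow> v \<in> Hs s \<Longrightarrow> Hs_energy s V0 (\<lambda>x. u x - v x)
    = 2 * Hs_energy s V0 u + 2 * Hs_energy s V0 v - 4 * Hs_energy s V0 (\<lambda>x. 1/2 * u x + 1/2 * v x)"
  by (subst Hs_energy_lincomb) (simp_all add: Hs_energy_diff power2_eq_square)

text \<open>Kept in \<open>ennreal\<close> because the inner integral may be infinite at individual
  points; pointwise estimates then carry no integrability condition.\<close>

definition gagliardo_nn :: "real \<Rightarrow> (point \<Rightarrow> real) \<Rightarrow> point \<Rightarrow> ennreal" where
  "gagliardo_nn s u x = (\<integral>\<^sup>+y. ennreal (gagliardo_kernel s u u (x, y)) \<partial>lborel)"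

lemma borel_measurable_gagliardo_nn [measurable]:
  assumes [measurable]: "u \<in> borel_measurable borel"
  shows "gagliardo_nn s u \<in> borel_measurable borel"
  unfolding gagliardo_nn_def by measurable

lemma nn_integral_gagliardo_nn:
  assumes "u \<in> borel_measurable borel"
  shows "(\<integral>\<^sup>+x. gagliardo_nn s u x \<partial>lborel) = (\<integral>\<^sup>+z. ennreal (gagliardo_kernel s u u z) \<partial>lborel2)"
  unfolding gagliardo_nn_def
  by (rule lborel.nn_integral_fst[of "\<lambda>z. ennreal (gagliardo_kernel s u u z)"]) (use assms in measurable)

locale sobolev =
  fixes s V0 :: real
  assumes s_pos: "0 < s" and s_less: "s < 1" and V0_pos: "0 < V0"
begin

abbreviation "E u \<equiv> Hs_energy s V0 u"
abbreviation "B u v \<equiv> Hs_form s V0 u v"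

lemma E_alt: "E u = (\<integral>z. gagliardo_kernel s u u z \<partial>lborel2) + V0 * (\<integral>x. (u x)\<^sup>2 \<partial>lborel)"
  by (simp add: Hs_energy_def)

lemma E_nonneg [simp]: "0 \<le> E u"
  using V0_pos by (simp add: E_alt)

lemma integral_square_le_E: "u \<in> Hs s \<Longrightarrow> (\<integral>x. (u x)\<^sup>2 \<partial>lborel) \<le> E u / V0"
  using V0_pos by (simp add: E_alt field_simps)

lemma nn_integral_square_le_E:
  assumes "u \<in> Hs s"
  shows "(\<integral>\<^sup>+x. ennreal ((u x)\<^sup>2) \<partial>lborel) \<le> ennreal (E u / V0)"
  using integral_square_le_E[OF assms] V0_pos
  by (subst nn_integral_eq_integral) (auto simp: Hs_square[OF assms] ennreal_leI)

lemma nn_integral_gagliardo_le_E: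
  assumes "u \<in> Hs s"
  shows "(\<integral>\<^sup>+x. gagliardo_nn s u x \<partial>lborel) \<le> ennreal (E u)"
  using V0_pos
  by (subst nn_integral_gagliardo_nn, use assms in \<open>simp add: HsD\<close>, subst nn_integral_eq_integral)
     (auto simp: Hs_gagliardo[OF assms] ennreal_leI E_alt)

text \<open>Stands in for definiteness of the norm, since members of \<open>Hs s\<close> are
  functions and not classes. For the converse, almost every slice of the kernel vanishes, and
  Tonelli does the rest.\<close>

lemma E_eq_0_iff:
  assumes "u \<in> Hs s"
  shows "E u = 0 \<longleftrightarrow> (AE x in lborel. u x = 0)"
proof
  assume "E u = 0"
  then have "(\<integral>x. (u x)\<^sup>2 \<partial>lborel) = 0"
    using integral_square_le_E[OF assms] by (simp add: antisym)
  then show "AE x in lborel. u x = 0"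
    using integral_nonneg_eq_0_iff_AE[of lborel "\<lambda>x. (u x)\<^sup>2"] Hs_square[OF assms] by simp
next
  assume *: "AE x in lborel. u x = 0"
  have [measurable]: "u \<in> borel_measurable borel" using assms by (rule Hs_borel)
  have "AE x in lborel. gagliardo_nn s u x = 0"
    using *
  proof eventually_elim
    case (elim x)
    have "(\<integral>\<^sup>+y. ennreal (gagliardo_kernel s u u (x, y)) \<partial>lborel) = (\<integral>\<^sup>+y. 0 \<partial>(lborel :: point measure))"
      by (rule nn_integral_cong_AE) (use * elim in \<open>auto simp: gagliardo_kernel_def\<close>)
    then show ?case by (simp add: gagliardo_nn_def)
  qed
  then have "(\<integral>\<^sup>+z. ennreal (gagliardo_kernel s u u z) \<partial>lborel2) = 0"
    by (simp add: nn_integral_gagliardo_nn[symmetric] nn_integral_0_iff_AE)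
  then have "(\<integral>z. gagliardo_kernel s u u z \<partial>lborel2) = 0"
    by (simp add: integral_eq_nn_integral Hs_gagliardo assms)
  moreover have "(\<integral>x. (u x)\<^sup>2 \<partial>lborel) = (\<integral>x. 0 \<partial>(lborel :: point measure))"
    by (rule integral_cong_AE) (use * in auto)
  ultimately show "E u = 0" by (simp add: E_alt)
qed

end

section \<open>Cube averages and the fractional Sobolev embedding\<close>

text \<open>The half-open cell containing \<open>x\<close> of the grid of side \<open>r\<close>
  based at the origin. Tying the cube to a grid instead of centring it at \<open>x\<close> leaves
  countably many cubes for each \<open>r\<close>, which the diagonal argument for compactness relies
  on.\<close>

definition cube :: "real \<Rightarrow> point \<Rightarrow> point set" where
  "cube r x = {y. \<forall>i. \<lfloor>y $ i / r\<rfloor> = \<lfloor>x $ i / r\<rfloor>}"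

lemma borel_measurable_vec_nth_comp [measurable (raw)]:
  fixes f :: "'a \<Rightarrow> real^'n"
  assumes "f \<in> borel_measurable M"
  shows "(\<lambda>x. f x $ i) \<in> borel_measurable M"
  by (rule measurable_compose[OF assms]) (intro borel_measurable_continuous_onI continuous_intros)

lemma in_cube_pred [measurable]: "Measurable.pred (borel \<Otimes>\<^sub>M borel) (\<lambda>z. snd z \<in> cube r (fst z))"
  unfolding cube_def mem_Collect_eq by measurable

lemma cube_sets [measurable]: "cube r x \<in> sets borel"
proof -
  have "{y \<in> space borel. \<forall>i. \<lfloor>y $ i / r\<rfloor> = \<lfloor>x $ i / r\<rfloor>} \<in> sets borel" by measurable
  then show ?thesis by (simp add: cube_def)
qed

lemma mem_cube_self [simp]: "x \<in> cube r x" by (simp add: cube_def)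

lemma mem_cube_iff:
  assumes "0 < r"
  shows "y \<in> cube r x \<longleftrightarrow> (\<forall>i. r * \<lfloor>x $ i / r\<rfloor> \<le> y $ i \<and> y $ i < r * \<lfloor>x $ i / r\<rfloor> + r)"
proof -
  have "\<lfloor>y $ i / r\<rfloor> = \<lfloor>x $ i / r\<rfloor> \<longleftrightarrow> r * \<lfloor>x $ i / r\<rfloor> \<le> y $ i \<and> y $ i < r * \<lfloor>x $ i / r\<rfloor> + r" for i
    using assms by (simp add: floor_eq_iff field_simps)
  then show ?thesis by (simp add: cube_def)
qed

lemma norm_diff_cube_le:
  assumes "0 < r" "y \<in> cube r x"
  shows "norm (x - y) \<le> 3 * r"
proof -
  have "\<bar>(x - y) $ i\<bar> \<le> r" for i
  proof -
    have "x \<in> cube r x" by simp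
    with assms mem_cube_iff[OF assms(1)]
    have "r * \<lfloor>x $ i / r\<rfloor> \<le> y $ i" "y $ i < r * \<lfloor>x $ i / r\<rfloor> + r"
      "r * \<lfloor>x $ i / r\<rfloor> \<le> x $ i" "x $ i < r * \<lfloor>x $ i / r\<rfloor> + r"
      by blast+
    then show ?thesis by simp
  qed
  then have "(\<Sum>i\<in>UNIV. \<bar>(x - y) $ i\<bar>) \<le> (\<Sum>i\<in>(UNIV :: 3 set). r)"
    by (intro sum_mono)
  then show ?thesis using norm_le_l1_cart[of "x - y"] by simp
qed

lemma emeasure_cube [simp]:
  assumes "0 < r"
  shows "emeasure lborel (cube r x) = ennreal (r ^ 3)"
proof -
  define a where "a = (\<chi> i. r * \<lfloor>x $ i / r\<rfloor>)"
  define b where "b = (\<chi> i. r * \<lfloor>x $ i / r\<rfloor> + r)"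
  have "box a b \<subseteq> cube r x" "cube r x \<subseteq> cbox a b"
    using assms by (auto simp: mem_cube_iff mem_box_cart a_def b_def less_imp_le)
  then have *: "emeasure lborel (box a b) \<le> emeasure lborel (cube r x)"
    "emeasure lborel (cube r x) \<le> emeasure lborel (cbox a b)"
    by (auto intro!: emeasure_mono)
  have 1: "a \<bullet> k \<le> b \<bullet> k" and 2: "(b - a) \<bullet> k = r" if "k \<in> Basis" for k
    using that assms by (auto simp: Basis_vec_def inner_axis a_def b_def)
  show ?thesis
    using * 1 2 by (simp add: emeasure_lborel_box_eq emeasure_lborel_cbox_eq antisym)
qed

lemma measure_cube [simp]: "0 < r \<Longrightarrow> measure lborel (cube r x) = r ^ 3"
  unfolding measure_def by simp

lemma integrable_indicator_cube: "0 < r \<Longrightarrow> integrable lborel (\<lambda>y. indicator (cube r x) y :: real)"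
  by (rule integrable_real_indicator) simp_all

definition cube_avg :: "real \<Rightarrow> (point \<Rightarrow> real) \<Rightarrow> point \<Rightarrow> real" where
  "cube_avg r u x = (\<integral>y. indicator (cube r x) y * u y \<partial>lborel) / r ^ 3"

lemma borel_measurable_cube_avg [measurable]:
  assumes [measurable]: "u \<in> borel_measurable borel"
  shows "cube_avg r u \<in> borel_measurable borel"
proof -
  have [measurable]: "(\<lambda>z. indicator (cube r (fst z)) (snd z) :: real) \<in> borel_measurable (borel \<Otimes>\<^sub>M borel)"
    unfolding indicator_def by measurable
  have "(\<lambda>(x, y). indicator (cube r x) y * u y) \<in> borel_measurable (borel \<Otimes>\<^sub>M lborel)"
    unfolding case_prod_beta by measurable
  then have "(\<lambda>x. \<integral>y. indicator (cube r x) y * u y \<partial>lborel) \<in> borel_measurable borel"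
    by (rule lborel.borel_measurable_lebesgue_integral)
  then show ?thesis unfolding cube_avg_def by measurable
qed

lemma Hs_integrable_cube:
  assumes "u \<in> Hs s" "0 < r"
  shows "integrable lborel (\<lambda>y. indicator (cube r x) y * u y)"
proof (rule integrable_mult_squares)
  show "integrable lborel (\<lambda>y. (indicator (cube r x) y :: real)\<^sup>2)"
    using integrable_indicator_cube[OF assms(2), of x] by (simp add: power2_eq_square flip: indicator_inter_arith)
qed (use Hs_borel[OF assms(1)] Hs_square[OF assms(1)] in simp_all)

text \<open>Jensen's inequality on the cube, then multiplication and division by norm (x - y)^(3 +
  2s), which is at most (3r)^(3 + 2s) there. The volume r^3 cancels three powers of r.\<close>

lemma square_diff_cube_avg_le:
  assumes u: "u \<in> Hs s" and r: "0 < r" and s: "0 < s"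
  shows "ennreal ((u x - cube_avg r u x)\<^sup>2) \<le> ennreal (3 powr (3 + 2 * s) * r powr (2 * s)) * gagliardo_nn s u x"
proof -
  note [measurable] = Hs_borel[OF u]
  define a c where "a = cube_avg r u x" and "c = u x"
  let ?I = "\<lambda>y. indicator (cube r x) y :: real"
  have I: "integrable lborel ?I" "integrable lborel (\<lambda>y. ?I y * u y)"
    using integrable_indicator_cube[OF r] Hs_integrable_cube[OF u r] by auto
  have Iu2: "integrable lborel (\<lambda>y. ?I y * (u y)\<^sup>2)"
    by (rule Bochner_Integration.integrable_bound[OF Hs_square[OF u]]) (auto simp: indicator_def)
  have a: "(\<integral>y. ?I y * u y \<partial>lborel) = r ^ 3 * a" using r by (simp add: a_def cube_avg_def)
  have int: "integrable lborel (\<lambda>y. ?I y * (c - u y)\<^sup>2)"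
  proof -
    have "integrable lborel (\<lambda>y. c\<^sup>2 * ?I y - 2 * c * (?I y * u y) + ?I y * (u y)\<^sup>2)"
      using I Iu2 by simp
    then show ?thesis by (simp add: power2_diff algebra_simps)
  qed
  \<comment> \<open>Jensen by completing the square: the integrand on the right falls short of
    \<open>(c - u y)\<^sup>2\<close> by exactly \<open>(a - u y)\<^sup>2\<close> on the
    cube.\<close>
  have "r ^ 3 * (c - a)\<^sup>2 = (\<integral>y. ((c - a)\<^sup>2 + 2 * (c - a) * a) * ?I y - 2 * (c - a) * (?I y * u y) \<partial>lborel)"
    using I a r by (simp add: distrib_right)
  also have "\<dots> \<le> (\<integral>y. ?I y * (c - u y)\<^sup>2 \<partial>lborel)"
  proof (rule integral_mono)
    show "integrable lborel (\<lambda>y. ((c - a)\<^sup>2 + 2 * (c - a) * a) * ?I y - 2 * (c - a) * (?I y * u y))"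
      using I by simp
    fix y
    have "(c - u y)\<^sup>2 - ((c - a)\<^sup>2 + 2 * (c - a) * a - 2 * (c - a) * u y) = (a - u y)\<^sup>2"
      by (simp add: power2_eq_square algebra_simps)
    moreover have "0 \<le> (a - u y)\<^sup>2" by simp
    ultimately have "(c - a)\<^sup>2 + 2 * (c - a) * a - 2 * (c - a) * u y \<le> (c - u y)\<^sup>2" by linarith
    then show "((c - a)\<^sup>2 + 2 * (c - a) * a) * ?I y - 2 * (c - a) * (?I y * u y) \<le> ?I y * (c - u y)\<^sup>2"
      by (cases "y \<in> cube r x") simp_all
  qed (rule int)
  finally have "ennreal (r ^ 3 * (c - a)\<^sup>2) \<le> ennreal (\<integral>y. ?I y * (c - u y)\<^sup>2 \<partial>lborel)"
    by (rule ennreal_leI)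
  also have "\<dots> = (\<integral>\<^sup>+y. ennreal (?I y * (c - u y)\<^sup>2) \<partial>lborel)"
    using int by (subst nn_integral_eq_integral) auto
  also have "\<dots> \<le> (\<integral>\<^sup>+y. ennreal ((3 * r) powr (3 + 2 * s)) * ennreal (gagliardo_kernel s u u (x, y)) \<partial>lborel)"
  proof (rule nn_integral_mono)
    fix y
    show "ennreal (?I y * (c - u y)\<^sup>2) \<le> ennreal ((3 * r) powr (3 + 2 * s)) * ennreal (gagliardo_kernel s u u (x, y))"
    proof (cases "y \<in> cube r x \<and> y \<noteq> x")
      case True
      then have n: "0 < norm (x - y)" "norm (x - y) \<le> 3 * r"
        using norm_diff_cube_le[OF r] by auto
      then have "norm (x - y) powr (3 + 2 * s) \<le> (3 * r) powr (3 + 2 * s)"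
        using s by (intro powr_mono2) auto
      moreover have "(c - u y)\<^sup>2 = norm (x - y) powr (3 + 2 * s) * gagliardo_kernel s u u (x, y)"
        using n by (simp add: gagliardo_kernel_def c_def power2_eq_square)
      ultimately have "(c - u y)\<^sup>2 \<le> (3 * r) powr (3 + 2 * s) * gagliardo_kernel s u u (x, y)"
        by (simp add: mult_right_mono)
      then show ?thesis using True by (simp add: ennreal_mult[symmetric] ennreal_leI)
    next
      case False
      then show ?thesis by (auto simp: indicator_def c_def)
    qed
  qed
  also have "\<dots> = ennreal ((3 * r) powr (3 + 2 * s)) * gagliardo_nn s u x"
    unfolding gagliardo_nn_def by (rule nn_integral_cmult) measurable
  finally have *: "ennreal (r ^ 3 * (c - a)\<^sup>2) \<le> ennreal ((3 * r) powr (3 + 2 * s)) * gagliardo_nn s u x" .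
  have "ennreal ((c - a)\<^sup>2) = ennreal (1 / r ^ 3) * ennreal (r ^ 3 * (c - a)\<^sup>2)"
    using r by (simp add: ennreal_mult[symmetric])
  also have "\<dots> \<le> ennreal (1 / r ^ 3) * (ennreal ((3 * r) powr (3 + 2 * s)) * gagliardo_nn s u x)"
    by (intro mult_left_mono *) simp
  also have "\<dots> = ennreal (1 / r ^ 3 * (3 * r) powr (3 + 2 * s)) * gagliardo_nn s u x"
    using r by (subst ennreal_mult) (simp_all add: mult.assoc)
  also have "1 / r ^ 3 * (3 * r) powr (3 + 2 * s) = 3 powr (3 + 2 * s) * r powr (2 * s)"
    using r by (simp add: powr_mult powr_add)
  finally show ?thesis by (simp add: a_def c_def)
qed

text \<open>Replaces Hoelder's inequality: above the level \<open>l\<close> the value is traded for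
  its p-th power, and \<open>l\<close> stays free to be tuned later.\<close>

lemma abs_le_threshold_powr:
  fixes a l :: real
  assumes "0 < l" "1 \<le> p"
  shows "\<bar>a\<bar> \<le> l + l powr (1 - p) * \<bar>a\<bar> powr p"
proof (cases "\<bar>a\<bar> \<le> l")
  case True then show ?thesis by (simp add: add_increasing2)
next
  case False
  then have "\<bar>a\<bar> = \<bar>a\<bar> powr (1 - p) * \<bar>a\<bar> powr p"
    using assms by (simp add: powr_add[symmetric])
  also have "\<dots> \<le> l powr (1 - p) * \<bar>a\<bar> powr p"
    using False assms by (intro mult_right_mono powr_mono2') auto
  finally show ?thesis using assms by simp
qed

lemma abs_cube_avg_le:
  assumes u: "u \<in> Hs s" and r: "0 < r" and l: "0 < l" and p: "1 \<le> p" and K: "0 \<le> K"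
    and bd: "(\<integral>\<^sup>+y. ennreal (indicator (cube r x) y * \<bar>u y\<bar> powr p) \<partial>lborel) \<le> ennreal K"
  shows "\<bar>cube_avg r u x\<bar> \<le> l + l powr (1 - p) * K / r ^ 3"
proof -
  note [measurable] = Hs_borel[OF u]
  let ?I = "\<lambda>y. indicator (cube r x) y :: real"
  have I: "integrable lborel ?I" "integrable lborel (\<lambda>y. ?I y * u y)"
    using integrable_indicator_cube[OF r] Hs_integrable_cube[OF u r] by auto
  have Ip: "integrable lborel (\<lambda>y. ?I y * \<bar>u y\<bar> powr p)"
    by (rule integrableI_bounded) (use bd in \<open>auto intro: le_less_trans\<close>)
  then have "ennreal (\<integral>y. ?I y * \<bar>u y\<bar> powr p \<partial>lborel) \<le> ennreal K"
    using bd by (subst (asm) nn_integral_eq_integral) auto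
  then have K': "(\<integral>y. ?I y * \<bar>u y\<bar> powr p \<partial>lborel) \<le> K" using K by simp
  have "\<bar>\<integral>y. ?I y * u y \<partial>lborel\<bar> \<le> (\<integral>y. \<bar>?I y * u y\<bar> \<partial>lborel)"
    by (rule integral_abs_bound)
  also have "\<dots> \<le> (\<integral>y. l * ?I y + l powr (1 - p) * (?I y * \<bar>u y\<bar> powr p) \<partial>lborel)"
    using I Ip abs_le_threshold_powr[OF l p] by (intro integral_mono) (auto simp: indicator_def)
  also have "\<dots> = l * r ^ 3 + l powr (1 - p) * (\<integral>y. ?I y * \<bar>u y\<bar> powr p \<partial>lborel)"
    using I Ip r by simp
  also have "\<dots> \<le> l * r ^ 3 + l powr (1 - p) * K"
    using K' by (simp add: mult_left_mono)
  finally show ?thesis using r by (simp add: cube_avg_def abs_divide divide_simps mult.commute)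
qed

context sobolev
begin

text \<open>At each point the side of the cube is chosen so large that the average over it is at most
  half of \<open>\<bar>u x\<bar>\<close>; the oscillation estimate then bounds a power of \<open>\<bar>u x\<bar>\<close> by \<open>gagliardo_nn s u x\<close>.\<close>
lemma sobolev_step:
  assumes C: "0 < C" and p: "1 \<le> p"
    and bd: "\<And>u. u \<in> Hs s \<Longrightarrow> E u \<le> 1 \<Longrightarrow> (\<integral>\<^sup>+x. ennreal (\<bar>u x\<bar> powr p) \<partial>lborel) \<le> ennreal C"
  shows "\<exists>C'>0. \<forall>u\<in>Hs s. E u \<le> 1 \<longrightarrow>
    (\<integral>\<^sup>+x. ennreal (\<bar>u x\<bar> powr (2 + 2 * s * p / 3)) \<partial>lborel) \<le> ennreal C'"
proof (intro exI conjI ballI impI)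
  let ?t = "2 * s * p / 3"
  let ?C' = "4 powr (1 + ?t) * (3 powr (3 + 2 * s) * C powr (2 * s / 3))"
  show "0 < ?C'" using C by simp
  fix u assume u: "u \<in> Hs s" and Eu: "E u \<le> 1"
  note [measurable] = Hs_borel[OF u]
  have "ennreal (\<bar>u x\<bar> powr (2 + ?t)) \<le> ennreal ?C' * gagliardo_nn s u x" for x
  proof (cases "u x = 0")
    case False
    \<comment> \<open>\<open>r\<close> is the side for which both terms of
      \<open>abs_cube_avg_le\<close> equal \<open>l\<close>. The average is then at most 2l, half of
      4l = \<bar>u x\<bar>, so the oscillation is at least 2l.\<close>
    define l where "l = \<bar>u x\<bar> / 4"
    define r where "r = (C * l powr (- p)) powr (1/3)"
    have l: "0 < l" using False by (simp add: l_def)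
    have r: "0 < r" using C l by (simp add: r_def)
    have "r powr 3 = C * l powr (- p)" using C l by (simp add: r_def powr_powr)
    then have r3: "r ^ 3 = C * l powr (- p)" using r by simp
    have "(\<integral>\<^sup>+y. ennreal (indicator (cube r x) y * \<bar>u y\<bar> powr p) \<partial>lborel) \<le> (\<integral>\<^sup>+y. ennreal (\<bar>u y\<bar> powr p) \<partial>lborel)"
      by (intro nn_integral_mono ennreal_leI) (auto simp: indicator_def)
    also have "\<dots> \<le> ennreal C" by (rule bd[OF u Eu])
    finally have "\<bar>cube_avg r u x\<bar> \<le> l + l powr (1 - p) * C / r ^ 3"
      by (intro abs_cube_avg_le[OF u r l p]) (use C in auto)
    also have "l powr (1 - p) * C / r ^ 3 = l"
      unfolding r3 using C l by (simp add: powr_diff powr_minus field_simps)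
    finally have "2 * l \<le> \<bar>u x - cube_avg r u x\<bar>" unfolding l_def by linarith
    then have "(2 * l)\<^sup>2 \<le> (u x - cube_avg r u x)\<^sup>2"
      using l by (metis abs_ge_zero abs_le_square_iff abs_of_pos abs_abs mult_pos_pos zero_less_numeral)
    then have "ennreal ((2 * l)\<^sup>2) \<le> ennreal (3 powr (3 + 2 * s) * r powr (2 * s)) * gagliardo_nn s u x"
      using square_diff_cube_avg_le[OF u r s_pos, of x] by (meson ennreal_leI order_trans)
    \<comment> \<open>The factor l^t cancels the l^(-t) hidden in r^(2s); it raises the exponent
      from 2 to 2 + 2sp/3 on the left.\<close>
    then have "ennreal (4 powr (1 + ?t) * l powr ?t) * ennreal ((2 * l)\<^sup>2)
        \<le> ennreal (4 powr (1 + ?t) * l powr ?t) * (ennreal (3 powr (3 + 2 * s) * r powr (2 * s)) * gagliardo_nn s u x)"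
      by (intro mult_left_mono) auto
    also have "\<dots> = ennreal (4 powr (1 + ?t) * l powr ?t * (3 powr (3 + 2 * s) * r powr (2 * s))) * gagliardo_nn s u x"
      by (simp add: ennreal_mult mult.assoc)
    also have "4 powr (1 + ?t) * l powr ?t * (3 powr (3 + 2 * s) * r powr (2 * s)) = ?C'"
    proof -
      have "r powr (2 * s) = C powr (2 * s / 3) * l powr (- ?t)"
        using C l by (simp add: r_def powr_powr powr_mult algebra_simps)
      moreover have "l powr ?t * l powr (- ?t) = 1" using l by (simp flip: powr_add)
      ultimately show ?thesis by (simp add: mult_ac)
    qed
    also have "ennreal (4 powr (1 + ?t) * l powr ?t) * ennreal ((2 * l)\<^sup>2) = ennreal (\<bar>u x\<bar> powr (2 + ?t))"
    proof -
      have "\<bar>u x\<bar> = 4 * l" by (simp add: l_def)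
      then have "\<bar>u x\<bar> powr (2 + ?t) = 4 powr (1 + ?t) * 4 * (l powr 2 * l powr ?t)"
        using l by (simp add: powr_mult powr_add)
      also have "\<dots> = 4 powr (1 + ?t) * l powr ?t * (2 * l)\<^sup>2"
        using l by (simp add: power2_eq_square)
      finally show ?thesis by (simp add: ennreal_mult)
    qed
    finally show ?thesis .
  qed simp
  then have "(\<integral>\<^sup>+x. ennreal (\<bar>u x\<bar> powr (2 + ?t)) \<partial>lborel) \<le> (\<integral>\<^sup>+x. ennreal ?C' * gagliardo_nn s u x \<partial>lborel)"
    by (intro nn_integral_mono)
  also have "\<dots> = ennreal ?C' * (\<integral>\<^sup>+x. gagliardo_nn s u x \<partial>lborel)"
    by (intro nn_integral_cmult) measurable
  also have "\<dots> \<le> ennreal ?C' * 1"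
    using nn_integral_gagliardo_le_E[OF u] Eu
    by (intro mult_left_mono) (auto intro: order_trans simp: ennreal_le_1)
  finally show "(\<integral>\<^sup>+x. ennreal (\<bar>u x\<bar> powr (2 + ?t)) \<partial>lborel) \<le> ennreal ?C'" by simp
qed

section \<open>Subcritical Sobolev embedding\<close>

lemma powr_interpolate:
  fixes a :: real
  assumes "2 \<le> q" "q \<le> p"
  shows "\<bar>a\<bar> powr q \<le> a\<^sup>2 + \<bar>a\<bar> powr p"
proof (cases "\<bar>a\<bar> \<le> 1")
  case True
  show ?thesis
  proof (cases "a = 0")
    case False
    have "\<bar>a\<bar> powr q \<le> \<bar>a\<bar> powr 2" using True assms by (intro powr_mono') auto
    then show ?thesis using False by (simp add: add_increasing2)
  qed simp
next
  case False
  then have "\<bar>a\<bar> powr q \<le> \<bar>a\<bar> powr p" using assms by (intro powr_mono) auto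
  then show ?thesis by (simp add: add_increasing)
qed

text \<open>The exponents \<open>p k\<close> produced by iterating \<open>p \<mapsto> 2 + 2 s p / 3\<close> from \<open>2\<close> increase to the
  fixed point \<open>6 / (3 - 2 s)\<close>.\<close>
lemma sobolev_unit:
  assumes q: "2 \<le> q" "q < 6 / (3 - 2 * s)"
  shows "\<exists>C>0. \<forall>u\<in>Hs s. E u \<le> 1 \<longrightarrow> (\<integral>\<^sup>+x. ennreal (\<bar>u x\<bar> powr q) \<partial>lborel) \<le> ennreal C"
proof -
  define P where "P = 6 / (3 - 2 * s)"
  \<comment> \<open>Closed form of the iteration: each step multiplies the distance to the fixed
    point \<open>P\<close> by 2s/3 < 1.\<close>
  define p where "p k = P - (2 * s / 3) ^ k * (P - 2)" for k
  have P: "P = 2 + 2 * s * P / 3" "2 \<le> P" using s_less s_pos by (auto simp: P_def field_simps)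
  have p2: "2 \<le> p k" for k
  proof -
    have "(2 * s / 3) ^ k \<le> 1" using s_less s_pos by (intro power_le_one) auto
    then have "(2 * s / 3) ^ k * (P - 2) \<le> 1 * (P - 2)" using P by (intro mult_right_mono) auto
    then show ?thesis by (simp add: p_def)
  qed
  have p_Suc: "p (Suc k) = 2 + 2 * s * p k / 3" for k
  proof -
    have "2 + 2 * s * p k / 3 = (2 + 2 * s * P / 3) - (2 * s / 3) ^ Suc k * (P - 2)"
      by (simp add: p_def right_diff_distrib diff_divide_distrib add_diff_eq)
    then show ?thesis using P(1) by (simp add: p_def)
  qed
  have "\<exists>C>0. \<forall>u\<in>Hs s. E u \<le> 1 \<longrightarrow> (\<integral>\<^sup>+x. ennreal (\<bar>u x\<bar> powr p k) \<partial>lborel) \<le> ennreal C" for k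
  proof (induction k)
    case 0
    have "p 0 = 2" by (simp add: p_def)
    then have eq: "\<bar>a\<bar> powr p 0 = a\<^sup>2" for a by (cases "a = 0") auto
    show ?case
    proof (intro exI[of _ "1 / V0"] conjI ballI impI)
      fix u assume u: "u \<in> Hs s" "E u \<le> 1"
      have "E u / V0 \<le> 1 / V0" using u V0_pos by (simp add: divide_right_mono)
      then show "(\<integral>\<^sup>+x. ennreal (\<bar>u x\<bar> powr p 0) \<partial>lborel) \<le> ennreal (1 / V0)"
        unfolding eq using nn_integral_square_le_E[OF u(1)] by (meson ennreal_leI order_trans)
    qed (use V0_pos in simp)
  next
    case (Suc k)
    then obtain C where C: "C > 0" "\<And>u. u \<in> Hs s \<Longrightarrow> E u \<le> 1 \<Longrightarrow> (\<integral>\<^sup>+x. ennreal (\<bar>u x\<bar> powr p k) \<partial>lborel) \<le> ennreal C"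
      by auto
    have "1 \<le> p k" using p2[of k] by simp
    from sobolev_step[OF C(1) this C(2)] show ?case unfolding p_Suc .
  qed
  moreover obtain k where k: "q \<le> p k"
  proof -
    have "(\<lambda>k. (2 * s / 3) ^ k) \<longlonglongrightarrow> 0"
      by (rule LIMSEQ_power_zero) (use s_less s_pos in \<open>simp add: abs_if\<close>)
    then have "p \<longlonglongrightarrow> P - 0 * (P - 2)"
      unfolding p_def by (intro tendsto_diff tendsto_mult tendsto_const)
    then have "eventually (\<lambda>k. q < p k) sequentially" using q by (intro order_tendstoD) (auto simp: P_def)
    then show ?thesis using that by (auto simp: eventually_sequentially intro: less_imp_le)
  qed
  ultimately obtain C where C: "C > 0" "\<And>u. u \<in> Hs s \<Longrightarrow> E u \<le> 1 \<Longrightarrow> (\<integral>\<^sup>+x. ennreal (\<bar>u x\<bar> powr p k) \<partial>lborel) \<le> ennreal C"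
    by metis
  show ?thesis
  proof (intro exI[of _ "1 / V0 + C"] conjI ballI impI)
    fix u assume u: "u \<in> Hs s" "E u \<le> 1"
    note [measurable] = Hs_borel[OF u(1)]
    have "(\<integral>\<^sup>+x. ennreal (\<bar>u x\<bar> powr q) \<partial>lborel) \<le> (\<integral>\<^sup>+x. ennreal ((u x)\<^sup>2) + ennreal (\<bar>u x\<bar> powr p k) \<partial>lborel)"
      using powr_interpolate[OF q(1) k] by (intro nn_integral_mono) (simp add: ennreal_leI flip: ennreal_plus)
    also have "\<dots> = (\<integral>\<^sup>+x. ennreal ((u x)\<^sup>2) \<partial>lborel) + (\<integral>\<^sup>+x. ennreal (\<bar>u x\<bar> powr p k) \<partial>lborel)"
      by (intro nn_integral_add) auto
    also have "\<dots> \<le> ennreal (1 / V0) + ennreal C"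
    proof (intro add_mono C u)
      have "E u / V0 \<le> 1 / V0" using u V0_pos by (simp add: divide_right_mono)
      then show "(\<integral>\<^sup>+x. ennreal ((u x)\<^sup>2) \<partial>lborel) \<le> ennreal (1 / V0)"
        using nn_integral_square_le_E[OF u(1)] by (meson ennreal_leI order_trans)
    qed
    finally show "(\<integral>\<^sup>+x. ennreal (\<bar>u x\<bar> powr q) \<partial>lborel) \<le> ennreal (1 / V0 + C)"
      using V0_pos C by (simp flip: ennreal_plus)
  qed (use V0_pos C in \<open>simp add: add_pos_pos\<close>)
qed

text \<open>The unit case applied to u / sqrt (E u); the power q/2 appears because the energy is
  quadratic. Energy 0 cannot be normalised, but then \<open>u\<close> vanishes almost
  everywhere.\<close>

lemma sobolev_embedding:
  assumes q: "2 \<le> q" "q < 6 / (3 - 2 * s)"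
  shows "\<exists>C>0. \<forall>u\<in>Hs s. integrable lborel (\<lambda>x. \<bar>u x\<bar> powr q) \<and>
    (\<integral>x. \<bar>u x\<bar> powr q \<partial>lborel) \<le> C * E u powr (q / 2)"
proof -
  from sobolev_unit[OF q] obtain C where C: "C > 0"
    "\<And>u. u \<in> Hs s \<Longrightarrow> E u \<le> 1 \<Longrightarrow> (\<integral>\<^sup>+x. ennreal (\<bar>u x\<bar> powr q) \<partial>lborel) \<le> ennreal C" by metis
  show ?thesis
  proof (intro exI[of _ C] conjI C ballI)
    fix u assume u: "u \<in> Hs s"
    note [measurable] = Hs_borel[OF u]
    have "(\<integral>\<^sup>+x. ennreal (\<bar>u x\<bar> powr q) \<partial>lborel) \<le> ennreal (C * E u powr (q / 2))"
    proof (cases "E u = 0")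
      case True
      then have "AE x in lborel. u x = 0" using E_eq_0_iff[OF u] by simp
      then have "AE x in lborel. ennreal (\<bar>u x\<bar> powr q) = 0" by eventually_elim simp
      then have "(\<integral>\<^sup>+x. ennreal (\<bar>u x\<bar> powr q) \<partial>lborel) = 0" by (subst nn_integral_0_iff_AE) auto
      then show ?thesis by simp
    next
      case False
      then have e: "0 < E u" by (simp add: less_le)
      define k where "k = sqrt (E u)"
      have k: "0 < k" "k\<^sup>2 = E u" using e by (auto simp: k_def)
      let ?v = "\<lambda>x. (1 / k) * u x"
      have v: "?v \<in> Hs s" "E ?v \<le> 1"
        using Hs_scale[OF u, of "1 / k"] e unfolding Hs_energy_scale[OF u] by (auto simp: power_divide k(2))
      have "\<bar>u x\<bar> powr q = k powr q * \<bar>?v x\<bar> powr q" for x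
        using k by (simp add: abs_mult flip: powr_mult)
      then have "(\<integral>\<^sup>+x. ennreal (\<bar>u x\<bar> powr q) \<partial>lborel) = (\<integral>\<^sup>+x. ennreal (k powr q) * ennreal (\<bar>?v x\<bar> powr q) \<partial>lborel)"
        by (simp add: ennreal_mult[symmetric])
      also have "\<dots> = ennreal (k powr q) * (\<integral>\<^sup>+x. ennreal (\<bar>?v x\<bar> powr q) \<partial>lborel)"
        by (intro nn_integral_cmult) measurable
      also have "\<dots> \<le> ennreal (k powr q) * ennreal C"
        by (intro mult_left_mono C(2)[OF v]) auto
      also have "\<dots> = ennreal (C * E u powr (q / 2))"
      proof -
        have "k = E u powr (1/2)" using e by (simp add: k_def powr_half_sqrt)
        then have "k powr q = E u powr (q / 2)" by (simp add: powr_powr)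
        then show ?thesis using C by (simp add: mult.commute ennreal_mult)
      qed
      finally show ?thesis .
    qed
    moreover from this show int: "integrable lborel (\<lambda>x. \<bar>u x\<bar> powr q)"
      by (intro integrableI_bounded) (auto intro: le_less_trans)
    ultimately have "ennreal (\<integral>x. \<bar>u x\<bar> powr q \<partial>lborel) \<le> ennreal (C * E u powr (q / 2))"
      by (subst (asm) nn_integral_eq_integral) auto
    then show "(\<integral>x. \<bar>u x\<bar> powr q \<partial>lborel) \<le> C * E u powr (q / 2)"
      using C by simp
  qed
qed

end

section \<open>Fatou properties and local compactness\<close>

lemma integrable_of_nn_integral_le:
  fixes f :: "'a \<Rightarrow> real"
  assumes "f \<in> borel_measurable M" "\<And>x. 0 \<le> f x" "(\<integral>\<^sup>+x. ennreal (f x) \<partial>M) \<le> ennreal c"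
  shows "integrable M f"
  using le_less_trans[OF assms(3) ennreal_less_top] assms(1,2) by (intro integrableI_bounded) auto

lemma integral_le_of_nn_integral_le:
  fixes f :: "'a \<Rightarrow> real"
  assumes "f \<in> borel_measurable M" "\<And>x. 0 \<le> f x" "0 \<le> c" "(\<integral>\<^sup>+x. ennreal (f x) \<partial>M) \<le> ennreal c"
  shows "(\<integral>x. f x \<partial>M) \<le> c"
proof -
  have "ennreal (\<integral>x. f x \<partial>M) \<le> ennreal c"
    using integrable_of_nn_integral_le[OF assms(1,2,4)] assms(2,4) by (subst (asm) nn_integral_eq_integral) auto
  then show ?thesis using assms(3) by simp
qed

text \<open>Fatou's lemma. The bound is only asked eventually so that \<open>c\<close> may be a
  limit of integrals plus an epsilon.\<close>

lemma nn_integral_le_of_AE_limit: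
  assumes [measurable]: "\<And>n. f n \<in> borel_measurable M"
    and lim: "AE x in M. (\<lambda>n. f n x) \<longlonglongrightarrow> g x"
    and bd: "eventually (\<lambda>n. (\<integral>\<^sup>+x. f n x \<partial>M) \<le> c) sequentially"
  shows "(\<integral>\<^sup>+x. g x \<partial>M) \<le> c"
proof -
  have "(\<integral>\<^sup>+x. g x \<partial>M) = (\<integral>\<^sup>+x. liminf (\<lambda>n. f n x) \<partial>M)"
    by (rule nn_integral_cong_AE) (use lim in \<open>auto elim!: eventually_mono dest!: lim_imp_Liminf[rotated]\<close>)
  also have "\<dots> \<le> liminf (\<lambda>n. \<integral>\<^sup>+x. f n x \<partial>M)" by (rule nn_integral_liminf) measurable
  also have "\<dots> \<le> limsup (\<lambda>n. \<integral>\<^sup>+x. f n x \<partial>M)" by (rule Liminf_le_Limsup) simp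
  also have "\<dots> \<le> c" by (rule Limsup_bounded) (use bd in simp)
  finally show ?thesis .
qed

lemma AE_lborel2_fst_snd:
  assumes "AE x in lborel. P x"
  shows "AE z in lborel2. P (fst z) \<and> P (snd z)"
proof -
  from assms obtain N where N: "{x. \<not> P x} \<subseteq> N" "N \<in> sets lborel" "emeasure lborel N = 0"
    by (auto elim!: AE_E)
  then have "N \<times> UNIV \<in> null_sets lborel2" "UNIV \<times> N \<in> null_sets lborel2"
    by (auto simp: null_sets_def lborel.emeasure_pair_measure_Times space_pair_measure)
  then have "N \<times> UNIV \<union> UNIV \<times> N \<in> null_sets lborel2" by auto
  then show ?thesis by (rule AE_I') (use N in auto)
qed

lemma tendsto_gagliardo_kernel:
  assumes "AE x in lborel. (\<lambda>n. u n x) \<longlonglongrightarrow> v x"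
  shows "AE z in lborel2. (\<lambda>n. gagliardo_kernel s (u n) (u n) z) \<longlonglongrightarrow> gagliardo_kernel s v v z"
  using AE_lborel2_fst_snd[OF assms]
  by eventually_elim (auto simp: gagliardo_kernel_weight intro!: tendsto_intros)

context sobolev
begin

text \<open>Fatou on each summand of the energy with the common bound \<open>A\<close> would lose a
  factor. Along a subsequence whose square integrals tend to some \<open>l\<close>, the square
  integral of the limit is at most \<open>l\<close> and its kernel integral at most
  \<open>A - V0 * l\<close>; these add up to \<open>A\<close>.\<close>

lemma E_fatou_bound:
  assumes u: "\<And>n. u n \<in> Hs s" and v [measurable]: "v \<in> borel_measurable borel"
    and lim: "AE x in lborel. (\<lambda>n. u n x) \<longlonglongrightarrow> v x"
    and bd: "\<And>n. E (u n) \<le> A"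
  shows "v \<in> Hs s \<and> E v \<le> A"
proof -
  note [measurable] = u[THEN Hs_borel]
  define b where "b n = (\<integral>x. (u n x)\<^sup>2 \<partial>lborel)" for n
  have b: "0 \<le> b n" "b n \<le> A / V0" for n
    using integral_square_le_E[OF u, of n] divide_right_mono[OF bd[of n], of V0] V0_pos by (auto simp: b_def)
  then have "bounded (range b)" by (intro boundedI[of _ "A / V0"]) auto
  then obtain l and r :: "nat \<Rightarrow> nat" where r: "strict_mono r" "(b \<circ> r) \<longlonglongrightarrow> l"
    using bounded_imp_convergent_subsequence by blast
  have lim': "AE x in lborel. (\<lambda>n. u (r n) x) \<longlonglongrightarrow> v x"
    using lim by eventually_elim (use LIMSEQ_subseq_LIMSEQ[OF _ r(1)] in \<open>auto simp: o_def\<close>)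
  have l: "0 \<le> l" using r(2) b by (intro LIMSEQ_le_const) auto
  have sq: "(\<integral>\<^sup>+x. ennreal ((v x)\<^sup>2) \<partial>lborel) \<le> ennreal (l + e)" if "0 < e" for e
  proof (rule nn_integral_le_of_AE_limit[where f = "\<lambda>n x. ennreal ((u (r n) x)\<^sup>2)"])
    show "AE x in lborel. (\<lambda>n. ennreal ((u (r n) x)\<^sup>2)) \<longlonglongrightarrow> ennreal ((v x)\<^sup>2)"
      using lim' by eventually_elim (intro tendsto_ennrealI tendsto_intros)
    have "eventually (\<lambda>n. (b \<circ> r) n < l + e) sequentially"
      using order_tendstoD(2)[OF r(2), of "l + e"] that by simp
    then show "eventually (\<lambda>n. (\<integral>\<^sup>+x. ennreal ((u (r n) x)\<^sup>2) \<partial>lborel) \<le> ennreal (l + e)) sequentially"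
    proof eventually_elim
      case (elim n)
      then show ?case
        using Hs_square[OF u, of "r n"] by (subst nn_integral_eq_integral) (auto simp: b_def intro!: ennreal_leI)
    qed
  qed measurable
  then have v2: "integrable lborel (\<lambda>x. (v x)\<^sup>2)"
    using sq[of 1] by (intro integrable_of_nn_integral_le[of _ _ "l + 1"]) auto
  have v2': "(\<integral>x. (v x)\<^sup>2 \<partial>lborel) \<le> l + e" if "0 < e" for e
    by (rule integral_le_of_nn_integral_le) (use sq[OF that] l that in auto)
  have ga: "(\<integral>\<^sup>+z. ennreal (gagliardo_kernel s v v z) \<partial>lborel2) \<le> ennreal (A - V0 * l + e)" if "0 < e" for e
  proof (rule nn_integral_le_of_AE_limit[where f = "\<lambda>n z. ennreal (gagliardo_kernel s (u (r n)) (u (r n)) z)"])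
    show "AE z in lborel2. (\<lambda>n. ennreal (gagliardo_kernel s (u (r n)) (u (r n)) z)) \<longlonglongrightarrow> ennreal (gagliardo_kernel s v v z)"
      using tendsto_gagliardo_kernel[OF lim'] by eventually_elim (intro tendsto_ennrealI)
    have "eventually (\<lambda>n. l - e / V0 < (b \<circ> r) n) sequentially"
      using order_tendstoD(1)[OF r(2), of "l - e / V0"] that V0_pos by simp
    then show "eventually (\<lambda>n. (\<integral>\<^sup>+z. ennreal (gagliardo_kernel s (u (r n)) (u (r n)) z) \<partial>lborel2)
        \<le> ennreal (A - V0 * l + e)) sequentially"
    proof eventually_elim
      case (elim n)
      then have "V0 * (l - e / V0) < V0 * b (r n)" using V0_pos by simp
      then have "V0 * l - e < V0 * b (r n)" using V0_pos by (simp add: right_diff_distrib)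
      then have "(\<integral>z. gagliardo_kernel s (u (r n)) (u (r n)) z \<partial>lborel2) \<le> A - V0 * l + e"
        using bd[of "r n"] by (simp add: E_alt b_def)
      then show ?case
        using Hs_gagliardo[OF u, of "r n"] by (subst nn_integral_eq_integral) (auto intro!: ennreal_leI)
    qed
  qed measurable
  have vg: "integrable lborel2 (gagliardo_kernel s v v)"
    using ga[of 1] by (intro integrable_of_nn_integral_le[of _ _ "A - V0 * l + 1"]) auto
  have vg': "(\<integral>z. gagliardo_kernel s v v z \<partial>lborel2) \<le> A - V0 * l + e" if "0 < e" for e
  proof -
    have "A - V0 * l \<ge> 0"
    proof (rule LIMSEQ_le_const[where X = "\<lambda>n. A - V0 * (b \<circ> r) n"])
      show "(\<lambda>n. A - V0 * (b \<circ> r) n) \<longlonglongrightarrow> A - V0 * l" by (intro tendsto_intros r)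
      show "\<exists>N. \<forall>n\<ge>N. 0 \<le> A - V0 * (b \<circ> r) n"
        using b V0_pos by (auto simp: field_simps)
    qed
    then show ?thesis
      by (intro integral_le_of_nn_integral_le) (use ga[OF that] that in auto)
  qed
  have "E v \<le> A + e" if e: "0 < e" for e
  proof -
    \<comment> \<open>Splits the error \<open>e\<close> between the kernel part and
      \<open>V0\<close> times the square part.\<close>
    define d where "d = e / (1 + V0)"
    have "0 < d" "(1 + V0) * d = e" using e V0_pos by (simp_all add: d_def)
    then have d: "0 < d" "d + V0 * d = e" by (simp_all add: distrib_right)
    have "V0 * (\<integral>x. (v x)\<^sup>2 \<partial>lborel) \<le> V0 * (l + d)" using v2'[OF d(1)] V0_pos by simp
    then show ?thesis using vg'[OF d(1)] d(2) by (simp add: E_alt distrib_left)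
  qed
  then have "E v \<le> A" by (rule field_le_epsilon)
  then show ?thesis using v2 vg by (simp add: Hs_def)
qed

lemma E_fatou:
  assumes u: "\<And>n. u n \<in> Hs s" and v: "v \<in> borel_measurable borel"
    and lim: "AE x in lborel. (\<lambda>n. u n x) \<longlonglongrightarrow> v x"
    and A: "(\<lambda>n. E (u n)) \<longlonglongrightarrow> A"
  shows "v \<in> Hs s" "E v \<le> A"
proof -
  have *: "v \<in> Hs s \<and> E v \<le> A + e" if "0 < e" for e
  proof -
    have "eventually (\<lambda>n. E (u n) < A + e) sequentially" using A that by (intro order_tendstoD) auto
    then obtain N where N: "\<And>n. n \<ge> N \<Longrightarrow> E (u n) < A + e" by (auto simp: eventually_sequentially)
    show ?thesis
    proof (rule E_fatou_bound[where u = "\<lambda>n. u (n + N)"])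
      show "AE x in lborel. (\<lambda>n. u (n + N) x) \<longlonglongrightarrow> v x"
        using lim by eventually_elim (rule LIMSEQ_ignore_initial_segment)
    qed (use u v N in \<open>auto intro: less_imp_le\<close>)
  qed
  show "v \<in> Hs s" using *[of 1] by simp
  show "E v \<le> A" using * by (blast intro: field_le_epsilon)
qed

end

text \<open>Increments with squared integral at most 8^(-j) over the ball of radius j remain
  summable after multiplication by 4^j. Hence at almost every x they are eventually bounded by a
  constant times 2^(-j). Letting the balls grow with j makes one subsequence serve all
  radii.\<close>

lemma AE_convergent_of_square_Cauchy:
  fixes w :: "nat \<Rightarrow> point \<Rightarrow> real"
  assumes [measurable]: "\<And>n. w n \<in> borel_measurable borel"
    and cau: "\<And>R e. 0 < e \<Longrightarrow> \<exists>N. \<forall>n\<ge>N. \<forall>m\<ge>N.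
      (\<integral>\<^sup>+x. ennreal (indicator (ball 0 R) x * (w n x - w m x)\<^sup>2) \<partial>lborel) \<le> ennreal e"
  shows "\<exists>r. strict_mono r \<and> (AE x in lborel. convergent (\<lambda>n. w (r n) x))"
proof -
  have "\<forall>j. \<exists>N. \<forall>n\<ge>N. \<forall>m\<ge>N. (\<integral>\<^sup>+x. ennreal (indicator (ball 0 (real j)) x * (w n x - w m x)\<^sup>2) \<partial>lborel)
      \<le> ennreal ((1/8) ^ j)"
    by (rule allI, rule cau) simp
  then obtain N where N: "\<And>j n m. n \<ge> N j \<Longrightarrow> m \<ge> N j \<Longrightarrow>
      (\<integral>\<^sup>+x. ennreal (indicator (ball 0 (real j)) x * (w n x - w m x)\<^sup>2) \<partial>lborel) \<le> ennreal ((1/8) ^ j)"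
    unfolding choice_iff by blast
  \<comment> \<open>The sum forces \<open>N j \<le> r j\<close>, the summand \<open>j\<close> makes
    \<open>r\<close> strictly increasing.\<close>
  define r where "r j = j + (\<Sum>i\<le>j. N i)" for j
  have rN: "N j \<le> r j" for j
  proof -
    have "N j \<le> (\<Sum>i\<le>j. N i)" by (rule member_le_sum) auto
    then show ?thesis by (simp add: r_def)
  qed
  have r: "strict_mono r" by (rule strict_monoI_Suc) (simp add: r_def)
  have [measurable]: "ball (0 :: point) t \<in> sets borel" for t by simp
  define d where "d j x = indicator (ball 0 (real j)) x * (w (r (Suc j)) x - w (r j) x)\<^sup>2" for j and x :: point
  have d_meas [measurable]: "d j \<in> borel_measurable borel" for j unfolding d_def by measurable
  have d0: "0 \<le> d j x" for j x by (simp add: d_def)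
  have "(\<integral>\<^sup>+x. (\<Sum>j. ennreal (4 ^ j * d j x)) \<partial>lborel) = (\<Sum>j. \<integral>\<^sup>+x. ennreal (4 ^ j * d j x) \<partial>lborel)"
    by (rule nn_integral_suminf) measurable
  also have "\<dots> \<le> (\<Sum>j. ennreal ((1/2) ^ j))"
  proof (intro suminf_le summableI)
    fix j
    have "(\<integral>\<^sup>+x. ennreal (4 ^ j * d j x) \<partial>lborel) = ennreal (4 ^ j) * (\<integral>\<^sup>+x. ennreal (d j x) \<partial>lborel)"
      by (subst nn_integral_cmult[symmetric]) (auto simp: ennreal_mult d0)
    also have "\<dots> \<le> ennreal (4 ^ j) * ennreal ((1/8) ^ j)"
      unfolding d_def
      by (intro mult_left_mono N) (use rN[of j] r in \<open>auto intro: order_trans strict_monoD less_imp_le\<close>)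
    also have "\<dots> = ennreal ((1/2) ^ j)"
      by (simp add: ennreal_mult[symmetric] power_mult_distrib[symmetric])
    finally show "(\<integral>\<^sup>+x. ennreal (4 ^ j * d j x) \<partial>lborel) \<le> ennreal ((1/2) ^ j)" .
  qed
  also have "\<dots> < \<infinity>"
    by (subst suminf_ennreal2) (auto intro!: summable_geometric)
  finally have "AE x in lborel. (\<Sum>j. ennreal (4 ^ j * d j x)) \<noteq> \<infinity>"
    by (intro nn_integral_PInf_AE) auto
  then have "AE x in lborel. convergent (\<lambda>n. w (r n) x)"
  proof eventually_elim
    case (elim x)
    then have "(\<Sum>j. ennreal (4 ^ j * d j x)) < top" by (simp add: top.not_eq_extremum)
    then obtain S where S: "0 \<le> S" "(\<Sum>j. ennreal (4 ^ j * d j x)) = ennreal S"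
      by (cases "\<Sum>j. ennreal (4 ^ j * d j x)") auto
    have dS: "4 ^ j * d j x \<le> S" for j
    proof -
      have "ennreal (4 ^ j * d j x) \<le> (\<Sum>j. ennreal (4 ^ j * d j x))"
        using sum_le_suminf[of "\<lambda>j. ennreal (4 ^ j * d j x)" "{j}"] by simp
      then show ?thesis using S by simp
    qed
    obtain J :: nat where J: "norm x < real J" using reals_Archimedean2 by blast
    have "summable (\<lambda>j. w (r (Suc j)) x - w (r j) x)"
    proof (rule summable_comparison_test)
      show "summable (\<lambda>j. sqrt S * (1/2) ^ j)" by (intro summable_mult summable_geometric) simp
      show "\<exists>N. \<forall>n\<ge>N. norm (w (r (Suc n)) x - w (r n) x) \<le> sqrt S * (1/2) ^ n"
      proof (intro exI[of _ J] allI impI)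
        fix j assume "J \<le> j"
        then have "x \<in> ball 0 (real j)" using J by simp
        then have "4 ^ j * (w (r (Suc j)) x - w (r j) x)\<^sup>2 \<le> S" using dS[of j] by (simp add: d_def)
        then have "(2 ^ j * (w (r (Suc j)) x - w (r j) x))\<^sup>2 \<le> S"
          by (simp add: power_mult_distrib power_mult[symmetric] mult.commute[of j] power_mult)
        then have "2 ^ j * \<bar>w (r (Suc j)) x - w (r j) x\<bar> \<le> sqrt S"
          using real_sqrt_le_mono by (fastforce simp: abs_mult)
        then show "norm (w (r (Suc j)) x - w (r j) x) \<le> sqrt S * (1/2) ^ j"
          by (simp add: field_simps power_one_over)
      qed
    qed
    then have "convergent (\<lambda>n. \<Sum>j<n. w (r (Suc j)) x - w (r j) x)"
      by (simp add: summable_iff_convergent)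
    moreover have "(\<Sum>j<n. w (r (Suc j)) x - w (r j) x) = w (r n) x - w (r 0) x" for n
      by (induction n) auto
    ultimately have "convergent (\<lambda>n. w (r n) x - w (r 0) x + w (r 0) x)"
      by (intro convergent_add convergent_const) simp
    then show ?case by simp
  qed
  then show ?thesis using r by blast
qed

lemma square_sum4_le: "((a + b) + (c + d))\<^sup>2 \<le> 4 * ((a\<^sup>2 + b\<^sup>2) + (c\<^sup>2 + d\<^sup>2))" for a b c d :: real
proof -
  have "((a + b) + (c + d))\<^sup>2 \<le> 2 * (a + b)\<^sup>2 + 2 * (c + d)\<^sup>2" by (rule square_sum_le)
  also have "\<dots> \<le> 2 * (2 * a\<^sup>2 + 2 * b\<^sup>2) + 2 * (2 * c\<^sup>2 + 2 * d\<^sup>2)"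
    by (intro add_mono mult_left_mono square_sum_le) simp_all
  finally show ?thesis by simp
qed

context sobolev
begin

lemma nn_integral_cube_square_le:
  assumes u: "u \<in> Hs s"
  shows "(\<integral>\<^sup>+y. ennreal (indicator (cube r x) y * \<bar>u y\<bar> powr 2) \<partial>lborel) \<le> ennreal (E u / V0)"
proof -
  have eq: "\<bar>a\<bar> powr 2 = a\<^sup>2" for a :: real by (cases "a = 0") auto
  have "(\<integral>\<^sup>+y. ennreal (indicator (cube r x) y * \<bar>u y\<bar> powr 2) \<partial>lborel) \<le> (\<integral>\<^sup>+y. ennreal ((u y)\<^sup>2) \<partial>lborel)"
    unfolding eq by (intro nn_integral_mono ennreal_leI) (auto simp: indicator_def)
  also note nn_integral_square_le_E[OF u]
  finally show ?thesis .
qed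

lemma nn_integral_diff_cube_avg_le:
  assumes u: "u \<in> Hs s" and r: "0 < r" and A: "E u \<le> A"
  shows "(\<integral>\<^sup>+x. ennreal ((u x - cube_avg r u x)\<^sup>2) \<partial>lborel) \<le> ennreal (3 powr (3 + 2 * s) * r powr (2 * s) * A)"
proof -
  note [measurable] = Hs_borel[OF u]
  have "0 \<le> A" using A E_nonneg[of u] by linarith
  have "(\<integral>\<^sup>+x. ennreal ((u x - cube_avg r u x)\<^sup>2) \<partial>lborel)
      \<le> (\<integral>\<^sup>+x. ennreal (3 powr (3 + 2 * s) * r powr (2 * s)) * gagliardo_nn s u x \<partial>lborel)"
    by (intro nn_integral_mono square_diff_cube_avg_le u r s_pos)
  also have "\<dots> = ennreal (3 powr (3 + 2 * s) * r powr (2 * s)) * (\<integral>\<^sup>+x. gagliardo_nn s u x \<partial>lborel)"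
    by (intro nn_integral_cmult) measurable
  also have "\<dots> \<le> ennreal (3 powr (3 + 2 * s) * r powr (2 * s)) * ennreal A"
    using nn_integral_gagliardo_le_E[OF u] A by (intro mult_left_mono) (auto intro: order_trans ennreal_leI)
  finally show ?thesis using \<open>0 \<le> A\<close> by (simp add: ennreal_mult)
qed

text \<open>Compactness is stated as convergence almost everywhere; together with \<open>E_fatou\<close> it replaces
  weak convergence throughout.\<close>
lemma rellich:
  fixes u :: "nat \<Rightarrow> point \<Rightarrow> real"
  assumes u: "\<And>n. u n \<in> Hs s" and A: "\<And>n. E (u n) \<le> A"
  shows "\<exists>(r :: nat \<Rightarrow> nat) v. strict_mono r \<and> v \<in> Hs s \<and> (AE x in lborel. (\<lambda>n. u (r n) x) \<longlonglongrightarrow> v x)"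
proof -
  define \<rho> where "\<rho> j = 1 / real (Suc j)" for j
  have \<rho>: "0 < \<rho> j" "\<rho> j \<le> 1" for j by (auto simp: \<rho>_def)
  have \<rho>0: "\<rho> \<longlonglongrightarrow> 0" unfolding \<rho>_def by (rule LIMSEQ_Suc[OF lim_1_over_n])
  note [measurable] = u[THEN Hs_borel]
  have A0: "0 \<le> A" using A[of 0] E_nonneg[of "u 0"] by linarith
  define Q where "Q j m = {y :: point. \<forall>i. \<lfloor>y $ i / \<rho> j\<rfloor> = m $ i}" for j and m :: "int^3"
  have Q: "cube (\<rho> j) x = Q j (\<chi> i. \<lfloor>x $ i / \<rho> j\<rfloor>)" for j x by (simp add: cube_def Q_def)
  have bdQ: "\<bar>\<integral>y. indicator (cube (\<rho> j) x) y * u n y \<partial>lborel\<bar> \<le> 1 + A / V0" for j n x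
  proof -
    let ?I = "\<lambda>y. indicator (cube (\<rho> j) x) y :: real"
    have "\<bar>\<integral>y. ?I y * u n y \<partial>lborel\<bar> \<le> (\<integral>y. \<bar>?I y * u n y\<bar> \<partial>lborel)" by (rule integral_abs_bound)
    also have "\<dots> \<le> (\<integral>y. ?I y + (u n y)\<^sup>2 \<partial>lborel)"
    proof (rule integral_mono)
      show "\<bar>?I y * u n y\<bar> \<le> ?I y + (u n y)\<^sup>2" for y
        using abs_mult_le_squares[of "?I y" "u n y"] by (auto simp: indicator_def split: if_splits)
    qed (use Hs_integrable_cube[OF u \<rho>(1)] integrable_indicator_cube[OF \<rho>(1)] Hs_square[OF u] in auto)
    also have "\<dots> = \<rho> j ^ 3 + (\<integral>y. (u n y)\<^sup>2 \<partial>lborel)"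
      using integrable_indicator_cube[OF \<rho>(1)] Hs_square[OF u] \<rho>(1)[of j] by simp
    also have "\<dots> \<le> 1 + A / V0"
      using integral_square_le_E[OF u, of n] divide_right_mono[OF A[of n], of V0] V0_pos \<rho>[of j]
      by (intro add_mono power_le_one) auto
    finally show ?thesis .
  qed
  \<comment> \<open>A cell integral depends only on \<open>j\<close> and on the integer index of the
    cell. This parameter set is countable and the integrals are uniformly bounded, so a single
    subsequence makes all of them converge.\<close>
  define f where "f n = (\<lambda>(j, m). \<integral>y. indicator (Q j m) y * u n y \<partial>lborel)" for n
  define S where "S = range (\<lambda>(j, x :: point). (j, \<chi> i. \<lfloor>x $ i / \<rho> j\<rfloor>))"
  have "countable S" by simp
  moreover have "norm (f n p) \<le> 1 + A / V0" if "p \<in> S" for n p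
    using that bdQ by (auto simp: S_def f_def Q[symmetric])
  ultimately obtain k where k: "strict_mono (k :: nat \<Rightarrow> nat)" "\<And>p. p \<in> S \<Longrightarrow> \<exists>l. (\<lambda>n. f (k n) p) \<longlonglongrightarrow> l"
    using function_convergent_subsequence[of S f "1 + A / V0"] by blast
  define w where "w n = u (k n)" for n
  have w: "w n \<in> Hs s" "E (w n) \<le> A" for n using u A by (auto simp: w_def)
  note [measurable] = w(1)[THEN Hs_borel]
  define g where "g j x = lim (\<lambda>n. cube_avg (\<rho> j) (w n) x)" for j x
  have g: "(\<lambda>n. cube_avg (\<rho> j) (w n) x) \<longlonglongrightarrow> g j x" for j x
  proof -
    have "(j, \<chi> i. \<lfloor>x $ i / \<rho> j\<rfloor>) \<in> S" by (auto simp: S_def)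
    from k(2)[OF this] obtain l where l: "(\<lambda>n. \<integral>y. indicator (cube (\<rho> j) x) y * w n y \<partial>lborel) \<longlonglongrightarrow> l"
      by (auto simp: f_def Q w_def)
    have "convergent (\<lambda>n. cube_avg (\<rho> j) (w n) x)"
      unfolding cube_avg_def by (rule convergentI[OF tendsto_divide[OF l tendsto_const]]) (use \<rho>(1)[of j] in simp)
    then show ?thesis by (simp add: g_def convergent_LIMSEQ_iff)
  qed
  have g_meas [measurable]: "g j \<in> borel_measurable borel" for j
    by (rule borel_measurable_LIMSEQ_metric[OF _ g]) measurable
  define K where "K j = 1 + A / V0 / \<rho> j ^ 3" for j
  have K: "\<bar>cube_avg (\<rho> j) (w n) x\<bar> \<le> K j" for j n x
  proof -
    have "\<bar>cube_avg (\<rho> j) (w n) x\<bar> \<le> 1 + 1 powr (1 - 2) * (A / V0) / \<rho> j ^ 3"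
    proof (rule abs_cube_avg_le[OF w(1) \<rho>(1)])
      have "E (w n) / V0 \<le> A / V0" using w(2) V0_pos by (simp add: divide_right_mono)
      then show "(\<integral>\<^sup>+y. ennreal (indicator (cube (\<rho> j) x) y * \<bar>w n y\<bar> powr 2) \<partial>lborel) \<le> ennreal (A / V0)"
        using nn_integral_cube_square_le[OF w(1)] by (meson ennreal_leI order_trans)
    qed (use A0 V0_pos in auto)
    then show ?thesis by (simp add: K_def)
  qed
  have gK: "\<bar>g j x\<bar> \<le> K j" for j x
    by (rule LIMSEQ_le_const2[OF tendsto_rabs[OF g]]) (use K in auto)
  have [measurable]: "ball (0 :: point) R \<in> sets borel" for R by simp
  \<comment> \<open>For fixed \<open>j\<close> the averages converge pointwise and are bounded by
    \<open>K j\<close> uniformly in n and x, so dominated convergence applies on a ball.\<close>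
  have a0: "(\<lambda>n. \<integral>\<^sup>+x. ennreal (indicator (ball 0 R) x * (cube_avg (\<rho> j) (w n) x - g j x)\<^sup>2) \<partial>lborel) \<longlonglongrightarrow> 0" for R j
  proof -
    have "(\<lambda>n. \<integral>\<^sup>+x. ennreal (indicator (ball 0 R) x * (cube_avg (\<rho> j) (w n) x - g j x)\<^sup>2) \<partial>lborel)
      \<longlonglongrightarrow> (\<integral>\<^sup>+x. 0 \<partial>(lborel :: point measure))"
    proof (rule nn_integral_dominated_convergence[where w = "\<lambda>x. ennreal (indicator (ball 0 R) x * (2 * K j)\<^sup>2)"])
      have "(\<integral>\<^sup>+x. ennreal (indicator (ball (0 :: point) R) x * (2 * K j)\<^sup>2) \<partial>lborel)
        = (\<integral>\<^sup>+x. ennreal ((2 * K j)\<^sup>2) * indicator (ball (0 :: point) R) x \<partial>lborel)"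
        by (intro nn_integral_cong) (auto simp: indicator_def)
      also have "\<dots> = ennreal ((2 * K j)\<^sup>2) * emeasure lborel (ball (0 :: point) R)"
        by (rule nn_integral_cmult_indicator) simp
      also have "\<dots> < \<infinity>"
        using emeasure_lborel_ball_finite[of "0 :: point" R] by (auto simp: ennreal_mult_less_top)
      finally show "(\<integral>\<^sup>+x. ennreal (indicator (ball (0 :: point) R) x * (2 * K j)\<^sup>2) \<partial>lborel) < \<infinity>" .
      show "AE x in lborel. ennreal (indicator (ball 0 R) x * (cube_avg (\<rho> j) (w n) x - g j x)\<^sup>2)
          \<le> ennreal (indicator (ball 0 R) x * (2 * K j)\<^sup>2)" for n
      proof (intro AE_I2 ennreal_leI mult_left_mono)
        fix x
        have "\<bar>cube_avg (\<rho> j) (w n) x - g j x\<bar> \<le> \<bar>2 * K j\<bar>" using K[of j n x] gK[of j x] by linarith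
        then show "(cube_avg (\<rho> j) (w n) x - g j x)\<^sup>2 \<le> (2 * K j)\<^sup>2" by (simp only: abs_le_square_iff)
      qed simp
      show "AE x in lborel. (\<lambda>n. ennreal (indicator (ball 0 R) x * (cube_avg (\<rho> j) (w n) x - g j x)\<^sup>2)) \<longlonglongrightarrow> 0"
      proof (intro AE_I2)
        fix x
        have "(\<lambda>n. indicator (ball 0 R) x * (cube_avg (\<rho> j) (w n) x - g j x)\<^sup>2) \<longlonglongrightarrow> indicator (ball 0 R) x * (g j x - g j x)\<^sup>2"
          by (intro tendsto_intros g)
        from tendsto_ennrealI[OF this] show "(\<lambda>n. ennreal (indicator (ball 0 R) x * (cube_avg (\<rho> j) (w n) x - g j x)\<^sup>2)) \<longlonglongrightarrow> 0"
          by simp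
      qed
    qed measurable
    then show ?thesis by simp
  qed
  have "\<exists>r. strict_mono r \<and> (AE x in lborel. convergent (\<lambda>n. w (r n) x))"
  proof (rule AE_convergent_of_square_Cauchy)
    fix R e :: real assume e: "0 < e"
    have "(\<lambda>j. 3 powr (3 + 2 * s) * \<rho> j powr (2 * s) * A) \<longlonglongrightarrow> 3 powr (3 + 2 * s) * 0 * A"
      using tendsto_powr'[OF \<rho>0 tendsto_const[of "2 * s"]] s_pos \<rho>
      by (intro tendsto_mult tendsto_const) (auto simp: less_imp_le)
    \<comment> \<open>\<open>j\<close> is chosen first, making the oscillation terms small uniformly
      in n; only then is n taken large for the averages. The 16 is the factor 4 of
      \<open>square_sum4_le\<close> times its four terms.\<close>
    then have "eventually (\<lambda>j. 3 powr (3 + 2 * s) * \<rho> j powr (2 * s) * A < e / 16) sequentially"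
      using e by (intro order_tendstoD(2)[of _ 0]) auto
    then obtain j where j: "3 powr (3 + 2 * s) * \<rho> j powr (2 * s) * A < e / 16"
      by (auto simp: eventually_sequentially)
    have p: "(\<integral>\<^sup>+x. ennreal ((w n x - cube_avg (\<rho> j) (w n) x)\<^sup>2) \<partial>lborel) \<le> ennreal (e / 16)" for n
      using nn_integral_diff_cube_avg_le[OF w(1) \<rho>(1) w(2)] j by (meson ennreal_leI less_imp_le order_trans)
    let ?a = "\<lambda>n x. ennreal (indicator (ball 0 R) x * (cube_avg (\<rho> j) (w n) x - g j x)\<^sup>2)"
    have "eventually (\<lambda>n. (\<integral>\<^sup>+x. ?a n x \<partial>lborel) < ennreal (e / 16)) sequentially"
      using e by (intro order_tendstoD(2)[OF a0]) auto
    then obtain N where N: "\<And>n. n \<ge> N \<Longrightarrow> (\<integral>\<^sup>+x. ?a n x \<partial>lborel) \<le> ennreal (e / 16)"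
      by (auto simp: eventually_sequentially intro: less_imp_le)
    show "\<exists>N. \<forall>n\<ge>N. \<forall>m\<ge>N.
      (\<integral>\<^sup>+x. ennreal (indicator (ball 0 R) x * (w n x - w m x)\<^sup>2) \<partial>lborel) \<le> ennreal e"
    proof (intro exI[of _ N] allI impI)
      fix n m assume nm: "N \<le> n" "N \<le> m"
      let ?b = "\<lambda>n x. ennreal ((w n x - cube_avg (\<rho> j) (w n) x)\<^sup>2)"
      have "(\<integral>\<^sup>+x. ennreal (indicator (ball 0 R) x * (w n x - w m x)\<^sup>2) \<partial>lborel)
        \<le> (\<integral>\<^sup>+x. 4 * ((?b n x + ?a n x) + (?b m x + ?a m x)) \<partial>lborel)"
      proof (rule nn_integral_mono)
        fix x
        let ?p = "\<lambda>n. cube_avg (\<rho> j) (w n) x"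
        have "w n x - w m x = ((w n x - ?p n) + (?p n - g j x)) + (- (w m x - ?p m) + - (?p m - g j x))" by simp
        also have "\<dots>\<^sup>2 \<le> 4 * (((w n x - ?p n)\<^sup>2 + (?p n - g j x)\<^sup>2) + ((w m x - ?p m)\<^sup>2 + (?p m - g j x)\<^sup>2))"
          using square_sum4_le[of "w n x - ?p n" "?p n - g j x" "- (w m x - ?p m)" "- (?p m - g j x)"]
          by (simp only: power2_minus)
        finally have "ennreal (indicator (ball 0 R) x * (w n x - w m x)\<^sup>2) \<le> ennreal (4 *
            (((w n x - ?p n)\<^sup>2 + indicator (ball 0 R) x * (?p n - g j x)\<^sup>2) + ((w m x - ?p m)\<^sup>2 + indicator (ball 0 R) x * (?p m - g j x)\<^sup>2)))"
          by (intro ennreal_leI) (auto simp: indicator_def)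
        also have "\<dots> = 4 * ((?b n x + ?a n x) + (?b m x + ?a m x))"
          by (simp add: ennreal_mult ennreal_plus)
        finally show "ennreal (indicator (ball 0 R) x * (w n x - w m x)\<^sup>2) \<le> 4 * ((?b n x + ?a n x) + (?b m x + ?a m x))" .
      qed
      also have "\<dots> = 4 * (((\<integral>\<^sup>+x. ?b n x \<partial>lborel) + (\<integral>\<^sup>+x. ?a n x \<partial>lborel)) + ((\<integral>\<^sup>+x. ?b m x \<partial>lborel) + (\<integral>\<^sup>+x. ?a m x \<partial>lborel)))"
        by (simp add: nn_integral_cmult nn_integral_add)
      also have "\<dots> \<le> 4 * ((ennreal (e / 16) + ennreal (e / 16)) + (ennreal (e / 16) + ennreal (e / 16)))"
        by (intro mult_left_mono add_mono p N nm) auto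
      also have "\<dots> = ennreal e" using e by (simp add: ennreal_numeral[symmetric] flip: ennreal_plus ennreal_mult del: ennreal_numeral)
      finally show "(\<integral>\<^sup>+x. ennreal (indicator (ball 0 R) x * (w n x - w m x)\<^sup>2) \<partial>lborel) \<le> ennreal e" .
    qed
  qed measurable
  then obtain r where r: "strict_mono r" "AE x in lborel. convergent (\<lambda>n. w (r n) x)" by blast
  define v where "v x = lim (\<lambda>n. w (r n) x)" for x
  have [measurable]: "v \<in> borel_measurable borel" unfolding v_def by measurable
  have lim: "AE x in lborel. (\<lambda>n. w (r n) x) \<longlonglongrightarrow> v x"
    using r(2) by eventually_elim (simp add: v_def convergent_LIMSEQ_iff)
  have "v \<in> Hs s" using E_fatou_bound[OF w(1) _ lim w(2)] by simp
  moreover have "strict_mono (k \<circ> r)" using k(1) r(1) by (rule strict_mono_o)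
  ultimately show ?thesis using lim by (intro exI[of _ "k \<circ> r"] exI[of _ v]) (simp add: w_def)
qed

end

section \<open>Radial functions\<close>

lemma Hs_form_cong_AE:
  assumes [measurable]: "u \<in> borel_measurable borel" "u' \<in> borel_measurable borel"
    "v \<in> borel_measurable borel" "v' \<in> borel_measurable borel"
    and "AE x in lborel. u x = u' x" "AE x in lborel. v x = v' x"
  shows "Hs_form s V0 u v = Hs_form s V0 u' v'"
proof -
  have "(\<integral>z. gagliardo_kernel s u v z \<partial>lborel2) = (\<integral>z. gagliardo_kernel s u' v' z \<partial>lborel2)"
    using AE_lborel2_fst_snd[OF assms(5)] AE_lborel2_fst_snd[OF assms(6)]
    by (intro integral_cong_AE; measurable?) (auto simp: gagliardo_kernel_weight elim!: eventually_elim2)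
  moreover have "(\<integral>x. u x * v x \<partial>lborel) = (\<integral>x. u' x * v' x \<partial>lborel)"
    using assms(5,6) by (intro integral_cong_AE; measurable?) (auto elim!: eventually_elim2)
  ultimately show ?thesis by (simp add: Hs_form_def)
qed

section \<open>Invariance of the measure, the space and the form under orthogonal maps\<close>

lemma distr_lborel_orthogonal:
  fixes g :: "point \<Rightarrow> point"
  assumes g: "orthogonal_transformation g"
  shows "distr lborel borel g = lborel"
proof (rule lborel_eqI[symmetric])
  fix l u :: point
  assume lu: "\<And>b. b \<in> Basis \<Longrightarrow> l \<bullet> b \<le> u \<bullet> b"
  have lin: "linear g" and bij: "bij g" using g orthogonal_transformation_linear orthogonal_transformation_bij by blast+
  have [measurable]: "g \<in> borel_measurable borel"
    using lin by (intro borel_measurable_continuous_onI linear_continuous_on linear_conv_bounded_linear[THEN iffD1])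
  define h where "h = inv g"
  have h: "orthogonal_transformation h" "linear h"
    using g orthogonal_transformation_inv orthogonal_transformation_linear unfolding h_def by blast+
  \<comment> \<open>The preimage becomes a linear image under the inverse, whose determinant has
    absolute value 1.\<close>
  have vim: "g -` box l u = h ` box l u" using bij by (simp add: h_def bij_vimage_eq_inv_image)
  have *: "h ` box l u \<in> lmeasurable" "measure lebesgue (h ` box l u) = \<bar>det (matrix h)\<bar> * measure lebesgue (box l u)"
    using h(2) by (simp_all only: measurable_linear_image measure_linear_image lmeasurable_box)
  have "g -` box l u \<in> sets borel" using measurable_sets[of g borel borel "box l u"] by simp
  then have "emeasure lborel (g -` box l u) = emeasure lebesgue (h ` box l u)" by (simp add: vim)
  also have "\<dots> = ennreal (measure lebesgue (box l u))"
    using * h(1) by (simp add: emeasure_eq_measure2)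
  also have "\<dots> = emeasure lborel (box l u)"
    using emeasure_eq_ennreal_measure[of lborel "box l u"] emeasure_lborel_box_finite[of l u] by simp
  also have "\<dots> = (\<Prod>b\<in>Basis. (u - l) \<bullet> b)" using lu by simp
  finally show "emeasure (distr lborel borel g) (box l u) = (\<Prod>b\<in>Basis. (u - l) \<bullet> b)"
    by (simp add: emeasure_distr)
qed simp

lemma orthogonal_measurable [measurable_dest]:
  fixes g :: "point \<Rightarrow> point"
  assumes "orthogonal_transformation g"
  shows "g \<in> borel_measurable borel"
  using orthogonal_transformation_linear[OF assms]
  by (intro borel_measurable_continuous_onI linear_continuous_on linear_conv_bounded_linear[THEN iffD1])

lemma distr_lborel2_orthogonal:
  fixes g :: "point \<Rightarrow> point"
  assumes g: "orthogonal_transformation g"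
  shows "distr lborel2 lborel2 (\<lambda>(x, y). (g x, g y)) = lborel2"
proof -
  have m: "g \<in> lborel \<rightarrow>\<^sub>M lborel" using orthogonal_measurable[OF g] by simp
  have d: "distr lborel lborel g = lborel"
    using distr_lborel_orthogonal[OF g] by (simp cong: distr_cong)
  have "sigma_finite_measure (distr lborel lborel g)"
    unfolding d by (rule lborel.sigma_finite_measure_axioms)
  from pair_measure_distr[OF m m this] show ?thesis unfolding d by (rule sym)
qed

lemma nn_integral_orthogonal:
  fixes g :: "point \<Rightarrow> point"
  assumes g: "orthogonal_transformation g" and [measurable]: "F \<in> borel_measurable borel"
  shows "(\<integral>\<^sup>+x. F (g x) \<partial>lborel) = (\<integral>\<^sup>+x. F x \<partial>lborel)"
  using g by (subst (2) distr_lborel_orthogonal[OF g, symmetric]) (simp add: nn_integral_distr orthogonal_measurable)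

lemma integral_orthogonal:
  fixes g :: "point \<Rightarrow> point" and F :: "point \<Rightarrow> real"
  assumes g: "orthogonal_transformation g" and [measurable]: "F \<in> borel_measurable borel"
  shows "(\<integral>x. F (g x) \<partial>lborel) = (\<integral>x. F x \<partial>lborel)"
  using g by (subst (2) distr_lborel_orthogonal[OF g, symmetric]) (simp add: integral_distr orthogonal_measurable)

lemma integrable_orthogonal:
  fixes g :: "point \<Rightarrow> point" and F :: "point \<Rightarrow> real"
  assumes g: "orthogonal_transformation g" and [measurable]: "F \<in> borel_measurable borel"
  shows "integrable lborel (\<lambda>x. F (g x)) \<longleftrightarrow> integrable lborel F"
  using g by (subst (2) distr_lborel_orthogonal[OF g, symmetric]) (simp add: integrable_distr_eq orthogonal_measurable)

lemma AE_orthogonal: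
  fixes g :: "point \<Rightarrow> point"
  assumes g: "orthogonal_transformation g" and "AE x in lborel. P x"
  shows "AE x in lborel. P (g x)"
proof (rule AE_distrD[of g lborel borel])
  show "g \<in> lborel \<rightarrow>\<^sub>M borel" using orthogonal_measurable[OF g] by simp
  show "AE x in distr lborel borel g. P x" unfolding distr_lborel_orthogonal[OF g] by (rule assms(2))
qed

lemma norm_diff_orthogonal:
  "orthogonal_transformation g \<Longrightarrow> norm (g x - g y) = norm (x - y)"
  by (metis linear_diff orthogonal_transformation)

lemma gagliardo_kernel_orthogonal:
  fixes g :: "point \<Rightarrow> point"
  assumes g: "orthogonal_transformation g"
  shows "gagliardo_kernel s (\<lambda>x. u (g x)) (\<lambda>x. v (g x)) = (\<lambda>z. gagliardo_kernel s u v (case z of (x, y) \<Rightarrow> (g x, g y)))"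
  using norm_diff_orthogonal[OF g] by (auto simp: gagliardo_kernel_def fun_eq_iff)

lemma measurable_orthogonal_pair:
  fixes g :: "point \<Rightarrow> point"
  assumes g: "orthogonal_transformation g"
  shows "(\<lambda>(x, y). (g x, g y)) \<in> lborel2 \<rightarrow>\<^sub>M lborel2"
  using orthogonal_measurable[OF g] by measurable

lemma Hs_orthogonal:
  assumes g: "orthogonal_transformation g" and u: "u \<in> Hs s"
  shows "(\<lambda>x. u (g x)) \<in> Hs s"
proof -
  note [measurable] = Hs_borel[OF u] orthogonal_measurable[OF g]
  have "integrable lborel (\<lambda>x. (u (g x))\<^sup>2)"
    using integrable_orthogonal[OF g, of "\<lambda>x. (u x)\<^sup>2"] Hs_square[OF u] by simp
  moreover have "integrable lborel2 (gagliardo_kernel s (\<lambda>x. u (g x)) (\<lambda>x. u (g x)))"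
    unfolding gagliardo_kernel_orthogonal[OF g]
    using Hs_gagliardo[OF u] by (intro integrable_distr[OF measurable_orthogonal_pair[OF g]]) (simp add: distr_lborel2_orthogonal[OF g])
  ultimately show ?thesis by (simp add: Hs_def)
qed

lemma Hs_form_orthogonal:
  assumes g: "orthogonal_transformation g" and u: "u \<in> Hs s" and v: "v \<in> Hs s"
  shows "Hs_form s V0 (\<lambda>x. u (g x)) (\<lambda>x. v (g x)) = Hs_form s V0 u v"
proof -
  note [measurable] = Hs_borel[OF u] Hs_borel[OF v]
  have "(\<integral>z. gagliardo_kernel s u v z \<partial>distr lborel2 lborel2 (\<lambda>(x, y). (g x, g y)))
    = (\<integral>z. gagliardo_kernel s u v (case z of (x, y) \<Rightarrow> (g x, g y)) \<partial>lborel2)"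
    by (rule integral_distr[OF measurable_orthogonal_pair[OF g]]) measurable
  then show ?thesis
    using integral_orthogonal[OF g, of "\<lambda>x. u x * v x"]
    by (simp add: Hs_form_def gagliardo_kernel_orthogonal[OF g] distr_lborel2_orthogonal[OF g])
qed

text \<open>Invariance as classes: the exceptional null set may depend on \<open>g\<close>. This is
  what almost everywhere limits and uniqueness of energy minimizers deliver.\<close>

definition radial :: "(point \<Rightarrow> real) \<Rightarrow> bool" where
  "radial u \<longleftrightarrow> (\<forall>g. orthogonal_transformation g \<longrightarrow> (AE x in lborel. u (g x) = u x))"

lemma radialD: "radial u \<Longrightarrow> orthogonal_transformation g \<Longrightarrow> AE x in lborel. u (g x) = u x"
  by (simp add: radial_def)

lemma radial_lincomb: "radial u \<Longrightarrow> radial v \<Longrightarrow> radial (\<lambda>x. a * u x + b * v x)"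
  unfolding radial_def[of "\<lambda>x. a * u x + b * v x"]
proof (intro allI impI)
  fix g :: "point \<Rightarrow> point" assume uv: "radial u" "radial v" and g: "orthogonal_transformation g"
  show "AE x in lborel. a * u (g x) + b * v (g x) = a * u x + b * v x"
    using radialD[OF uv(1) g] radialD[OF uv(2) g] by eventually_elim simp
qed

lemma radial_scale: "radial u \<Longrightarrow> radial (\<lambda>x. a * u x)"
  using radial_lincomb[of u u a 0] by simp

lemma radial_AE_limit:
  assumes u: "\<And>n. radial (u n)" and lim: "AE x in lborel. (\<lambda>n. u n x) \<longlonglongrightarrow> v x"
  shows "radial v"
  unfolding radial_def
proof (intro allI impI)
  fix g :: "point \<Rightarrow> point" assume g: "orthogonal_transformation g"
  have "AE x in lborel. \<forall>n. u n (g x) = u n x" using radialD[OF u g] by (simp add: AE_all_countable)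
  with AE_orthogonal[OF g lim] lim show "AE x in lborel. v (g x) = v x"
    by eventually_elim (auto intro: LIMSEQ_unique)
qed

text \<open>On the great circle through \<open>x\<close> there are \<open>N\<close> points with mutual distance at least \<open>norm x / N\<close>.\<close>
lemma nn_integral_ball_radial_le:
  fixes u :: "point \<Rightarrow> real"
  assumes rad: "radial u" and [measurable]: "u \<in> borel_measurable borel"
    and N: "0 < N" and \<rho>: "0 < \<rho>" and x: "2 * \<rho> * real N \<le> norm x"
  shows "of_nat N * (\<integral>\<^sup>+y. ennreal (indicator (ball x \<rho>) y * (u y)\<^sup>2) \<partial>lborel) \<le> (\<integral>\<^sup>+y. ennreal ((u y)\<^sup>2) \<partial>lborel)"
proof -
  have x0: "0 < norm x" using x N \<rho> by (smt (verit, ccfv_threshold) mult_pos_pos of_nat_0_less_iff)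
  have "2 \<le> DIM(point)" by simp
  then obtain e' :: point where e': "e' \<noteq> 0" "orthogonal x e'"
    using orthogonal_to_vector_exists[of x] by blast
  define e where "e = (norm x / norm e') *\<^sub>R e'"
  have e: "norm e = norm x" "x \<bullet> e = 0" using e' by (auto simp: e_def orthogonal_def)
  \<comment> \<open>Only the components along \<open>x\<close> are spaced evenly. By Cauchy-Schwarz
    the inner product with \<open>x\<close> alone then separates the points, and no angles are
    needed.\<close>
  define a where "a k = 1 - real k / real N" for k
  define y where "y k = a k *\<^sub>R x + sqrt (1 - (a k)\<^sup>2) *\<^sub>R e" for k
  have a: "0 \<le> a k" "a k \<le> 1" if "k < N" for k using that by (auto simp: a_def)
  have ny: "norm (y k) = norm x" if "k < N" for k
  proof -
    have "(a k)\<^sup>2 \<le> 1" using a[OF that] by (simp add: power_le_one)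
    moreover have "orthogonal (a k *\<^sub>R x) (sqrt (1 - (a k)\<^sup>2) *\<^sub>R e)"
      using e(2) by (simp add: orthogonal_def)
    ultimately have "(norm (y k))\<^sup>2 = (norm x)\<^sup>2"
      unfolding y_def by (simp add: norm_add_Pythagorean power_mult_distrib e(1) algebra_simps)
    then show ?thesis by simp
  qed
  have dist: "2 * \<rho> \<le> dist (y k) (y j)" if "k < N" "j < N" "k \<noteq> j" for k j
  proof -
    have "(y k - y j) \<bullet> x = (a k - a j) * (norm x)\<^sup>2"
      using e by (simp add: y_def inner_diff_left inner_add_left inner_commute[of e x] power2_norm_eq_inner algebra_simps)
    moreover have "\<bar>(y k - y j) \<bullet> x\<bar> \<le> norm (y k - y j) * norm x" by (rule Cauchy_Schwarz_ineq2)
    ultimately have "\<bar>a k - a j\<bar> * norm x * norm x \<le> norm (y k - y j) * norm x"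
      by (simp add: abs_mult power2_eq_square mult.assoc)
    then have *: "\<bar>a k - a j\<bar> * norm x \<le> norm (y k - y j)" using x0 by simp
    have "1 \<le> \<bar>real j - real k\<bar>" using that by linarith
    then have "1 / real N \<le> \<bar>a k - a j\<bar>"
      using N by (simp add: a_def diff_divide_distrib[symmetric] abs_divide divide_right_mono)
    then have "1 / real N * norm x \<le> \<bar>a k - a j\<bar> * norm x" by (intro mult_right_mono) auto
    moreover have "2 * \<rho> \<le> 1 / real N * norm x" using x N by (simp add: field_simps)
    ultimately show ?thesis using * by (simp add: dist_norm)
  qed
  \<comment> \<open>All the balls carry the same mass, because an orthogonal map takes
    \<open>x\<close> to each centre, and they are disjoint because the centres are at least two
    radii apart.\<close>
  let ?I = "\<lambda>c. \<integral>\<^sup>+z. ennreal (indicator (ball c \<rho>) z * (u z)\<^sup>2) \<partial>lborel"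
  have [measurable]: "ball (c :: point) \<rho> \<in> sets borel" for c by simp
  have I: "?I (y k) = ?I x" if "k < N" for k
  proof -
    have "norm x = norm (y k)" using ny[OF that] by simp
    then obtain g where g: "orthogonal_transformation g" "g x = y k"
      using orthogonal_transformation_exists by blast
    have ball: "indicator (ball (g x) \<rho>) (g z) = (indicator (ball x \<rho>) z :: real)" for z
    proof -
      have "dist (g x) (g z) = dist x z"
        using norm_diff_orthogonal[OF g(1)] by (simp add: dist_norm)
      then show ?thesis by (simp add: indicator_def)
    qed
    have "?I (y k) = (\<integral>\<^sup>+z. ennreal (indicator (ball (y k) \<rho>) (g z) * (u (g z))\<^sup>2) \<partial>lborel)"
      by (rule nn_integral_orthogonal[OF g(1), symmetric]) measurable
    also have "\<dots> = ?I x"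
      using radialD[OF rad g(1)] by (intro nn_integral_cong_AE) (auto simp: ball g(2)[symmetric])
    finally show ?thesis .
  qed
  have "of_nat N * ?I x = (\<Sum>k<N. ?I (y k))" using I by simp
  also have "\<dots> = (\<integral>\<^sup>+z. (\<Sum>k<N. ennreal (indicator (ball (y k) \<rho>) z * (u z)\<^sup>2)) \<partial>lborel)"
    by (rule nn_integral_sum[symmetric]) measurable
  also have "\<dots> \<le> (\<integral>\<^sup>+z. ennreal ((u z)\<^sup>2) \<partial>lborel)"
  proof (rule nn_integral_mono)
    fix z
    show "(\<Sum>k<N. ennreal (indicator (ball (y k) \<rho>) z * (u z)\<^sup>2)) \<le> ennreal ((u z)\<^sup>2)"
    proof (cases "\<exists>k<N. z \<in> ball (y k) \<rho>")
      case True
      then obtain k where k: "k < N" "z \<in> ball (y k) \<rho>" by auto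
      have "z \<notin> ball (y j) \<rho>" if "j < N" "j \<noteq> k" for j
        using dist[OF k(1) that(1)] that(2) k(2) dist_triangle2[of "y k" "y j" z] by auto
      then have "(\<Sum>j<N. ennreal (indicator (ball (y j) \<rho>) z * (u z)\<^sup>2))
          = (\<Sum>j<N. if j = k then ennreal ((u z)\<^sup>2) else 0)"
        using k by (intro sum.cong) (auto simp: indicator_def)
      also have "\<dots> = ennreal ((u z)\<^sup>2)" using k(1) by (simp add: sum.delta)
      finally show ?thesis by (rule order_eq_refl)
    next
      case False
      then have "(\<Sum>j<N. ennreal (indicator (ball (y j) \<rho>) z * (u z)\<^sup>2)) = (\<Sum>j<N. 0)"
        by (intro sum.cong) (auto simp: indicator_def)
      also have "\<dots> \<le> ennreal ((u z)\<^sup>2)" by simp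
      finally show ?thesis .
    qed
  qed
  finally show ?thesis .
qed

context sobolev
begin

text \<open>A Chebyshev argument. Far out, a cube carries at most the fraction 1/N of the total
  square integral, so the average there is at most d/2. Where \<bar>u x\<bar> exceeds
  \<open>d\<close>, the oscillation then exceeds d/2, and the integrated oscillation estimate bounds
  the measure of such points.\<close>

lemma radial_tail:
  assumes d: "0 < d" and e: "0 < e"
  shows "\<exists>R. \<forall>u\<in>Hs s. radial u \<longrightarrow> E u \<le> A \<longrightarrow> emeasure lborel {x. R < norm x \<and> d < \<bar>u x\<bar>} \<le> ennreal e"
proof (cases "0 \<le> A")
  case False
  then have "\<not> E u \<le> A" for u using E_nonneg[of u] by linarith
  then show ?thesis by blast
next
  case A0: True
  define Cs where "Cs = (3 :: real) powr (3 + 2 * s)"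
  define l where "l = d / 4"
  have l: "0 < l" using d by (simp add: l_def)
  obtain r where r: "0 < r" "Cs * r powr (2 * s) * A \<le> e * (2 * l)\<^sup>2"
  proof
    \<comment> \<open>Solves Cs r^(2s) (A + 1) = e (2l)^2 for r; the + 1 keeps the denominator
      positive when A = 0.\<close>
    define t where "t = e * (2 * l)\<^sup>2 / (Cs * (A + 1))"
    have t: "0 < t" using e l A0 by (auto simp: t_def Cs_def intro!: divide_pos_pos mult_pos_pos)
    show "0 < t powr (1 / (2 * s))" using t by simp
    have "(t powr (1 / (2 * s))) powr (2 * s) = t" using t s_pos by (simp add: powr_powr)
    then have "Cs * (t powr (1 / (2 * s))) powr (2 * s) * A = e * (2 * l)\<^sup>2 * (A / (A + 1))"
      using A0 by (simp add: t_def Cs_def)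
    also have "\<dots> \<le> e * (2 * l)\<^sup>2 * 1" using A0 e by (intro mult_left_mono) auto
    finally show "Cs * (t powr (1 / (2 * s))) powr (2 * s) * A \<le> e * (2 * l)\<^sup>2" by simp
  qed
  \<comment> \<open>The mass per cube for which both terms of \<open>abs_cube_avg_le\<close> with
    exponent 2 equal \<open>l\<close>.\<close>
  define K where "K = l\<^sup>2 * r ^ 3"
  have K: "0 < K" using l r by (simp add: K_def)
  obtain N :: nat where "A / V0 / K < real N" using reals_Archimedean2 by blast
  then have N: "A / V0 < K * real N" using pos_divide_less_eq[OF K, of "A / V0" "real N"] by (simp only: mult.commute)
  have "0 \<le> A / V0" using A0 V0_pos by simp
  then have "0 < N" using N K by (cases "N = 0") auto
  show ?thesis
  \<comment> \<open>The cube of side \<open>r\<close> stays within distance 3r of \<open>x\<close>,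
    hence inside the ball of radius 4r; beyond this distance from the origin N disjoint rotated
    copies of that ball fit.\<close>
  proof (intro exI[of _ "2 * (4 * r) * real N"] ballI impI)
    fix u assume u: "u \<in> Hs s" and rad: "radial u" and Eu: "E u \<le> A"
    note [measurable] = Hs_borel[OF u]
    let ?S = "{x. 2 * (4 * r) * real N < norm x \<and> d < \<bar>u x\<bar>}"
    have "ennreal ((2 * l)\<^sup>2) * indicator ?S x \<le> ennreal ((u x - cube_avg r u x)\<^sup>2)" for x
    proof (cases "x \<in> ?S")
      case True
      have sub: "cube r x \<subseteq> ball x (4 * r)"
        using norm_diff_cube_le[OF r(1), of _ x] r(1) by (fastforce simp: dist_norm)
      have "of_nat N * (\<integral>\<^sup>+y. ennreal (indicator (cube r x) y * \<bar>u y\<bar> powr 2) \<partial>lborel)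
          \<le> of_nat N * (\<integral>\<^sup>+y. ennreal (indicator (ball x (4 * r)) y * (u y)\<^sup>2) \<partial>lborel)"
      proof (intro mult_left_mono nn_integral_mono ennreal_leI)
        fix y
        have "\<bar>u y\<bar> powr 2 = (u y)\<^sup>2" by (cases "u y = 0") auto
        then show "indicator (cube r x) y * \<bar>u y\<bar> powr 2 \<le> indicator (ball x (4 * r)) y * (u y)\<^sup>2"
          using sub by (auto simp: indicator_def)
      qed simp
      also have "\<dots> \<le> (\<integral>\<^sup>+y. ennreal ((u y)\<^sup>2) \<partial>lborel)"
        by (rule nn_integral_ball_radial_le[OF rad _ \<open>0 < N\<close>]) (use True r(1) in auto)
      also have "\<dots> \<le> ennreal (A / V0)"
        using nn_integral_square_le_E[OF u] divide_right_mono[OF Eu, of V0] V0_pos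
        by (meson ennreal_leI less_imp_le order_trans)
      also have "\<dots> \<le> ennreal (of_nat N * K)" using N by (intro ennreal_leI) (simp add: mult.commute)
      also have "\<dots> = of_nat N * ennreal K" using K by (simp add: ennreal_mult ennreal_of_nat_eq_real_of_nat)
      finally have "(\<integral>\<^sup>+y. ennreal (indicator (cube r x) y * \<bar>u y\<bar> powr 2) \<partial>lborel) \<le> ennreal K"
        using \<open>0 < N\<close> by (subst (asm) ennreal_mult_le_mult_iff) (auto simp: of_nat_less_top)
      then have "\<bar>cube_avg r u x\<bar> \<le> l + l powr (1 - 2) * K / r ^ 3"
        by (intro abs_cube_avg_le[OF u r(1) l]) (use K in auto)
      also have "l powr (1 - 2) * K / r ^ 3 = l"
        using l r(1) by (simp add: K_def powr_minus power2_eq_square)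
      finally have "\<bar>cube_avg r u x\<bar> \<le> l + l" .
      moreover have "d < \<bar>u x\<bar>" using True by simp
      ultimately have "\<bar>2 * l\<bar> \<le> \<bar>u x - cube_avg r u x\<bar>" using l unfolding l_def by linarith
      then have "(2 * l)\<^sup>2 \<le> (u x - cube_avg r u x)\<^sup>2" by (simp only: abs_le_square_iff)
      then show ?thesis using True by (simp add: ennreal_leI)
    qed simp
    then have "(\<integral>\<^sup>+x. ennreal ((2 * l)\<^sup>2) * indicator ?S x \<partial>lborel) \<le> (\<integral>\<^sup>+x. ennreal ((u x - cube_avg r u x)\<^sup>2) \<partial>lborel)"
      by (rule nn_integral_mono)
    also have "\<dots> \<le> ennreal (Cs * r powr (2 * s) * A)"
      unfolding Cs_def by (rule nn_integral_diff_cube_avg_le[OF u r(1) Eu])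
    also have "\<dots> \<le> ennreal (e * (2 * l)\<^sup>2)" by (rule ennreal_leI[OF r(2)])
    also have "\<dots> = ennreal ((2 * l)\<^sup>2) * ennreal e" using e by (simp add: ennreal_mult mult.commute)
    finally have "ennreal ((2 * l)\<^sup>2) * emeasure lborel ?S \<le> ennreal ((2 * l)\<^sup>2) * ennreal e"
      by (subst (asm) nn_integral_cmult_indicator) auto
    then show "emeasure lborel ?S \<le> ennreal e"
      using l by (subst (asm) ennreal_mult_le_mult_iff) auto
  qed
qed

end

section \<open>Compactness of radial functions under subcritical nonlinearities\<close>

definition growth :: "real \<Rightarrow> real \<Rightarrow> real" where
  "growth q t = t\<^sup>2 + \<bar>t\<bar> powr q"

lemma growth_nonneg [simp]: "0 \<le> growth q t" by (simp add: growth_def)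

lemma growth_mono: "0 \<le> q \<Longrightarrow> \<bar>a\<bar> \<le> \<bar>b\<bar> \<Longrightarrow> growth q a \<le> growth q b"
  unfolding growth_def by (intro add_mono powr_mono2) (auto simp: abs_le_square_iff)

lemma borel_measurable_growth [measurable]:
  assumes [measurable]: "u \<in> borel_measurable M"
  shows "(\<lambda>x. growth q (u x)) \<in> borel_measurable M"
  unfolding growth_def by measurable

text \<open>For q > 2 this says o(t^2) at 0 and o(\<bar>t\<bar>^q) at infinity: both ends are
  negligible against quantities that the energy bounds, and only values in a compact range away from
  0 need compactness.\<close>

definition little_growth :: "real \<Rightarrow> (real \<Rightarrow> real) \<Rightarrow> bool" where
  "little_growth q g \<longleftrightarrow> continuous_on UNIV g \<and>
     (\<forall>e>0. \<exists>d>0. \<exists>K>0. \<forall>t. \<bar>t\<bar> \<le> d \<or> K \<le> \<bar>t\<bar> \<longrightarrow> \<bar>g t\<bar> \<le> e * growth q t)"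

lemma little_growth_continuous: "little_growth q g \<Longrightarrow> continuous_on UNIV g"
  by (simp add: little_growth_def)

lemma continuous_borel_compose:
  fixes g :: "real \<Rightarrow> real"
  assumes "continuous_on UNIV g" "u \<in> borel_measurable M"
  shows "(\<lambda>x. g (u x)) \<in> borel_measurable M"
  using measurable_compose[OF assms(2) borel_measurable_continuous_onI[OF assms(1)]] .

lemma continuous_tendsto_compose:
  fixes g :: "real \<Rightarrow> real"
  assumes "continuous_on UNIV g" "(\<lambda>n. a n) \<longlonglongrightarrow> l"
  shows "(\<lambda>n. g (a n)) \<longlonglongrightarrow> g l"
  using assms by (auto intro: isCont_tendsto_compose simp: continuous_on_eq_continuous_at)

lemma little_growthD:
  assumes g: "little_growth q g" and e: "0 < e"
  obtains d K G where "0 < d" "0 < K" "0 \<le> G" "\<And>t. \<bar>t\<bar> \<le> d \<or> K \<le> \<bar>t\<bar> \<Longrightarrow> \<bar>g t\<bar> \<le> e * growth q t"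
    "\<And>t. \<bar>t\<bar> \<le> K \<Longrightarrow> \<bar>g t\<bar> \<le> G"
proof -
  obtain d K where dK: "0 < d" "0 < K" "\<And>t. \<bar>t\<bar> \<le> d \<or> K \<le> \<bar>t\<bar> \<Longrightarrow> \<bar>g t\<bar> \<le> e * growth q t"
    using g e unfolding little_growth_def by metis
  have "compact (g ` {-K..K})"
    using little_growth_continuous[OF g] by (intro compact_continuous_image) (auto intro: continuous_on_subset)
  then obtain G where G: "\<And>y. y \<in> g ` {-K..K} \<Longrightarrow> norm y \<le> G"
    using compact_imp_bounded bounded_iff by metis
  have G': "\<bar>g t\<bar> \<le> G" if "\<bar>t\<bar> \<le> K" for t
    using G[of "g t"] that by (auto simp: abs_le_iff)
  have "0 \<le> G" using G'[of 0] dK by simp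
  then show ?thesis using that dK G' by blast
qed

lemma little_growth_bound:
  assumes g: "little_growth q g" and e: "0 < e"
  obtains C where "0 < C" "\<And>t. \<bar>g t\<bar> \<le> e * growth q t + C * \<bar>t\<bar> powr p"
proof -
  obtain d K G where *: "0 < d" "0 < K" "0 \<le> G" "\<And>t. \<bar>t\<bar> \<le> d \<or> K \<le> \<bar>t\<bar> \<Longrightarrow> \<bar>g t\<bar> \<le> e * growth q t"
    "\<And>t. \<bar>t\<bar> \<le> K \<Longrightarrow> \<bar>g t\<bar> \<le> G"
    using little_growthD[OF g e] by blast
  \<comment> \<open>On d < \<bar>t\<bar> < K the power \<bar>t\<bar>^p is bounded below by d^p or by
    K^p according to the sign of \<open>p\<close>; the sum covers both.\<close>
  define C where "C = (G + 1) * (d powr (- p) + K powr (- p))"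
  have "0 < d powr (- p)" using *(1) by simp
  moreover have "0 < G + 1" using *(3) by simp
  ultimately have "0 < C" unfolding C_def by (intro mult_pos_pos) (auto intro: add_pos_nonneg)
  moreover have "\<bar>g t\<bar> \<le> e * growth q t + C * \<bar>t\<bar> powr p" for t
  proof (cases "\<bar>t\<bar> \<le> d \<or> K \<le> \<bar>t\<bar>")
    case True
    have "0 \<le> C * \<bar>t\<bar> powr p" using \<open>0 < C\<close> by simp
    then show ?thesis using *(4)[OF True] by linarith
  next
    case False
    then have t: "d < \<bar>t\<bar>" "\<bar>t\<bar> < K" by auto
    have "1 \<le> (d powr (- p) + K powr (- p)) * \<bar>t\<bar> powr p"
    proof (cases "0 \<le> p")
      case True
      have "1 = d powr (- p) * d powr p" using *(1) by (simp flip: powr_add)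
      also have "\<dots> \<le> d powr (- p) * \<bar>t\<bar> powr p"
        using t *(1) True by (intro mult_left_mono powr_mono2) auto
      also have "\<dots> \<le> (d powr (- p) + K powr (- p)) * \<bar>t\<bar> powr p" by (intro mult_right_mono) auto
      finally show ?thesis .
    next
      case False
      have "1 = K powr (- p) * K powr p" using *(2) by (simp flip: powr_add)
      also have "\<dots> \<le> K powr (- p) * \<bar>t\<bar> powr p"
        using t *(1) False by (intro mult_left_mono powr_mono2') auto
      also have "\<dots> \<le> (d powr (- p) + K powr (- p)) * \<bar>t\<bar> powr p" by (intro mult_right_mono) auto
      finally show ?thesis .
    qed
    then have "(G + 1) * 1 \<le> (G + 1) * ((d powr (- p) + K powr (- p)) * \<bar>t\<bar> powr p)"
      using *(3) by (intro mult_left_mono) auto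
    then have "G + 1 \<le> C * \<bar>t\<bar> powr p" by (simp add: C_def mult.assoc)
    moreover have "0 \<le> e * growth q t" using e by simp
    ultimately show ?thesis using *(5)[of t] t by linarith
  qed
  ultimately show ?thesis by (rule that)
qed

lemma little_growth_le_growth:
  assumes "little_growth q g"
  obtains C where "0 < C" "\<And>t. \<bar>g t\<bar> \<le> C * growth q t"
proof -
  obtain C where C: "0 < C" "\<And>t. \<bar>g t\<bar> \<le> 1 * growth q t + C * \<bar>t\<bar> powr q"
    using little_growth_bound[OF assms, of 1 q] by auto
  have "\<bar>g t\<bar> \<le> (1 + C) * growth q t" for t
  proof -
    have "C * \<bar>t\<bar> powr q \<le> C * growth q t" using C by (simp add: growth_def)
    then show ?thesis using C(2)[of t] by (simp add: distrib_right)
  qed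
  then show ?thesis using C(1) by (intro that[of "1 + C"]) auto
qed

lemma tendsto_integral_growth_dominated:
  fixes g :: "real \<Rightarrow> real"
  assumes g: "continuous_on UNIV g" and C: "\<And>t. \<bar>g t\<bar> \<le> C * growth q t" and q: "0 \<le> q" and C0: "0 \<le> C"
    and [measurable]: "\<And>n. u n \<in> borel_measurable M" "v \<in> borel_measurable M"
    and lim: "AE x in M. (\<lambda>n. u n x) \<longlonglongrightarrow> v x"
    and le: "\<And>n x. \<bar>u n x\<bar> \<le> w x" and w: "integrable M (\<lambda>x. growth q (w x))"
  shows "(\<lambda>n. \<integral>x. g (u n x) \<partial>M) \<longlonglongrightarrow> (\<integral>x. g (v x) \<partial>M)"
proof (rule integral_dominated_convergence[where w = "\<lambda>x. C * growth q (w x)"])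
  note [measurable] = continuous_borel_compose[OF g]
  show "(\<lambda>x. g (v x)) \<in> borel_measurable M" "\<And>n. (\<lambda>x. g (u n x)) \<in> borel_measurable M" by measurable
  show "integrable M (\<lambda>x. C * growth q (w x))" using w by simp
  show "AE x in M. (\<lambda>n. g (u n x)) \<longlonglongrightarrow> g (v x)"
    using lim
  proof eventually_elim
    case (elim x)
    from continuous_tendsto_compose[OF g elim] show ?case .
  qed
  show "AE x in M. norm (g (u n x)) \<le> C * growth q (w x)" for n
  proof (intro AE_I2)
    fix x
    have "growth q (u n x) \<le> growth q (w x)" using le[of n x] by (intro growth_mono q) auto
    then have "C * growth q (u n x) \<le> C * growth q (w x)" using C0 by (rule mult_left_mono)
    then show "norm (g (u n x)) \<le> C * growth q (w x)" using C[of "u n x"] by simp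
  qed
qed

section \<open>Convergence of nonlinear integrals along radial sequences\<close>

locale sobolev_subcritical = sobolev +
  fixes q :: real
  assumes q_gt: "2 < q" and q_less: "q < 6 / (3 - 2 * s)"
begin

lemma growth_bounded:
  "\<exists>C>0. \<forall>u\<in>Hs s. E u \<le> A \<longrightarrow> (\<integral>x. growth q (u x) \<partial>lborel) \<le> C"
proof -
  obtain C where C: "0 < C" "\<And>u. u \<in> Hs s \<Longrightarrow> integrable lborel (\<lambda>x. \<bar>u x\<bar> powr q)"
    "\<And>u. u \<in> Hs s \<Longrightarrow> (\<integral>x. \<bar>u x\<bar> powr q \<partial>lborel) \<le> C * E u powr (q / 2)"
    using sobolev_embedding[of q] q_gt q_less by auto
  show ?thesis
  proof (intro exI[of _ "\<bar>A\<bar> / V0 + C * \<bar>A\<bar> powr (q / 2) + 1"] conjI ballI impI)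
    show "0 < \<bar>A\<bar> / V0 + C * \<bar>A\<bar> powr (q / 2) + 1"
      using V0_pos C(1) by (simp add: add_nonneg_pos)
    fix u assume u: "u \<in> Hs s" and Eu: "E u \<le> A"
    have 1: "E u / V0 \<le> \<bar>A\<bar> / V0" using Eu V0_pos by (intro divide_right_mono) auto
    have 2: "C * E u powr (q / 2) \<le> C * \<bar>A\<bar> powr (q / 2)"
      using Eu C(1) q_gt by (intro mult_left_mono powr_mono2) auto
    have "(\<integral>x. growth q (u x) \<partial>lborel) = (\<integral>x. (u x)\<^sup>2 \<partial>lborel) + (\<integral>x. \<bar>u x\<bar> powr q \<partial>lborel)"
      unfolding growth_def using Hs_square[OF u] C(2)[OF u] by simp
    then show "(\<integral>x. growth q (u x) \<partial>lborel) \<le> \<bar>A\<bar> / V0 + C * \<bar>A\<bar> powr (q / 2) + 1"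
      using integral_square_le_E[OF u] C(3)[OF u] 1 2 by linarith
  qed
qed

lemma integrable_growth:
  assumes u: "u \<in> Hs s"
  shows "integrable lborel (\<lambda>x. growth q (u x))"
  using sobolev_embedding[of q] q_gt q_less Hs_square[OF u] u unfolding growth_def by auto

lemma integrable_nonlinearity:
  assumes g: "continuous_on UNIV g" and C: "\<And>t. \<bar>g t\<bar> \<le> C * growth q t" and u: "u \<in> Hs s"
  shows "integrable lborel (\<lambda>x. g (u x))"
proof (rule Bochner_Integration.integrable_bound)
  note [measurable] = Hs_borel[OF u] continuous_borel_compose[OF g]
  show "integrable lborel (\<lambda>x. C * growth q (u x))" using integrable_growth[OF u] by simp
  show "(\<lambda>x. g (u x)) \<in> borel_measurable lborel" by measurable
  show "AE x in lborel. norm (g (u x)) \<le> norm (C * growth q (u x))"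
    using C by (intro AE_I2) (fastforce intro: order_trans)
qed

lemma integrable_little_growth:
  assumes g: "little_growth q g" and u: "u \<in> Hs s"
  shows "integrable lborel (\<lambda>x. g (u x))"
  using little_growth_le_growth[OF g] integrable_nonlinearity[OF little_growth_continuous[OF g] _ u] by metis

text \<open>The first estimate serves on a ball, where clamping the values makes the integrand
  bounded. The second serves outside it, where values above \<open>d\<close> occur only on a set of
  small measure.\<close>

lemma nonlinearity_diff_bound:
  fixes g :: "real \<Rightarrow> real"
  assumes K: "0 < K" and G: "\<And>t. \<bar>t\<bar> \<le> K \<Longrightarrow> \<bar>g t\<bar> \<le> G"
    and e: "0 \<le> e" "\<And>t. \<bar>t\<bar> \<le> d \<or> K \<le> \<bar>t\<bar> \<Longrightarrow> \<bar>g t\<bar> \<le> e * growth q t"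
  shows "\<bar>g t - g (max (- K) (min K t))\<bar> \<le> 2 * e * growth q t"
    and "\<bar>g t\<bar> \<le> 2 * e * growth q t + (if d < \<bar>t\<bar> then G else 0)"
proof -
  define cl where "cl t = max (- K) (min K t)" for t
  have eg: "0 \<le> e * growth q t" using e(1) by simp
  have "\<bar>g t - g (cl t)\<bar> \<le> 2 * e * growth q t"
  proof (cases "\<bar>t\<bar> \<le> K")
    case True
    then have "cl t = t" by (auto simp: cl_def)
    then show ?thesis using eg by simp
  next
    case False
    then have cl: "\<bar>cl t\<bar> = K" using K by (auto simp: cl_def)
    have "growth q (cl t) \<le> growth q t" using False cl q_gt by (intro growth_mono) auto
    then have "e * growth q (cl t) \<le> e * growth q t" using e(1) by (rule mult_left_mono)
    moreover have "\<bar>g (cl t)\<bar> \<le> e * growth q (cl t)" "\<bar>g t\<bar> \<le> e * growth q t"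
      using e(2) cl False by auto
    ultimately show ?thesis by linarith
  qed
  then show "\<bar>g t - g (max (- K) (min K t))\<bar> \<le> 2 * e * growth q t" by (simp add: cl_def)
  show "\<bar>g t\<bar> \<le> 2 * e * growth q t + (if d < \<bar>t\<bar> then G else 0)"
  proof (cases "\<bar>t\<bar> \<le> d \<or> K \<le> \<bar>t\<bar>")
    case True
    moreover have "0 \<le> G" using G[of 0] K by simp
    ultimately show ?thesis using e(2)[OF True] eg by auto
  next
    case False
    then show ?thesis using G[of t] eg by auto
  qed
qed

text \<open>Very small and very large values cost at most \<open>e\<close> times a growth integral
  bounded by the energy. The values in between are treated by dominated convergence on a large ball
  and by \<open>radial_tail\<close> outside it.\<close>

lemma radial_compactness:
  assumes g: "little_growth q g"
    and u: "\<And>n. u n \<in> Hs s" "\<And>n. radial (u n)" "\<And>n. E (u n) \<le> A"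
    and v: "v \<in> Hs s" "radial v" "E v \<le> A"
    and lim: "AE x in lborel. (\<lambda>n. u n x) \<longlonglongrightarrow> v x"
  shows "(\<lambda>n. \<integral>x. g (u n x) \<partial>lborel) \<longlonglongrightarrow> (\<integral>x. g (v x) \<partial>lborel)"
proof (rule tendstoI)
  fix \<eta> :: real assume \<eta>: "0 < \<eta>"
  note gc = little_growth_continuous[OF g]
  note [measurable] = u(1)[THEN Hs_borel] Hs_borel[OF v(1)] continuous_borel_compose[OF gc]
  obtain S where S: "0 < S" "\<And>u. u \<in> Hs s \<Longrightarrow> E u \<le> A \<Longrightarrow> (\<integral>x. growth q (u x) \<partial>lborel) \<le> S"
    using growth_bounded by metis
  \<comment> \<open>Budget: the growth terms take \<eta>/4 together, the ball \<eta>/4, and the two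
    tails \<eta>/8 each through \<open>\<mu>\<close>, whose \<open>G + 1\<close> avoids division by
    0.\<close>
  define e where "e = \<eta> / (16 * S)"
  have e: "0 < e" using \<eta> S by (simp add: e_def)
  obtain d K G where d: "0 < d" and K: "0 < K" and G0: "0 \<le> G"
    and small: "\<And>t. \<bar>t\<bar> \<le> d \<or> K \<le> \<bar>t\<bar> \<Longrightarrow> \<bar>g t\<bar> \<le> e * growth q t" and G: "\<And>t. \<bar>t\<bar> \<le> K \<Longrightarrow> \<bar>g t\<bar> \<le> G"
    using little_growthD[OF g e] by metis
  define \<mu> where "\<mu> = \<eta> / (8 * (G + 1))"
  have \<mu>: "0 < \<mu>" using \<eta> G0 by (simp add: \<mu>_def)
  obtain R where R: "\<And>u. u \<in> Hs s \<Longrightarrow> radial u \<Longrightarrow> E u \<le> A \<Longrightarrow> emeasure lborel {x. R < norm x \<and> d < \<bar>u x\<bar>} \<le> ennreal \<mu>"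
    using radial_tail[OF d \<mu>, of A] by blast
  define cl where "cl t = max (- K) (min K t)" for t
  have clc: "continuous_on UNIV (\<lambda>t. g (cl t))" unfolding cl_def
    by (rule continuous_on_compose2[OF gc]) (auto intro!: continuous_intros)
  have clK: "\<bar>cl t\<bar> \<le> K" for t using K by (auto simp: cl_def)
  have [measurable]: "cball (0 :: point) R \<in> sets borel" by simp
  let ?B = "indicator (cball (0 :: point) R) :: point \<Rightarrow> real"
  let ?T = "\<lambda>w :: point \<Rightarrow> real. indicator {x. R < norm x \<and> d < \<bar>w x\<bar>} :: point \<Rightarrow> real"
  have B: "integrable lborel ?B"
    using emeasure_bounded_finite[of "cball (0 :: point) R"] by (intro integrable_real_indicator) auto
  let ?D = "\<lambda>n. \<integral>x. ?B x * \<bar>g (cl (u n x)) - g (cl (v x))\<bar> \<partial>lborel"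
  have Dint: "integrable lborel (\<lambda>x. ?B x * \<bar>g (cl (u n x)) - g (cl (v x))\<bar>)"
    and Dlim: "?D \<longlonglongrightarrow> 0" for n
  proof -
    have bd: "\<bar>?B x * \<bar>g (cl (u n x)) - g (cl (v x))\<bar>\<bar> \<le> 2 * G * ?B x" for n x
      using G[OF clK, of "u n x"] G[OF clK, of "v x"] by (auto simp: indicator_def)
    have m: "(\<lambda>x. ?B x * \<bar>g (cl (u n x)) - g (cl (v x))\<bar>) \<in> borel_measurable lborel" for n
      unfolding cl_def by measurable
    show "integrable lborel (\<lambda>x. ?B x * \<bar>g (cl (u n x)) - g (cl (v x))\<bar>)"
      by (rule Bochner_Integration.integrable_bound[where f = "\<lambda>x. 2 * G * ?B x", OF _ m])
        (use bd B G0 in \<open>auto simp: abs_of_nonneg\<close>)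
    have "?D \<longlonglongrightarrow> (\<integral>x. 0 \<partial>(lborel :: point measure))"
    proof (rule integral_dominated_convergence[where w = "\<lambda>x. 2 * G * ?B x"])
      show "AE x in lborel. (\<lambda>n. ?B x * \<bar>g (cl (u n x)) - g (cl (v x))\<bar>) \<longlonglongrightarrow> 0"
        using lim
      proof eventually_elim
        case (elim x)
        have "(\<lambda>n. ?B x * \<bar>g (cl (u n x)) - g (cl (v x))\<bar>) \<longlonglongrightarrow> ?B x * \<bar>g (cl (v x)) - g (cl (v x))\<bar>"
          by (intro tendsto_intros continuous_tendsto_compose[OF clc] elim)
        then show ?case by simp
      qed
    qed (use B m bd in auto)
    then show "?D \<longlonglongrightarrow> 0" by simp
  qed
  have T: "integrable lborel (?T w)" "(\<integral>x. ?T w x \<partial>lborel) \<le> \<mu>" if w: "w \<in> Hs s" "radial w" "E w \<le> A" for w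
  proof -
    note [measurable] = Hs_borel[OF w(1)]
    have m: "{x. R < norm x \<and> d < \<bar>w x\<bar>} \<in> sets lborel" by measurable
    show int: "integrable lborel (?T w)"
      using R[OF w] m by (intro integrable_real_indicator) (auto intro: le_less_trans)
    have "measure lborel {x. R < norm x \<and> d < \<bar>w x\<bar>} \<le> \<mu>"
      using R[OF w] \<mu> by (simp add: measure_def enn2real_leI)
    then show "(\<integral>x. ?T w x \<partial>lborel) \<le> \<mu>" using m by simp
  qed
  have "eventually (\<lambda>n. ?D n < \<eta> / 4) sequentially"
    using \<eta> by (intro order_tendstoD(2)[OF Dlim]) auto
  then show "eventually (\<lambda>n. dist (\<integral>x. g (u n x) \<partial>lborel) (\<integral>x. g (v x) \<partial>lborel) < \<eta>) sequentially"
  proof eventually_elim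
    case (elim n)
    have pw: "\<bar>g (u n x) - g (v x)\<bar> \<le> 2 * e * growth q (u n x) + 2 * e * growth q (v x)
        + ?B x * \<bar>g (cl (u n x)) - g (cl (v x))\<bar> + G * ?T (u n) x + G * ?T v x" for x
    proof -
      note bds = nonlinearity_diff_bound[OF K G less_imp_le[OF e] small]
      have 1: "\<bar>g t - g (cl t)\<bar> \<le> 2 * e * growth q t" for t unfolding cl_def by (rule bds(1))
      have 2: "\<bar>g t\<bar> \<le> 2 * e * growth q t + (if d < \<bar>t\<bar> then G else 0)" for t by (rule bds(2))
      show ?thesis
      proof (cases "x \<in> cball 0 R")
        case True
        then show ?thesis using 1[of "u n x"] 1[of "v x"] by auto
      next
        case False
        then have "R < norm x" by simp
        then show ?thesis using 2[of "u n x"] 2[of "v x"] False by (auto simp: indicator_def split: if_splits)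
      qed
    qed
    have gi: "integrable lborel (\<lambda>x. g (u n x))" "integrable lborel (\<lambda>x. g (v x))"
      using integrable_little_growth[OF g] u v by auto
    have "\<bar>(\<integral>x. g (u n x) \<partial>lborel) - (\<integral>x. g (v x) \<partial>lborel)\<bar> = \<bar>\<integral>x. g (u n x) - g (v x) \<partial>lborel\<bar>"
      using gi by simp
    also have "\<dots> \<le> (\<integral>x. \<bar>g (u n x) - g (v x)\<bar> \<partial>lborel)" by (rule integral_abs_bound)
    also have "\<dots> \<le> (\<integral>x. 2 * e * growth q (u n x) + 2 * e * growth q (v x)
        + ?B x * \<bar>g (cl (u n x)) - g (cl (v x))\<bar> + G * ?T (u n) x + G * ?T v x \<partial>lborel)"
    proof (rule integral_mono[OF _ _ pw])
      show "integrable lborel (\<lambda>x. \<bar>g (u n x) - g (v x)\<bar>)" using gi by simp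
      show "integrable lborel (\<lambda>x. 2 * e * growth q (u n x) + 2 * e * growth q (v x)
        + ?B x * \<bar>g (cl (u n x)) - g (cl (v x))\<bar> + G * ?T (u n) x + G * ?T v x)"
        using integrable_growth[OF u(1)] integrable_growth[OF v(1)] T(1)[OF u] T(1)[OF v] Dint by simp
    qed
    also have "\<dots> = 2 * e * (\<integral>x. growth q (u n x) \<partial>lborel) + 2 * e * (\<integral>x. growth q (v x) \<partial>lborel)
        + ?D n + G * (\<integral>x. ?T (u n) x \<partial>lborel) + G * (\<integral>x. ?T v x \<partial>lborel)"
      using integrable_growth[OF u(1)] integrable_growth[OF v(1)] T(1)[OF u] T(1)[OF v] Dint by simp
    also have "\<dots> \<le> 2 * e * S + 2 * e * S + ?D n + G * \<mu> + G * \<mu>"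
      using S(2) u v T(2) e G0 by (intro add_mono mult_left_mono order_refl) auto
    also have "\<dots> < \<eta>"
    proof -
      have "2 * e * S = \<eta> / 8" using S by (simp add: e_def)
      moreover have "G * \<mu> \<le> \<eta> / 8"
      proof -
        have "G * \<mu> \<le> (G + 1) * \<mu>" using \<mu> by simp
        also have "\<dots> = \<eta> / 8"
        proof -
          have "G + 1 \<noteq> 0" using G0 by simp
          then show ?thesis unfolding \<mu>_def by (metis divide_divide_eq_left nonzero_mult_div_cancel_left times_divide_eq_right mult.commute)
        qed
        finally show ?thesis .
      qed
      ultimately show ?thesis using elim \<eta> by linarith
    qed
    finally show ?case by (simp add: dist_real_def)
  qed
qed

end

section \<open>Tent functions\<close>

lemma dyadic_between:
  fixes x :: real
  assumes "1 \<le> x"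
  obtains k where "2 ^ k \<le> x" "x < 2 ^ Suc k"
proof -
  define n where "n = (LEAST n. x < 2 ^ n)"
  have "\<exists>n. x < 2 ^ n" by (rule real_arch_pow) simp
  then have n: "x < 2 ^ n" unfolding n_def by (rule LeastI_ex)
  have "n \<noteq> 0" using n assms by (cases n) auto
  then obtain k where k: "n = Suc k" by (cases n) auto
  have "\<not> x < 2 ^ k" using not_less_Least[of k "\<lambda>n. x < 2 ^ n"] k by (simp add: n_def)
  then show ?thesis using n k by (intro that[of k]) auto
qed

lemma emeasure_cball_point_le:
  assumes "0 \<le> r"
  shows "emeasure lborel (cball (0 :: point) r) \<le> ennreal ((2 * r) ^ 3)"
proof -
  have "cball (0 :: point) r \<subseteq> cbox (\<chi> i. - r) (\<chi> i. r)"
  proof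
    fix x :: point assume "x \<in> cball 0 r"
    then have "\<bar>x $ i\<bar> \<le> r" for i using component_le_norm_cart[of x i] by simp
    then have "- r \<le> x $ i \<and> x $ i \<le> r" for i by (simp add: abs_le_iff minus_le_iff)
    then show "x \<in> cbox (\<chi> i. - r) (\<chi> i. r)" by (simp add: mem_box_cart)
  qed
  then have "emeasure lborel (cball (0 :: point) r) \<le> emeasure lborel (cbox (\<chi> i. - r) (\<chi> i. r) :: point set)"
    by (intro emeasure_mono) auto
  also have "\<dots> = ennreal ((2 * r) ^ 3)"
  proof -
    have "((\<chi> i. - r) :: point) \<bullet> k = - r" "((\<chi> i. r) :: point) \<bullet> k = r" if "k \<in> Basis" for k
      using that by (auto simp: Basis_vec_def inner_axis)
    then show ?thesis using assms by (simp add: emeasure_lborel_cbox_eq inner_diff_left)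
  qed
  finally show ?thesis .
qed

text \<open>Majorant of the kernel for 1-Lipschitz functions with values in [0, 1], whose squared
  increments are at most min 1 (norm z)^2.\<close>

definition levy :: "real \<Rightarrow> point \<Rightarrow> real" where
  "levy s z = min 1 ((norm z)\<^sup>2) / norm z powr (3 + 2 * s)"

lemma levy_nonneg [simp]: "0 \<le> levy s z" by (simp add: levy_def)

lemma borel_measurable_levy [measurable]: "levy s \<in> borel_measurable borel"
  unfolding levy_def by measurable

lemma nn_integral_cball_series:
  assumes c: "\<And>k. 0 \<le> c k" and r: "\<And>k. 0 \<le> r k"
    and le: "\<And>k. c k * (2 * r k) ^ 3 \<le> C * a ^ k" and a: "0 \<le> a" "a < 1" and C: "0 \<le> C"
  shows "(\<integral>\<^sup>+z. (\<Sum>k. ennreal (c k) * indicator (cball (0 :: point) (r k)) z) \<partial>lborel) < \<infinity>"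
proof -
  have [measurable]: "cball (0 :: point) (r k) \<in> sets borel" for k by simp
  have "(\<integral>\<^sup>+z. (\<Sum>k. ennreal (c k) * indicator (cball (0 :: point) (r k)) z) \<partial>lborel)
      = (\<Sum>k. \<integral>\<^sup>+z. ennreal (c k) * indicator (cball (0 :: point) (r k)) z \<partial>lborel)"
    by (rule nn_integral_suminf) measurable
  also have "\<dots> \<le> (\<Sum>k. ennreal (C * a ^ k))"
  proof (intro suminf_le summableI)
    fix k
    have "(\<integral>\<^sup>+z. ennreal (c k) * indicator (cball (0 :: point) (r k)) z \<partial>lborel)
        = ennreal (c k) * emeasure lborel (cball (0 :: point) (r k))"
      by (rule nn_integral_cmult_indicator) simp
    also have "\<dots> \<le> ennreal (c k) * ennreal ((2 * r k) ^ 3)"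
      by (intro mult_left_mono emeasure_cball_point_le r) simp
    also have "\<dots> = ennreal (c k * (2 * r k) ^ 3)" using c r by (simp add: ennreal_mult)
    also have "\<dots> \<le> ennreal (C * a ^ k)" by (intro ennreal_leI le)
    finally show "(\<integral>\<^sup>+z. ennreal (c k) * indicator (cball (0 :: point) (r k)) z \<partial>lborel) \<le> ennreal (C * a ^ k)" .
  qed
  also have "\<dots> < \<infinity>"
    using a C by (subst suminf_ennreal2) (auto intro!: summable_mult summable_geometric)
  finally show ?thesis .
qed

text \<open>The dyadic shell at radius 2^k contributes on the order of 2^(-2sk), the one at radius
  2^(-k) on the order of 2^((2s - 2)k). The two geometric series converge because s > 0 and s < 1.
  Each shell is enlarged to a ball, at the cost of a constant.\<close>

lemma nn_integral_levy:
  assumes s: "0 < s" "s < 1"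
  shows "(\<integral>\<^sup>+z. ennreal (levy s z) \<partial>lborel) < \<infinity>"
proof -
  define p where "p = 3 + 2 * s"
  define c1 where "c1 k = ((2 :: real) ^ k) powr (- p)" for k :: nat
  define c2 where "c2 k = ((1 / 2) ^ k)\<^sup>2 * ((1 / 2 :: real) ^ Suc k) powr (- p)" for k :: nat
  let ?r1 = "\<lambda>k. (2 :: real) ^ Suc k" and ?r2 = "\<lambda>k. (1 / 2 :: real) ^ k"
  let ?S1 = "\<lambda>z. \<Sum>k. ennreal (c1 k) * indicator (cball (0 :: point) (?r1 k)) z"
  let ?S2 = "\<lambda>z. \<Sum>k. ennreal (c2 k) * indicator (cball (0 :: point) (?r2 k)) z"
  have p: "0 < p" using s by (simp add: p_def)
  have pt: "ennreal (levy s z) \<le> ?S1 z + ?S2 z" for z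
  proof (cases "z = 0")
    case True
    then show ?thesis by (simp add: levy_def)
  next
    case z: False
    have term_le: "f k \<le> (\<Sum>k. f k)" for f :: "nat \<Rightarrow> ennreal" and k
      using sum_le_suminf[of f "{k}"] by simp
    show ?thesis
    proof (cases "1 \<le> norm z")
      case True
      then obtain k where k: "2 ^ k \<le> norm z" "norm z < 2 ^ Suc k" using dyadic_between by blast
      have "levy s z \<le> 1 / norm z powr p"
        unfolding levy_def p_def[symmetric] by (intro divide_right_mono) auto
      also have "\<dots> = norm z powr (- p)" by (simp add: powr_minus divide_inverse)
      also have "\<dots> \<le> c1 k" unfolding c1_def using k p by (intro powr_mono2') auto
      finally have "ennreal (levy s z) \<le> ennreal (c1 k) * indicator (cball (0 :: point) (?r1 k)) z"
        using k by (simp add: ennreal_leI)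
      also have "\<dots> \<le> ?S1 z" by (rule term_le)
      finally show ?thesis by (simp add: add_increasing2)
    next
      case False
      then have "1 \<le> 1 / norm z" using z by simp
      then obtain k where k: "2 ^ k \<le> 1 / norm z" "1 / norm z < 2 ^ Suc k" using dyadic_between by blast
      have k': "norm z \<le> (1 / 2) ^ k" "(1 / 2) ^ Suc k \<le> norm z"
        using k z by (simp_all add: power_one_over field_simps)
      have "levy s z \<le> (norm z)\<^sup>2 / norm z powr p"
        unfolding levy_def p_def[symmetric] by (intro divide_right_mono) auto
      also have "\<dots> = (norm z)\<^sup>2 * norm z powr (- p)" by (simp add: powr_minus divide_inverse)
      also have "\<dots> \<le> c2 k" unfolding c2_def using k' p by (intro mult_mono power_mono powr_mono2') auto
      finally have "ennreal (levy s z) \<le> ennreal (c2 k) * indicator (cball (0 :: point) (?r2 k)) z"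
        using k' by (simp add: ennreal_leI)
      also have "\<dots> \<le> ?S2 z" by (rule term_le)
      finally show ?thesis by (simp add: add_increasing)
    qed
  qed
  have 1: "(\<integral>\<^sup>+z. ?S1 z \<partial>lborel) < \<infinity>"
  proof (rule nn_integral_cball_series[where C = 64 and a = "2 powr (- 2 * s)"])
    fix k
    have "c1 k = (2 powr real k) powr (- p)" by (simp add: c1_def powr_realpow)
    also have "\<dots> = 2 powr (- 3 * real k) * 2 powr (- 2 * s * real k)"
      by (simp add: powr_powr p_def algebra_simps flip: powr_add)
    also have "2 powr (- 2 * s * real k) = (2 powr (- 2 * s)) ^ k"
      by (simp add: powr_realpow[symmetric] powr_powr)
    also have "2 powr (- 3 * real k) = 1 / 8 ^ k"
    proof -
      have "(2 :: real) powr (3 * real k) = (2 powr 3) powr real k" by (simp only: powr_powr)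
      then show ?thesis by (simp add: powr_minus powr_realpow divide_inverse)
    qed
    finally have c1: "c1 k = 1 / 8 ^ k * (2 powr (- 2 * s)) ^ k" .
    have "(2 * 2 ^ Suc k) ^ 3 = (64 * 8 ^ k :: real)"
      by (simp add: power_mult_distrib power_commutes flip: power_mult) (simp add: power_mult mult.commute[of k])
    then show "c1 k * (2 * 2 ^ Suc k) ^ 3 \<le> 64 * (2 powr (- 2 * s)) ^ k" unfolding c1 by simp
  qed (use s in \<open>auto simp: c1_def powr_less_one\<close>)
  have 2: "(\<integral>\<^sup>+z. ?S2 z \<partial>lborel) < \<infinity>"
  proof (rule nn_integral_cball_series[where C = "8 * 2 powr p" and a = "2 powr (2 * s - 2)"])
    fix k
    have half: "(1 / 2 :: real) ^ j = 2 powr (- real j)" for j by (simp add: powr_minus powr_realpow power_one_over inverse_eq_divide)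
    have "c2 k * (2 * (1 / 2) ^ k) ^ 3 = 8 * (((1 / 2) ^ k)\<^sup>2 * ((1 / 2) ^ k) ^ 3 * ((1 / 2) ^ Suc k) powr (- p))"
      by (simp add: c2_def power_mult_distrib)
    also have "((1 / 2 :: real) ^ k)\<^sup>2 * ((1 / 2) ^ k) ^ 3 = 2 powr (- 5 * real k)"
    proof -
      have "((1 / 2 :: real) ^ k)\<^sup>2 * ((1 / 2) ^ k) ^ 3 = (1 / 2) ^ (5 * k)"
        unfolding power_mult[symmetric] power_add[symmetric] by (simp add: mult.commute)
      then show ?thesis unfolding half by simp
    qed
    also have "((1 / 2 :: real) ^ Suc k) powr (- p) = 2 powr (p * (real k + 1))"
      unfolding half by (simp add: powr_powr algebra_simps)
    also have "2 powr (- 5 * real k) * 2 powr (p * (real k + 1)) = 2 powr p * (2 powr (2 * s - 2)) ^ k"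
      by (simp add: p_def powr_realpow[symmetric] powr_powr algebra_simps flip: powr_add)
    finally show "c2 k * (2 * (1 / 2) ^ k) ^ 3 \<le> 8 * 2 powr p * (2 powr (2 * s - 2)) ^ k" by simp
  qed (use s in \<open>auto simp: c2_def powr_less_one\<close>)
  have [measurable]: "cball (0 :: point) r \<in> sets borel" for r by simp
  have "(\<integral>\<^sup>+z. ennreal (levy s z) \<partial>lborel) \<le> (\<integral>\<^sup>+z. ?S1 z + ?S2 z \<partial>lborel)"
    by (rule nn_integral_mono) (rule pt)
  also have "\<dots> = (\<integral>\<^sup>+z. ?S1 z \<partial>lborel) + (\<integral>\<^sup>+z. ?S2 z \<partial>lborel)"
    by (rule nn_integral_add) measurable
  also have "\<dots> < \<infinity>" using 1 2 by simp
  finally show ?thesis .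
qed

lemma nn_integral_levy_translate:
  "(\<integral>\<^sup>+y. ennreal (levy s (x - y)) \<partial>lborel) = (\<integral>\<^sup>+z. ennreal (levy s z) \<partial>lborel)"
proof -
  have "(\<integral>\<^sup>+z. ennreal (levy s z) \<partial>lborel) = (\<integral>\<^sup>+z. ennreal (levy s z) \<partial>distr lborel borel ((+) (- x)))"
    by (simp add: lborel_distr_plus)
  also have "\<dots> = (\<integral>\<^sup>+y. ennreal (levy s (- x + y)) \<partial>lborel)" by (subst nn_integral_distr) auto
  also have "(\<lambda>y. levy s (- x + y)) = (\<lambda>y. levy s (x - y))"
    by (auto simp: levy_def norm_minus_commute)
  finally show ?thesis by simp
qed

text \<open>The explicit element of the space: it makes the constraint set nonempty and is the
  barrier in the strong maximum principle.\<close>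

definition tent :: "real \<Rightarrow> point \<Rightarrow> real" where
  "tent R x = max 0 (min 1 (R - norm x))"

lemma tent_bounds: "0 \<le> tent R x" "tent R x \<le> 1" by (auto simp: tent_def)

lemma tent_pos_iff: "0 < tent R x \<longleftrightarrow> norm x < R" by (auto simp: tent_def)

lemma borel_measurable_tent [measurable]: "tent R \<in> borel_measurable borel"
  unfolding tent_def by measurable

lemma tent_radial: "radial (tent R)"
  unfolding radial_def tent_def by (auto simp: orthogonal_transformation_norm)

lemma tent_kernel_le:
  "gagliardo_kernel s (tent R) (tent R) (x, y)
    \<le> (indicator (cball 0 R) x + indicator (cball 0 R) y) * levy s (x - y)"
proof -
  let ?I = "(indicator (cball 0 R) x + indicator (cball 0 R) y) :: real"
  have "\<bar>tent R x - tent R y\<bar> \<le> \<bar>norm x - norm y\<bar>" by (auto simp: tent_def)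
  also have "\<dots> \<le> norm (x - y)" by (rule norm_triangle_ineq3)
  finally have "(tent R x - tent R y)\<^sup>2 \<le> (norm (x - y))\<^sup>2" by (simp add: abs_le_square_iff[symmetric])
  moreover have "(tent R x - tent R y)\<^sup>2 \<le> 1"
    using tent_bounds[of R x] tent_bounds[of R y] by (intro abs_square_le_1[THEN iffD2]) auto
  ultimately have 1: "(tent R x - tent R y)\<^sup>2 \<le> min 1 ((norm (x - y))\<^sup>2)" by simp
  have "(tent R x - tent R y)\<^sup>2 \<le> ?I * min 1 ((norm (x - y))\<^sup>2)"
  proof (cases "norm x \<le> R \<or> norm y \<le> R")
    case True
    then have "1 \<le> ?I" by auto
    then have "1 * min 1 ((norm (x - y))\<^sup>2) \<le> ?I * min 1 ((norm (x - y))\<^sup>2)" by (intro mult_right_mono) auto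
    then have "min 1 ((norm (x - y))\<^sup>2) \<le> ?I * min 1 ((norm (x - y))\<^sup>2)" by (simp only: mult_1_left)
    with 1 show ?thesis by (rule order_trans)
  next
    case False
    then have "tent R x = 0" "tent R y = 0" by (auto simp: tent_def)
    then show ?thesis by simp
  qed
  then have "(tent R x - tent R y)\<^sup>2 / norm (x - y) powr (3 + 2 * s) \<le> ?I * min 1 ((norm (x - y))\<^sup>2) / norm (x - y) powr (3 + 2 * s)"
    by (rule divide_right_mono) simp
  then show ?thesis by (simp add: gagliardo_kernel_def levy_def power2_eq_square)
qed

lemma tent_Hs:
  assumes s: "0 < s" "s < 1"
  shows "tent R \<in> Hs s"
proof -
  have [measurable]: "cball (0 :: point) R \<in> sets borel" by simp
  let ?I = "indicator (cball (0 :: point) R) :: point \<Rightarrow> real"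
  let ?L = "\<integral>\<^sup>+z. ennreal (levy s z) \<partial>lborel"
  have fin: "emeasure lborel (cball (0 :: point) R) < \<infinity>"
    using emeasure_bounded_finite[of "cball (0 :: point) R"] by simp
  have I: "integrable lborel ?I" using fin by (intro integrable_real_indicator) auto
  have sq: "integrable lborel (\<lambda>x. (tent R x)\<^sup>2)"
  proof (rule Bochner_Integration.integrable_bound[OF I])
    have "(tent R x)\<^sup>2 \<le> ?I x" for x
      using tent_bounds[of R x] tent_pos_iff[of R x]
      by (cases "norm x \<le> R") (auto simp: power_le_one tent_def)
    then show "AE x in lborel. norm ((tent R x)\<^sup>2) \<le> norm (?I x)" by simp
  qed measurable
  have A: "(\<integral>\<^sup>+x. \<integral>\<^sup>+y. ennreal (?I x * levy s (x - y)) \<partial>lborel \<partial>lborel) = ?L * emeasure lborel (cball (0 :: point) R)"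
  proof -
    have "(\<integral>\<^sup>+y. ennreal (?I x * levy s (x - y)) \<partial>lborel) = ?L * indicator (cball 0 R) x" for x
    proof -
      have "(\<integral>\<^sup>+y. ennreal (?I x * levy s (x - y)) \<partial>lborel) = (\<integral>\<^sup>+y. ennreal (?I x) * ennreal (levy s (x - y)) \<partial>lborel)"
        by (simp add: ennreal_mult)
      also have "\<dots> = ennreal (?I x) * ?L" by (subst nn_integral_cmult) (simp_all add: nn_integral_levy_translate)
      finally show ?thesis by (simp add: indicator_def mult.commute)
    qed
    then show ?thesis by (simp add: nn_integral_cmult_indicator)
  qed
  have A': "(\<integral>\<^sup>+x. \<integral>\<^sup>+y. ennreal (?I y * levy s (x - y)) \<partial>lborel \<partial>lborel) = ?L * emeasure lborel (cball (0 :: point) R)"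
  proof -
    have "(\<integral>\<^sup>+x. \<integral>\<^sup>+y. ennreal (?I y * levy s (x - y)) \<partial>lborel \<partial>lborel)
        = (\<integral>\<^sup>+y. \<integral>\<^sup>+x. ennreal (?I y * levy s (x - y)) \<partial>lborel \<partial>lborel)"
      by (rule lborel_pair.Fubini') measurable
    also have "\<dots> = (\<integral>\<^sup>+x. \<integral>\<^sup>+y. ennreal (?I x * levy s (x - y)) \<partial>lborel \<partial>lborel)"
      by (simp add: levy_def norm_minus_commute)
    finally show ?thesis by (simp add: A)
  qed
  have "(\<integral>\<^sup>+z. ennreal (gagliardo_kernel s (tent R) (tent R) z) \<partial>lborel2)
      = (\<integral>\<^sup>+x. \<integral>\<^sup>+y. ennreal (gagliardo_kernel s (tent R) (tent R) (x, y)) \<partial>lborel \<partial>lborel)"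
    by (rule lborel.nn_integral_fst[symmetric]) measurable
  also have "\<dots> \<le> (\<integral>\<^sup>+x. \<integral>\<^sup>+y. ennreal (?I x * levy s (x - y)) + ennreal (?I y * levy s (x - y)) \<partial>lborel \<partial>lborel)"
    using tent_kernel_le[of s R]
    by (intro nn_integral_mono) (simp add: distrib_right ennreal_leI flip: ennreal_plus)
  also have "\<dots> = (\<integral>\<^sup>+x. \<integral>\<^sup>+y. ennreal (?I x * levy s (x - y)) \<partial>lborel \<partial>lborel)
      + (\<integral>\<^sup>+x. \<integral>\<^sup>+y. ennreal (?I y * levy s (x - y)) \<partial>lborel \<partial>lborel)"
    by (subst nn_integral_add[symmetric]; measurable?) (intro nn_integral_cong nn_integral_add; measurable)
  also have "\<dots> < \<infinity>"
    unfolding A A' using fin nn_integral_levy[OF s] by (simp add: ennreal_mult_less_top)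
  finally have "integrable lborel2 (gagliardo_kernel s (tent R) (tent R))"
    by (intro integrableI_bounded) auto
  then show ?thesis using sq by (simp add: Hs_def)
qed

section \<open>Nehari minimization\<close>

locale kirchhoff = sobolev_subcritical s V0 q for s V0 q +
  fixes M f :: "real \<Rightarrow> real" and m0 \<theta> :: real
  assumes M_cont: "continuous_on {0..} M" and m0: "0 < m0" and M_ge: "\<And>t. 0 \<le> t \<Longrightarrow> m0 \<le> M t"
    and M_mono: "mono_on {0..} M"
    and M_ratio: "\<And>t1 t2. t2 \<le> t1 \<Longrightarrow> 0 < t2 \<Longrightarrow> M t1 / t1 - M t2 / t2 \<le> m0 * (1 / t1 - 1 / t2)"
    and f_cont: "continuous_on UNIV f" and f_neg: "\<And>t. t < 0 \<Longrightarrow> f t = 0"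
    and f_zero: "((\<lambda>t. f t / t ^ 3) \<longlongrightarrow> 0) (at_right 0)"
    and f_top: "((\<lambda>t. f t / t powr (q - 1)) \<longlongrightarrow> 0) at_top"
    and \<theta>: "4 < \<theta>"
    and f_AR: "\<And>t. 0 < t \<Longrightarrow> 0 < \<theta> * integral {0..t} f \<and> \<theta> * integral {0..t} f \<le> f t * t"
    and f_mono: "mono_on {0<..} (\<lambda>t. f t / t ^ 3)"
begin

section \<open>Primitives and consequences of the conditions on f and M\<close>

definition F where "F t = integral {0..t} f"
definition g where "g t = f t * t"
text \<open>\<open>H\<close> and \<open>K\<close> are the contributions of the nonlinearity and of
  the Kirchhoff term to \<open>I - J / 4\<close>.\<close>

definition H where "H t = g t / 4 - F t"
definition Mh where "Mh t = integral {0..t} M"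
definition K where "K t = Mh t / 2 - M t * t / 4"

lemma f_nonpos: "t \<le> 0 \<Longrightarrow> f t = 0"
proof (cases "t = 0")
  case True
  have "(f \<longlongrightarrow> f 0) (at_left 0)"
    using f_cont by (auto simp: continuous_on_eq_continuous_at isCont_def intro: filterlim_at_split[THEN iffD1, THEN conjunct1])
  moreover have "(f \<longlongrightarrow> 0) (at_left 0)"
    by (rule tendsto_eventually) (auto simp: eventually_at_left_field intro!: exI[of _ "-1"] f_neg)
  ultimately show ?thesis using True by (auto intro: tendsto_unique[rotated])
qed (use f_neg in auto)

lemma g_nonpos [simp]: "t \<le> 0 \<Longrightarrow> g t = 0" by (simp add: g_def f_nonpos)

lemma F_nonpos [simp]: "t \<le> 0 \<Longrightarrow> F t = 0"
  by (cases "t = 0") (simp_all add: F_def)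

lemma F_pos: "0 < t \<Longrightarrow> 0 < F t"
  using f_AR[of t] \<theta> by (simp add: F_def zero_less_mult_iff)

lemma g_ge_F: "0 < t \<Longrightarrow> \<theta> * F t \<le> g t"
  using f_AR[of t] by (simp add: F_def g_def)

lemma g_pos: "0 < t \<Longrightarrow> 0 < g t"
  using g_ge_F[of t] F_pos[of t] \<theta> by (smt (verit) mult_pos_pos)

lemma f_pos: "0 < t \<Longrightarrow> 0 < f t"
  using g_pos[of t] by (simp add: g_def zero_less_mult_iff)

lemma f_nonneg: "0 \<le> f t"
  using f_pos[of t] f_nonpos[of t] by (cases "0 < t") auto

lemma g_nonneg: "0 \<le> g t"
  using g_pos[of t] g_nonpos[of t] by (cases "0 < t") auto

lemma F_nonneg: "0 \<le> F t"
  using F_pos[of t] F_nonpos[of t] by (cases "0 < t") auto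

lemma g_cont: "continuous_on UNIV g"
  unfolding g_def using f_cont by (intro continuous_intros)

lemma F_deriv: "(F has_real_derivative f t) (at t)"
proof -
  \<comment> \<open>Since \<open>f\<close> vanishes on the negatives, the base point of the integral
    can be moved to the left of both t and 0, which makes t an interior point.\<close>
  define c b where "c = min t 0 - 1" and "b = max t 0 + 1"
  have cb: "c < t" "t < b" "c < 0" "0 < b" by (auto simp: c_def b_def)
  have fi: "f integrable_on {x..y}" for x y
    using f_cont by (intro integrable_continuous_real) (auto intro: continuous_on_subset)
  have eq: "F x = integral {c..x} f" if "c < x" for x
  proof (cases "0 \<le> x")
    case True
    have "integral {c..0} f = integral {c..0} (\<lambda>x. 0)" by (rule integral_cong) (simp add: f_nonpos)
    moreover have "integral {c..0} f + integral {0..x} f = integral {c..x} f"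
      using True cb by (intro Henstock_Kurzweil_Integration.integral_combine fi) auto
    ultimately show ?thesis by (simp add: F_def)
  next
    case False
    then have "integral {c..x} f = integral {c..x} (\<lambda>x. 0)" by (intro integral_cong) (simp add: f_nonpos)
    then show ?thesis using False by simp
  qed
  have "((\<lambda>x. integral {c..x} f) has_real_derivative f t) (at t within {c..b})"
    using f_cont cb by (intro integral_has_real_derivative) (auto intro: continuous_on_subset)
  then have "((\<lambda>x. integral {c..x} f) has_real_derivative f t) (at t)"
    using cb by (simp add: at_within_Icc_at)
  then show ?thesis
  proof (rule DERIV_cong_ev[THEN iffD1, rotated 3])
    show "eventually (\<lambda>x. integral {c..x} f = F x) (nhds t)"
      using eventually_nhds_in_open[of "{c<..}" t] cb by (auto elim!: eventually_mono simp: eq)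
  qed auto
qed

lemma F_cont: "continuous_on UNIV F"
  by (rule DERIV_continuous_on[where D = f]) (rule has_field_derivative_at_within[OF F_deriv])

lemma H_cont: "continuous_on UNIV H"
  unfolding H_def using g_cont F_cont by (intro continuous_intros) auto

lemma Mh_deriv: "0 < t \<Longrightarrow> (Mh has_real_derivative M t) (at t)"
proof -
  assume t: "0 < t"
  have "(Mh has_real_derivative M t) (at t within {0..t + 1})"
    unfolding Mh_def
    using M_cont t by (intro integral_has_real_derivative) (auto intro: continuous_on_subset)
  then show ?thesis using t by (simp add: at_within_Icc_at)
qed

lemma Mh_cont: "continuous_on {0..b} Mh"
  unfolding Mh_def
  using M_cont by (intro indefinite_integral_continuous_1 integrable_continuous_real) (auto intro: continuous_on_subset)

lemma Mh_0 [simp]: "Mh 0 = 0" by (simp add: Mh_def)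

lemma M_pos: "0 \<le> t \<Longrightarrow> 0 < M t"
  using M_ge[of t] m0 by linarith

lemma M_le: "0 \<le> a \<Longrightarrow> a \<le> b \<Longrightarrow> M a \<le> M b"
  using M_mono by (auto simp: mono_on_def)

text \<open>The condition on \<open>M\<close> says that (M t - m0)/t is nonincreasing. Keeping
  \<open>m0\<close> apart is what yields the strict inequality in \<open>M_ratio_strict\<close> and
  the linear gain in \<open>K_increase\<close>.\<close>

lemma M_ratio_ge:
  assumes "0 < a" "a \<le> b"
  shows "m0 + (M b - m0) * a / b \<le> M a"
proof -
  have "(M b - m0) / b \<le> (M a - m0) / a"
    using M_ratio[of a b] assms by (simp add: diff_divide_distrib right_diff_distrib)
  then have "(M b - m0) / b * a \<le> (M a - m0) / a * a" using assms by (intro mult_right_mono) auto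
  then show ?thesis using assms by simp
qed

lemma M_ratio_mono: "0 < a \<Longrightarrow> a \<le> b \<Longrightarrow> M b * a / b \<le> M a"
proof -
  assume ab: "0 < a" "a \<le> b"
  have "m0 * a / b \<le> m0" using ab m0 by (simp add: field_simps)
  then show ?thesis using M_ratio_ge[OF ab] by (simp add: left_diff_distrib diff_divide_distrib)
qed

lemma M_ratio_strict: "0 < a \<Longrightarrow> a < b \<Longrightarrow> M b * a / b < M a"
proof -
  assume ab: "0 < a" "a < b"
  have "m0 * a / b < m0" using ab m0 by (simp add: field_simps)
  then show ?thesis using M_ratio_ge[of a b] ab by (simp add: left_diff_distrib diff_divide_distrib)
qed

text \<open>Formally K' = (M - t M')/4, which is at least m0/4. As \<open>M\<close> need not be
  differentiable, \<open>Mh\<close> is instead compared on [a, b] with the primitive of the line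
  from m0 at 0 to M b at b, which lies below \<open>M\<close>.\<close>

lemma K_increase:
  assumes a: "0 \<le> a" "a \<le> b"
  shows "K a + m0 * (b - a) / 4 \<le> K b"
proof (cases "b = 0")
  case False
  then have b: "0 < b" using a by simp
  define k where "k = (M b - m0) / (2 * b)"
  define \<psi> where "\<psi> r = Mh r - m0 * r - k * r\<^sup>2" for r
  have k: "k * (2 * r) = (M b - m0) * r / b" for r using b by (simp add: k_def field_simps)
  have "\<psi> a \<le> \<psi> b"
  proof (rule DERIV_nonneg_imp_increasing_open[OF a(2)])
    fix x assume x: "a < x" "x < b"
    have "(\<psi> has_real_derivative (M x - m0 - k * (2 * x))) (at x)"
      unfolding \<psi>_def using x a by (auto intro!: derivative_eq_intros Mh_deriv)
    moreover have "0 \<le> M x - m0 - k * (2 * x)"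
      unfolding k using M_ratio_ge[of x b] x a by auto
    ultimately show "\<exists>y. (\<psi> has_real_derivative y) (at x) \<and> 0 \<le> y" by blast
  next
    have "continuous_on {a..b} Mh" using Mh_cont[of b] a by (auto intro: continuous_on_subset)
    then show "continuous_on {a..b} \<psi>" unfolding \<psi>_def by (intro continuous_intros)
  qed
  then have "Mh a - m0 * a - k * (a * a) \<le> Mh b - m0 * b - k * (b * b)"
    by (simp add: \<psi>_def power2_eq_square)
  moreover have "m0 * a + 2 * (k * (a * a)) \<le> M a * a"
  proof (cases "a = 0")
    case False
    then have "m0 + k * (2 * a) \<le> M a" unfolding k using M_ratio_ge[of a b] a by simp
    then have "(m0 + k * (2 * a)) * a \<le> M a * a" using a by (intro mult_right_mono)
    then show ?thesis by (simp add: algebra_simps)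
  qed simp
  moreover have "2 * (k * (b * b)) = M b * b - m0 * b"
  proof -
    have "k * (2 * b) * b = (M b - m0) * b" using k[of b] b by simp
    then show ?thesis by (simp add: algebra_simps)
  qed
  ultimately have "Mh a / 2 - M a * a / 4 + (m0 * b - m0 * a) / 4 \<le> Mh b / 2 - M b * b / 4" by argo
  then show ?thesis unfolding K_def right_diff_distrib .
qed (use a in \<open>auto simp: K_def\<close>)

lemma K_ge: "0 \<le> t \<Longrightarrow> m0 * t / 4 \<le> K t"
  using K_increase[of 0 t] by (simp add: K_def)

lemma K_mono: "0 \<le> a \<Longrightarrow> a \<le> b \<Longrightarrow> K a \<le> K b"
  using K_increase[of a b] m0 by (smt (verit) divide_nonneg_nonneg mult_nonneg_nonneg)

lemma K_strict: "0 \<le> a \<Longrightarrow> a < b \<Longrightarrow> K a < K b"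
  using K_increase[of a b] m0 by (smt (verit) divide_pos_pos mult_pos_pos)

text \<open>The line M e r / e lies below \<open>M\<close> for r < e and above it for r > e.
  Integrating from e to t^2 e gives the same inequality in both cases; the integral of the line
  produces t^4.\<close>

lemma Mh_scale_le:
  assumes t: "0 < t" and e: "0 < e"
  shows "Mh (t\<^sup>2 * e) / 2 \<le> Mh e / 2 + M e * e * (t ^ 4 - 1) / 4"
proof -
  define k where "k = M e / (2 * e)"
  define \<psi> where "\<psi> r = k * r\<^sup>2 - Mh r" for r
  have k: "k * (2 * r) = M e * r / e" for r using e by (simp add: k_def)
  have d: "(\<psi> has_real_derivative (k * (2 * x) - M x)) (at x)" if "0 < x" for x
    unfolding \<psi>_def using that by (auto intro!: derivative_eq_intros Mh_deriv)
  have te: "0 < t\<^sup>2 * e" using t e by simp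
  have "\<psi> e \<le> \<psi> (t\<^sup>2 * e)"
  proof (cases "e \<le> t\<^sup>2 * e")
    case True
    then show ?thesis
    proof (rule DERIV_nonneg_imp_nondecreasing)
      fix x assume x: "e \<le> x" "x \<le> t\<^sup>2 * e"
      then have "M x * e / x \<le> M e" "0 < x" using M_ratio_mono[of e x] e by auto
      then have "0 \<le> k * (2 * x) - M x" unfolding k using e by (simp add: field_simps)
      then show "\<exists>y. (\<psi> has_real_derivative y) (at x) \<and> 0 \<le> y" using d[of x] \<open>0 < x\<close> by blast
    qed
  next
    case False
    then have "t\<^sup>2 * e \<le> e" by simp
    then show ?thesis
    proof (rule DERIV_nonpos_imp_nonincreasing)
      fix x assume x: "t\<^sup>2 * e \<le> x" "x \<le> e"
      then have "0 < x" using te by simp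
      then have "k * (2 * x) - M x \<le> 0" unfolding k using M_ratio_mono[of x e] x by simp
      then show "\<exists>y. (\<psi> has_real_derivative y) (at x) \<and> y \<le> 0" using d[of x] \<open>0 < x\<close> by blast
    qed
  qed
  moreover have "k * (t\<^sup>2 * e)\<^sup>2 - k * e\<^sup>2 = M e * e * (t ^ 4 - 1) / 2"
    using e by (simp add: k_def power2_eq_square power4_eq_xxxx field_simps)
  moreover define z where "z = M e * e * (t ^ 4 - 1)"
  ultimately show ?thesis unfolding z_def[symmetric] \<psi>_def by linarith
qed

section \<open>Quartic scaling of the nonlinearity\<close>

lemma f_scale:
  assumes "0 < a" "a \<le> b"
  shows "f a * b ^ 3 \<le> f b * a ^ 3"
proof -
  have "f a / a ^ 3 \<le> f b / b ^ 3" using f_mono assms by (auto simp: mono_on_def)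
  then show ?thesis using assms by (simp add: field_simps)
qed

lemma g_scale_le:
  assumes t: "0 \<le> t" "t \<le> 1"
  shows "g (t * x) \<le> t ^ 4 * g x"
proof (cases "0 < x \<and> 0 < t")
  case True
  then have "f (t * x) * x ^ 3 \<le> (f x * t ^ 3) * x ^ 3" using f_scale[of "t * x" x] t by (simp add: power_mult_distrib mult_ac)
  then have "f (t * x) \<le> f x * t ^ 3" using True by simp
  then have "f (t * x) * (t * x) \<le> f x * t ^ 3 * (t * x)" using True by (intro mult_right_mono) auto
  then show ?thesis by (simp add: g_def power4_eq_xxxx power3_eq_cube mult_ac)
next
  case False
  then have "t * x \<le> 0" using t by (cases "t = 0") (auto simp: mult_nonneg_nonpos)
  then show ?thesis using g_nonneg[of x] t by simp
qed

lemma g_scale_ge: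
  assumes t: "1 \<le> t"
  shows "t ^ 4 * g x \<le> g (t * x)"
proof -
  have "g (1 / t * (t * x)) \<le> (1 / t) ^ 4 * g (t * x)" using t by (intro g_scale_le) auto
  then show ?thesis using t by (simp add: power_one_over field_simps)
qed

text \<open>Counterpart of \<open>Mh_scale_le\<close>: F (r x) - g x r^4 / 4 is smallest over r
  \<ge> 0 at r = 1, because f (r x) - r^3 f x changes sign there.\<close>

lemma F_scale_ge:
  assumes t: "0 \<le> t"
  shows "F x + g x * (t ^ 4 - 1) / 4 \<le> F (t * x)"
proof (cases "0 < x")
  case True
  define \<phi> where "\<phi> r = F (r * x) - g x * r ^ 4 / 4" for r
  have d: "(\<phi> has_real_derivative (f (r * x) * x - g x * r ^ 3)) (at r)" for r
    unfolding \<phi>_def by (auto intro!: derivative_eq_intros DERIV_chain2[OF F_deriv])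
  have "\<phi> 1 \<le> \<phi> t"
  proof (cases "1 \<le> t")
    case True
    then show ?thesis
    proof (rule DERIV_nonneg_imp_nondecreasing)
      fix r assume r: "1 \<le> r" "r \<le> t"
      have "f x * (r * x) ^ 3 \<le> f (r * x) * x ^ 3" using \<open>0 < x\<close> r by (intro f_scale) auto
      then have "f x * r ^ 3 \<le> f (r * x)" using \<open>0 < x\<close> by (simp add: power_mult_distrib)
      then have "f x * r ^ 3 * x \<le> f (r * x) * x" using \<open>0 < x\<close> by (intro mult_right_mono) auto
      then have "0 \<le> f (r * x) * x - g x * r ^ 3" by (simp add: g_def mult_ac)
      then show "\<exists>y. (\<phi> has_real_derivative y) (at r) \<and> 0 \<le> y" using d by blast
    qed
  next
    case False
    then have "t \<le> 1" by simp
    then show ?thesis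
    proof (rule DERIV_nonpos_imp_nonincreasing)
      fix r assume r: "t \<le> r" "r \<le> 1"
      have "f (r * x) \<le> f x * r ^ 3"
      proof (cases "r = 0")
        case False
        then have "f (r * x) * x ^ 3 \<le> f x * (r * x) ^ 3" using \<open>0 < x\<close> r t by (intro f_scale) auto
        then show ?thesis using \<open>0 < x\<close> by (simp add: power_mult_distrib)
      qed (simp add: f_nonpos)
      then have "f (r * x) * x \<le> f x * r ^ 3 * x" using \<open>0 < x\<close> by (intro mult_right_mono) auto
      then have "f (r * x) * x - g x * r ^ 3 \<le> 0" by (simp add: g_def mult_ac)
      then show "\<exists>y. (\<phi> has_real_derivative y) (at r) \<and> y \<le> 0" using d by blast
    qed
  qed
  then show ?thesis by (simp add: \<phi>_def right_diff_distrib diff_divide_distrib)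
next
  case False
  then show ?thesis using t by (simp add: mult_nonneg_nonpos)
qed

lemma H_scale_le:
  assumes t: "0 \<le> t" "t \<le> 1"
  shows "H (t * x) \<le> H x"
proof -
  have "g x * (t ^ 4 - 1) / 4 = t ^ 4 * g x / 4 - g x / 4" by (simp add: algebra_simps diff_divide_distrib)
  then show ?thesis
    using F_scale_ge[OF t(1), of x] g_scale_le[OF t, of x] unfolding H_def by linarith
qed

lemma H_nonneg: "0 \<le> H x"
  using H_scale_le[of 0 x] by (simp add: H_def)

text \<open>The Ambrosetti-Rabinowitz inequality makes F r / r^\<theta> nondecreasing on
  [1, t].\<close>

lemma g_superlinear: "1 \<le> t \<Longrightarrow> \<theta> * F 1 * t powr \<theta> \<le> g t"
proof -
  assume t: "1 \<le> t"
  define \<phi> where "\<phi> r = F r * r powr (- \<theta>)" for r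
  have "\<phi> 1 \<le> \<phi> t"
    using t
  proof (rule DERIV_nonneg_imp_nondecreasing)
    fix r :: real assume r: "1 \<le> r" "r \<le> t"
    have "(\<phi> has_real_derivative (f r * r powr (- \<theta>) + F r * (- \<theta> * r powr (- \<theta> - 1)))) (at r)"
      unfolding \<phi>_def using r by (auto intro!: derivative_eq_intros F_deriv simp: algebra_simps)
    moreover have "f r * r powr (- \<theta>) + F r * (- \<theta> * r powr (- \<theta> - 1)) = (g r - \<theta> * F r) * r powr (- \<theta> - 1)"
      using r by (simp add: g_def powr_diff field_simps)
    moreover have "0 \<le> (g r - \<theta> * F r) * r powr (- \<theta> - 1)" using g_ge_F[of r] r by simp
    ultimately show "\<exists>y. (\<phi> has_real_derivative y) (at r) \<and> 0 \<le> y" by metis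
  qed
  then have "F 1 * t powr \<theta> \<le> F t * t powr (- \<theta>) * t powr \<theta>"
    by (intro mult_right_mono) (auto simp: \<phi>_def)
  also have "\<dots> = F t" using t by (simp add: mult.assoc flip: powr_add)
  finally have "\<theta> * (F 1 * t powr \<theta>) \<le> \<theta> * F t" using \<theta> by (intro mult_left_mono) auto
  then show ?thesis using g_ge_F[of t] t by (simp add: mult.assoc)
qed

lemma little_growth_g: "little_growth q g"
  unfolding little_growth_def
proof (intro conjI g_cont allI impI)
  fix e :: real assume e: "0 < e"
  have "eventually (\<lambda>t. dist (f t / t ^ 3) 0 < 1) (at_right 0)" using f_zero by (rule tendstoD) simp
  then obtain b where b: "0 < b" "\<And>t. 0 < t \<Longrightarrow> t < b \<Longrightarrow> \<bar>f t / t ^ 3\<bar> < 1"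
    by (auto simp: eventually_at_right_field)
  have "eventually (\<lambda>t. dist (f t / t powr (q - 1)) 0 < e) at_top" by (rule tendstoD[OF f_top e])
  then obtain k where k: "\<And>t. k \<le> t \<Longrightarrow> \<bar>f t / t powr (q - 1)\<bar> < e"
    by (auto simp: eventually_at_top_linorder)
  \<comment> \<open>With \<open>t \<le> 1\<close> and \<open>t \<le> e\<close> the bound t^4 is at
    most e t^2; b / 2 keeps t strictly below \<open>b\<close>.\<close>
  define d where "d = min (b / 2) (min 1 e)"
  define k' where "k' = max k 1"
  have eg: "0 \<le> e * growth q t" for t using e by simp
  have "0 < d" "0 < k'" using b e by (auto simp: d_def k'_def)
  moreover have "\<bar>g t\<bar> \<le> e * growth q t" if t: "\<bar>t\<bar> \<le> d \<or> k' \<le> \<bar>t\<bar>" for t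
    proof (cases "0 < t")
      case pos: True
      show ?thesis
      proof (cases "t \<le> d")
        case True
        then have td: "t < b" "t \<le> 1" "t \<le> e" using b by (auto simp: d_def)
        have "\<bar>f t\<bar> < t ^ 3" using b(2)[OF pos td(1)] pos by (simp add: abs_divide)
        then have "\<bar>g t\<bar> \<le> t ^ 3 * t" using pos by (simp add: g_def abs_mult mult_right_mono)
        also have "\<dots> = t\<^sup>2 * (t * t)" by (simp add: power2_eq_square power3_eq_cube)
        also have "\<dots> \<le> t\<^sup>2 * (e * 1)" using pos td e by (intro mult_left_mono mult_mono) auto
        also have "\<dots> \<le> e * growth q t" using e by (simp add: growth_def)
        finally show ?thesis .
      next
        case False
        then have "k' \<le> t" using t pos by auto
        then have "\<bar>f t\<bar> < e * t powr (q - 1)" using k[of t] pos by (simp add: abs_divide k'_def pos_divide_less_eq)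
        then have "\<bar>g t\<bar> \<le> e * t powr (q - 1) * t" using pos by (simp add: g_def abs_mult mult_right_mono)
        also have "\<dots> = e * t powr q" using pos by (simp add: powr_diff)
        also have "\<dots> \<le> e * growth q t" using e pos by (simp add: growth_def)
        finally show ?thesis .
      qed
    qed (use eg in simp)
  ultimately show "\<exists>d>0. \<exists>k>0. \<forall>t. \<bar>t\<bar> \<le> d \<or> k \<le> \<bar>t\<bar> \<longrightarrow> \<bar>g t\<bar> \<le> e * growth q t"
    by blast
qed

lemma little_growth_dominated:
  assumes h: "continuous_on UNIV h" "\<And>t. \<bar>h t\<bar> \<le> g t"
  shows "little_growth q h"
  unfolding little_growth_def
proof (intro conjI h(1) allI impI)
  fix e :: real assume "0 < e"
  then obtain d k where dk: "0 < d" "0 < k" "\<And>t. \<bar>t\<bar> \<le> d \<or> k \<le> \<bar>t\<bar> \<Longrightarrow> \<bar>g t\<bar> \<le> e * growth q t"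
    using little_growth_g unfolding little_growth_def by metis
  then show "\<exists>d>0. \<exists>k>0. \<forall>t. \<bar>t\<bar> \<le> d \<or> k \<le> \<bar>t\<bar> \<longrightarrow> \<bar>h t\<bar> \<le> e * growth q t"
    using h(2) g_nonneg by (metis abs_of_nonneg order_trans)
qed

lemma little_growth_F: "little_growth q F"
proof (rule little_growth_dominated[OF F_cont])
  show "\<bar>F t\<bar> \<le> g t" for t
    using H_nonneg[of t] F_nonneg[of t] g_nonneg[of t] by (simp add: H_def)
qed

lemma little_growth_H: "little_growth q H"
proof (rule little_growth_dominated[OF H_cont])
  show "\<bar>H t\<bar> \<le> g t" for t
    using H_nonneg[of t] F_nonneg[of t] g_nonneg[of t] by (simp add: H_def)
qed

text \<open>Allowing different arguments \<open>a\<close> and \<open>b\<close> yields one dominating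
  function for difference quotients of \<open>F\<close>, where \<open>f\<close> is evaluated at an
  intermediate point, and for the functional \<open>L\<close>.\<close>

lemma f_mult_bound:
  obtains C where "0 < C" "\<And>a b y. \<bar>a\<bar> \<le> y \<Longrightarrow> \<bar>b\<bar> \<le> y \<Longrightarrow> \<bar>f a * b\<bar> \<le> C * growth q y"
proof -
  obtain C where C: "0 < C" "\<And>t. \<bar>g t\<bar> \<le> C * growth q t"
    using little_growth_le_growth[OF little_growth_g] by blast
  have "\<bar>f a * b\<bar> \<le> C * growth q y" if ab: "\<bar>a\<bar> \<le> y" "\<bar>b\<bar> \<le> y" for a b y
  proof (cases "0 < a")
    case True
    then have y: "0 < y" "a \<le> y" using ab by auto
    have "f a * a \<le> C * growth q a" using C(2)[of a] by (simp add: g_def)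
    also have "\<dots> = C * (a + a powr (q - 1)) * a"
      using True by (simp add: growth_def powr_diff power2_eq_square algebra_simps)
    finally have "f a \<le> C * (a + a powr (q - 1))" using True by simp
    also have "\<dots> \<le> C * (y + y powr (q - 1))"
      using y True C q_gt by (intro mult_left_mono add_mono powr_mono2) auto
    finally have "f a * \<bar>b\<bar> \<le> C * (y + y powr (q - 1)) * y"
      using ab f_nonneg[of a] y C by (intro mult_mono) auto
    also have "\<dots> = C * growth q y"
      using y by (simp add: growth_def powr_diff power2_eq_square algebra_simps)
    finally show ?thesis using f_nonneg[of a] by (simp add: abs_mult)
  next
    case False
    then show ?thesis using C by (simp add: f_nonpos)
  qed
  then show ?thesis using C(1) that by blast
qed

end

context kirchhoff
begin

text \<open>\<open>I\<close> is the energy functional and \<open>J u\<close> its derivative at \<open>u\<close> in direction \<open>u\<close>. The combination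
  \<open>G = I - J / 4\<close> agrees with \<open>I\<close> on the Nehari set, is coercive and increases along rays.\<close>
definition J where "J u = M (E u) * E u - (\<integral>x. g (u x) \<partial>lborel)"
definition G where "G u = K (E u) + (\<integral>x. H (u x) \<partial>lborel)"
definition I where "I u = Mh (E u) / 2 - (\<integral>x. F (u x) \<partial>lborel)"

text \<open>\<open>J u \<le> 0\<close> instead of \<open>J u = 0\<close>: the inequality passes to limits almost everywhere.\<close>
definition constraint_set where
  "constraint_set = {u \<in> Hs s. radial u \<and> 0 < E u \<and> J u \<le> 0}"

lemma I_eq:
  assumes u: "u \<in> Hs s"
  shows "I u = G u + J u / 4"
proof -
  have "(\<integral>x. H (u x) \<partial>lborel) = (\<integral>x. g (u x) \<partial>lborel) / 4 - (\<integral>x. F (u x) \<partial>lborel)"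
    unfolding H_def
    using integrable_little_growth[OF little_growth_g u] integrable_little_growth[OF little_growth_F u] by simp
  then show ?thesis by (simp add: I_def G_def J_def K_def diff_divide_distrib)
qed

lemma G_nonneg: "0 \<le> G u"
proof -
  have "0 \<le> m0 * E u / 4" using m0 by simp
  also have "\<dots> \<le> K (E u)" by (rule K_ge) simp
  finally show ?thesis unfolding G_def using H_nonneg by (intro add_nonneg_nonneg integral_nonneg_AE) auto
qed

lemma E_le_G: "E u \<le> 4 * G u / m0"
proof -
  have "m0 * E u / 4 \<le> K (E u)" by (rule K_ge) simp
  also have "\<dots> \<le> G u" unfolding G_def using H_nonneg by simp
  finally show ?thesis using m0 by (simp add: field_simps)
qed

text \<open>On the constraint set m0 E \<le> m0 E / 2 + c E^(q/2) by the Sobolev embedding, and q >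
  2 keeps a positive E away from 0. This prevents minimizing sequences from vanishing.\<close>

lemma constraint_lower_bound: "\<exists>\<rho>>0. \<forall>u\<in>constraint_set. \<rho> \<le> E u"
proof -
  obtain C where C: "0 < C" "\<And>u. u \<in> Hs s \<Longrightarrow> integrable lborel (\<lambda>x. \<bar>u x\<bar> powr q)"
    "\<And>u. u \<in> Hs s \<Longrightarrow> (\<integral>x. \<bar>u x\<bar> powr q \<partial>lborel) \<le> C * E u powr (q / 2)"
    using sobolev_embedding[of q] q_gt q_less by auto
  \<comment> \<open>Makes the square part of the growth bound at most half of m0 E.\<close>
  define e where "e = m0 * V0 / 2"
  have e: "0 < e" using m0 V0_pos by (simp add: e_def)
  obtain D where D: "0 < D" "\<And>t. \<bar>g t\<bar> \<le> e * growth q t + D * \<bar>t\<bar> powr q"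
    using little_growth_bound[OF little_growth_g e, of q] by blast
  define c where "c = (e + D) * C"
  have c: "0 < c" using e D C by (simp add: c_def)
  show ?thesis
  proof (intro exI[of _ "(m0 / (2 * c)) powr (1 / (q / 2 - 1))"] conjI ballI)
    show "0 < (m0 / (2 * c)) powr (1 / (q / 2 - 1))" using m0 c by simp
    fix u assume "u \<in> constraint_set"
    then have u: "u \<in> Hs s" "0 < E u" "J u \<le> 0" by (auto simp: constraint_set_def)
    have "m0 * E u \<le> M (E u) * E u" using M_ge[of "E u"] u by (intro mult_right_mono) auto
    also have "\<dots> \<le> (\<integral>x. g (u x) \<partial>lborel)" using u by (simp add: J_def)
    also have "\<dots> \<le> (\<integral>x. e * (u x)\<^sup>2 + (e + D) * \<bar>u x\<bar> powr q \<partial>lborel)"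
    proof (rule integral_mono)
      show "integrable lborel (\<lambda>x. g (u x))" by (rule integrable_little_growth[OF little_growth_g u(1)])
      show "integrable lborel (\<lambda>x. e * (u x)\<^sup>2 + (e + D) * \<bar>u x\<bar> powr q)"
        using Hs_square[OF u(1)] C(2)[OF u(1)] by simp
      show "g (u x) \<le> e * (u x)\<^sup>2 + (e + D) * \<bar>u x\<bar> powr q" for x
        using D(2)[of "u x"] by (simp add: growth_def algebra_simps)
    qed
    also have "\<dots> = e * (\<integral>x. (u x)\<^sup>2 \<partial>lborel) + (e + D) * (\<integral>x. \<bar>u x\<bar> powr q \<partial>lborel)"
      using Hs_square[OF u(1)] C(2)[OF u(1)] by simp
    also have "\<dots> \<le> e * (E u / V0) + (e + D) * (C * E u powr (q / 2))"
      using e D integral_square_le_E[OF u(1)] C(3)[OF u(1)] by (intro add_mono mult_left_mono) auto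
    also have "\<dots> = m0 * E u / 2 + c * E u powr (q / 2)"
      using V0_pos by (simp add: e_def c_def)
    also have "E u powr (q / 2) = E u powr (q / 2 - 1) * E u"
      using u(2) by (simp add: powr_diff)
    finally have "m0 / 2 * E u \<le> c * E u powr (q / 2 - 1) * E u" by simp
    then have "m0 / 2 \<le> c * E u powr (q / 2 - 1)" using u(2) by simp
    then have "m0 / (2 * c) \<le> E u powr (q / 2 - 1)" using c by (simp add: field_simps)
    then have "(m0 / (2 * c)) powr (1 / (q / 2 - 1)) \<le> (E u powr (q / 2 - 1)) powr (1 / (q / 2 - 1))"
      using m0 c q_gt by (intro powr_mono2) auto
    also have "\<dots> = E u" using u(2) q_gt by (simp add: powr_powr)
    finally show "(m0 / (2 * c)) powr (1 / (q / 2 - 1)) \<le> E u" .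
  qed
qed

text \<open>Along the ray through a tent the Kirchhoff term grows at most like t^4 and the nonlinear
  term at least like t^\<theta> with \<theta> > 4.\<close>

lemma constraint_nonempty: "constraint_set \<noteq> {}"
proof -
  define \<psi> where "\<psi> = tent 2"
  have \<psi>: "\<psi> \<in> Hs s" "radial \<psi>" using tent_Hs[OF s_pos s_less] tent_radial by (auto simp: \<psi>_def)
  have [measurable]: "ball (0 :: point) 1 \<in> sets borel" by simp
  let ?B = "indicator (ball (0 :: point) 1) :: point \<Rightarrow> real"
  define b where "b = measure lborel (ball (0 :: point) 1)"
  have b: "0 < b" unfolding b_def using content_ball_pos[of 1 "0 :: point"] by simp
  have Bi: "integrable lborel ?B"
    using emeasure_lborel_ball_finite[of "0 :: point" 1] by (intro integrable_real_indicator) auto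
  have "E \<psi> \<noteq> 0"
  proof
    assume "E \<psi> = 0"
    then have "AE x in lborel. \<psi> x = 0" using E_eq_0_iff[OF \<psi>(1)] by simp
    then have "AE x in lborel. x \<notin> ball (0 :: point) 1"
      by eventually_elim (auto simp: \<psi>_def tent_def)
    then have "emeasure lborel {x \<in> space lborel. \<not> x \<notin> ball (0 :: point) 1} = 0"
      by (subst (asm) AE_iff_measurable[OF _ refl]) simp_all
    then have "emeasure lborel (ball (0 :: point) 1) = 0" by (simp add: ball_def)
    then show False using b by (simp add: b_def measure_def)
  qed
  then have E: "0 < E \<psi>" using E_nonneg[of \<psi>] by linarith
  \<comment> \<open>Ratio of the coefficients of t^4 and t^\<theta>; \<open>b\<close> is the volume
    of the unit ball, on which \<open>tent 2\<close> equals 1. The \<open>t\<close> below satisfies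
    D \<le> t^(\<theta> - 4).\<close>
  define D where "D = M (E \<psi>) * E \<psi> / (b * (\<theta> * F 1))"
  have F1: "0 < \<theta> * F 1" using F_pos[of 1] \<theta> by simp
  have D: "0 < D" unfolding D_def using M_pos[of "E \<psi>"] E b F1 by simp
  define t where "t = max 1 (D powr (1 / (\<theta> - 4)))"
  have t: "1 \<le> t" "0 < t" by (auto simp: t_def)
  have "D = (D powr (1 / (\<theta> - 4))) powr (\<theta> - 4)" using D \<theta> by (simp add: powr_powr)
  also have "\<dots> \<le> t powr (\<theta> - 4)" using \<theta> by (intro powr_mono2) (auto simp: t_def)
  finally have "D * t ^ 4 \<le> t powr (\<theta> - 4) * t ^ 4" using t by (intro mult_right_mono) auto
  also have "\<dots> = t powr \<theta>" using t by (simp add: powr_diff)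
  finally have "(b * (\<theta> * F 1)) * (D * t ^ 4) \<le> (b * (\<theta> * F 1)) * t powr \<theta>"
    using b F1 by (intro mult_left_mono) auto
  moreover have "(b * (\<theta> * F 1)) * D = M (E \<psi>) * E \<psi>"
  proof -
    have "b * (\<theta> * F 1) \<noteq> 0" using b F1 by auto
    then show ?thesis unfolding D_def by (rule nonzero_mult_div_cancel_left[of "b * (\<theta> * F 1)", unfolded times_divide_eq_right[symmetric]])
  qed
  ultimately have Dt: "M (E \<psi>) * E \<psi> * t ^ 4 \<le> b * (\<theta> * F 1 * t powr \<theta>)"
    by (metis mult.assoc)
  let ?u = "\<lambda>x. t * \<psi> x"
  have u: "?u \<in> Hs s" "radial ?u" using Hs_scale[OF \<psi>(1)] radial_scale[OF \<psi>(2)] by auto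
  have Eu: "E ?u = t\<^sup>2 * E \<psi>" by (rule Hs_energy_scale[OF \<psi>(1)])
  have Epos: "0 < E ?u" using E t by (simp add: Eu)
  have "E \<psi> \<le> t\<^sup>2 * E \<psi>" using E t by simp
  then have "M (t\<^sup>2 * E \<psi>) * E \<psi> / (t\<^sup>2 * E \<psi>) \<le> M (E \<psi>)" using E by (intro M_ratio_mono) auto
  then have "M (t\<^sup>2 * E \<psi>) \<le> M (E \<psi>) * t\<^sup>2" using E t by (simp add: pos_divide_le_eq)
  then have "M (E ?u) * E ?u \<le> M (E \<psi>) * t\<^sup>2 * (t\<^sup>2 * E \<psi>)"
    unfolding Eu using E by (intro mult_right_mono) auto
  also have "\<dots> = M (E \<psi>) * E \<psi> * t ^ 4" by (simp add: power4_eq_xxxx power2_eq_square mult_ac)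
  also note Dt
  also have "b * (\<theta> * F 1 * t powr \<theta>) \<le> b * g t" using b g_superlinear[OF t(1)] by simp
  also have "\<dots> = (\<integral>x. g t * ?B x \<partial>lborel)" using Bi by (simp add: b_def mult.commute)
  also have "\<dots> \<le> (\<integral>x. g (?u x) \<partial>lborel)"
  proof (rule integral_mono)
    show "integrable lborel (\<lambda>x. g t * ?B x)" using Bi by simp
    show "integrable lborel (\<lambda>x. g (?u x))" by (rule integrable_little_growth[OF little_growth_g u(1)])
    show "g t * ?B x \<le> g (?u x)" for x
      using g_nonneg by (cases "x \<in> ball 0 1") (auto simp: \<psi>_def tent_def)
  qed
  finally have "J ?u \<le> 0" by (simp add: J_def)
  then have "?u \<in> constraint_set" using u Epos by (simp add: constraint_set_def)
  then show ?thesis by blast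
qed

section \<open>Existence of a minimizer\<close>

lemma tendsto_M:
  assumes "\<And>n. 0 \<le> a n" "a \<longlonglongrightarrow> l"
  shows "(\<lambda>n. M (a n)) \<longlonglongrightarrow> M l"
proof -
  have "0 \<le> l" using assms by (intro LIMSEQ_le_const[OF assms(2)]) auto
  then show ?thesis
    using continuous_on_tendsto_compose[OF M_cont assms(2)] assms(1) by simp
qed

lemma tendsto_K:
  assumes "\<And>n. 0 \<le> a n" "a \<longlonglongrightarrow> l"
  shows "(\<lambda>n. K (a n)) \<longlonglongrightarrow> K l"
proof -
  have l: "0 \<le> l" using assms by (intro LIMSEQ_le_const[OF assms(2)]) auto
  have "eventually (\<lambda>n. a n < l + 1) sequentially" using assms(2) by (rule order_tendstoD) simp
  then have "eventually (\<lambda>n. a n \<in> {0..l + 1}) sequentially"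
    by eventually_elim (use assms(1) in \<open>auto intro: less_imp_le\<close>)
  then have "(\<lambda>n. Mh (a n)) \<longlonglongrightarrow> Mh l"
    using l by (intro continuous_on_tendsto_compose[OF Mh_cont[of "l + 1"] assms(2)]) auto
  then show ?thesis unfolding K_def using tendsto_M[OF assms] assms(2) by (intro tendsto_intros) auto
qed

text \<open>The energies converge to some A' \<ge> E v, possibly with strict inequality, while the
  integrals of \<open>g\<close> and \<open>H\<close> converge to their values at \<open>v\<close>.
  Monotonicity of \<open>M\<close> and \<open>K\<close> then gives \<open>J v \<le> 0\<close> and
  \<open>G v \<le> c\<close>. The limit is nonzero because its integral of \<open>g\<close> is at
  least M A' A' > 0.\<close>

lemma minimizer_exists:
  "\<exists>v\<in>constraint_set. \<forall>u\<in>constraint_set. G v \<le> G u"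
proof -
  define c where "c = Inf (G ` constraint_set)"
  have bdd: "bdd_below (G ` constraint_set)" using G_nonneg by (intro bdd_belowI[of _ 0]) auto
  have c_le: "c \<le> G u" if "u \<in> constraint_set" for u
    unfolding c_def using that by (intro cInf_lower bdd) auto
  have "\<exists>u. u \<in> constraint_set \<and> G u < c + 1 / real (Suc n)" for n
  proof -
    have "Inf (G ` constraint_set) < c + 1 / real (Suc n)" by (simp add: c_def)
    then show ?thesis using cInf_less_iff[OF _ bdd] constraint_nonempty by auto
  qed
  then obtain u where u: "\<And>n. u n \<in> constraint_set" "\<And>n. G (u n) < c + 1 / real (Suc n)"
    using choice[of "\<lambda>n u. u \<in> constraint_set \<and> G u < c + 1 / real (Suc n)"] by blast
  have u': "u n \<in> Hs s" "radial (u n)" "J (u n) \<le> 0" for n using u(1)[of n] by (auto simp: constraint_set_def)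
  have Glim: "(\<lambda>n. G (u n)) \<longlonglongrightarrow> c"
  proof (rule tendsto_sandwich[where f = "\<lambda>_. c" and h = "\<lambda>n. c + 1 / real (Suc n)"])
    show "(\<lambda>n. c + 1 / real (Suc n)) \<longlonglongrightarrow> c"
      using tendsto_add[OF tendsto_const LIMSEQ_Suc[OF lim_1_over_n], of c] by simp
  qed (use u c_le in \<open>auto intro!: always_eventually less_imp_le\<close>)
  define A where "A = 4 * (c + 1) / m0"
  have EA: "E (u n) \<le> A" for n
  proof -
    have "1 / real (Suc n) \<le> 1" by simp
    then have "G (u n) \<le> c + 1" using u(2)[of n] by linarith
    then have "4 * G (u n) / m0 \<le> A" using m0 by (simp add: A_def divide_right_mono)
    then show ?thesis using E_le_G[of "u n"] by linarith
  qed
  obtain r v where r: "strict_mono (r :: nat \<Rightarrow> nat)" and v: "v \<in> Hs s"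
    and lim: "AE x in lborel. (\<lambda>n. u (r n) x) \<longlonglongrightarrow> v x"
    using rellich[where u = u, OF u'(1) EA] by blast
  have "bounded (range (\<lambda>n. E (u (r n))))" using EA by (intro boundedI[of _ A]) auto
  then obtain A' r' where r': "strict_mono (r' :: nat \<Rightarrow> nat)" and A': "((\<lambda>n. E (u (r n))) \<circ> r') \<longlonglongrightarrow> A'"
    using bounded_imp_convergent_subsequence by blast
  define w where "w n = u (r (r' n))" for n
  have w: "w n \<in> Hs s" "radial (w n)" "J (w n) \<le> 0" "E (w n) \<le> A" for n using u' EA by (auto simp: w_def)
  have wA: "(\<lambda>n. E (w n)) \<longlonglongrightarrow> A'" using A' by (simp add: o_def w_def)
  have wlim: "AE x in lborel. (\<lambda>n. w n x) \<longlonglongrightarrow> v x"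
    using lim
  proof eventually_elim
    case (elim x)
    from LIMSEQ_subseq_LIMSEQ[OF elim r'] show ?case by (simp add: o_def w_def)
  qed
  have EvA': "E v \<le> A'" using E_fatou[OF w(1) Hs_borel[OF v] wlim wA] by simp
  have "A' \<le> A" using w(4) by (intro LIMSEQ_le_const2[OF wA]) auto
  then have EvA: "E v \<le> A" using EvA' by simp
  have vr: "radial v" by (rule radial_AE_limit[OF w(2) wlim])
  have conv: "(\<lambda>n. \<integral>x. h (w n x) \<partial>lborel) \<longlonglongrightarrow> (\<integral>x. h (v x) \<partial>lborel)" if "little_growth q h" for h
    by (rule radial_compactness[OF that w(1,2,4) v vr EvA wlim])
  have A'0: "0 \<le> A'" by (intro LIMSEQ_le_const[OF wA]) auto
  have MA': "M A' * A' \<le> (\<integral>x. g (v x) \<partial>lborel)"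
  proof (rule LIMSEQ_le)
    show "(\<lambda>n. M (E (w n)) * E (w n)) \<longlonglongrightarrow> M A' * A'" by (intro tendsto_mult tendsto_M wA) simp
    show "(\<lambda>n. \<integral>x. g (w n x) \<partial>lborel) \<longlonglongrightarrow> (\<integral>x. g (v x) \<partial>lborel)" by (rule conv[OF little_growth_g])
    show "\<exists>N. \<forall>n\<ge>N. M (E (w n)) * E (w n) \<le> (\<integral>x. g (w n x) \<partial>lborel)" using w(3) by (simp add: J_def)
  qed
  obtain \<rho> where \<rho>: "0 < \<rho>" "\<And>u. u \<in> constraint_set \<Longrightarrow> \<rho> \<le> E u" using constraint_lower_bound by blast
  have "\<rho> \<le> A'" using \<rho>(2) u(1) by (intro LIMSEQ_le_const[OF wA]) (auto simp: w_def)
  then have "0 < M A' * A'" using M_pos[of A'] \<rho>(1) by simp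
  have "E v \<noteq> 0"
  proof
    assume "E v = 0"
    then have "AE x in lborel. v x = 0" using E_eq_0_iff[OF v] by simp
    then have "AE x in lborel. g (v x) = 0" by eventually_elim simp
    then have "(\<integral>x. g (v x) \<partial>lborel) = 0" by (rule integral_eq_zero_AE)
    then show False using MA' \<open>0 < M A' * A'\<close> by simp
  qed
  then have Ev: "0 < E v" using E_nonneg[of v] by linarith
  have "M (E v) * E v \<le> M A' * A'"
    using EvA' Ev M_le[of "E v" A'] M_pos[of A'] by (intro mult_mono) auto
  then have "J v \<le> 0" using MA' by (simp add: J_def)
  then have vS: "v \<in> constraint_set" using v vr Ev by (simp add: constraint_set_def)
  have "G v \<le> c"
  proof -
    have "(\<lambda>n. G (w n)) \<longlonglongrightarrow> K A' + (\<integral>x. H (v x) \<partial>lborel)"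
      unfolding G_def by (intro tendsto_add tendsto_K wA conv little_growth_H) simp
    moreover have "(\<lambda>n. G (w n)) \<longlonglongrightarrow> c"
      using LIMSEQ_subseq_LIMSEQ[OF Glim strict_mono_o[OF r r']] by (simp add: o_def w_def)
    ultimately have "K A' + (\<integral>x. H (v x) \<partial>lborel) = c" by (rule LIMSEQ_unique)
    moreover have "K (E v) \<le> K A'" using EvA' by (intro K_mono) auto
    ultimately show ?thesis by (simp add: G_def)
  qed
  then show ?thesis using vS c_le by (meson order_trans)
qed

lemma growth_sum_le:
  assumes "0 \<le> p" "\<bar>y\<bar> \<le> 2 * (\<bar>a\<bar> + \<bar>b\<bar>)"
  shows "growth p y \<le> growth p (4 * a) + growth p (4 * b)"
proof (cases "\<bar>a\<bar> \<le> \<bar>b\<bar>")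
  case True
  then have "growth p y \<le> growth p (4 * b)" using assms by (intro growth_mono) auto
  then show ?thesis by (simp add: add_increasing)
next
  case False
  then have "growth p y \<le> growth p (4 * a)" using assms by (intro growth_mono) auto
  then show ?thesis by (simp add: add_increasing2)
qed

lemma integrable_growth_sum:
  assumes u: "u \<in> Hs s" "v \<in> Hs s"
  shows "integrable lborel (\<lambda>x. growth q (2 * (\<bar>u x\<bar> + \<bar>v x\<bar>)))"
proof (rule Bochner_Integration.integrable_bound)
  note [measurable] = u[THEN Hs_borel]
  show "integrable lborel (\<lambda>x. growth q (4 * u x) + growth q (4 * v x))"
    using integrable_growth[OF Hs_scale[OF u(1)]] integrable_growth[OF Hs_scale[OF u(2)]] by simp
  show "(\<lambda>x. growth q (2 * (\<bar>u x\<bar> + \<bar>v x\<bar>))) \<in> borel_measurable lborel" by measurable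
  show "AE x in lborel. norm (growth q (2 * (\<bar>u x\<bar> + \<bar>v x\<bar>))) \<le> norm (growth q (4 * u x) + growth q (4 * v x))"
    using growth_sum_le[of q] q_gt by simp
qed

lemma tendsto_J:
  assumes u: "u \<in> Hs s" "w \<in> Hs s" and a: "a \<longlonglongrightarrow> a0" and b: "b \<longlonglongrightarrow> b0"
    and bd: "\<And>n. \<bar>a n\<bar> \<le> 2" "\<And>n. \<bar>b n\<bar> \<le> 2"
  shows "(\<lambda>n. J (\<lambda>x. a n * u x + b n * w x)) \<longlonglongrightarrow> J (\<lambda>x. a0 * u x + b0 * w x)"
    and "(\<lambda>n. E (\<lambda>x. a n * u x + b n * w x)) \<longlonglongrightarrow> E (\<lambda>x. a0 * u x + b0 * w x)"
proof -
  note [measurable] = u[THEN Hs_borel]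
  show Elim: "(\<lambda>n. E (\<lambda>x. a n * u x + b n * w x)) \<longlonglongrightarrow> E (\<lambda>x. a0 * u x + b0 * w x)"
    unfolding Hs_energy_lincomb[OF u] by (intro tendsto_intros a b)
  obtain C where C: "0 < C" "\<And>t. \<bar>g t\<bar> \<le> C * growth q t"
    using little_growth_le_growth[OF little_growth_g] by blast
  have "(\<lambda>n. \<integral>x. g (a n * u x + b n * w x) \<partial>lborel) \<longlonglongrightarrow> (\<integral>x. g (a0 * u x + b0 * w x) \<partial>lborel)"
  proof (rule tendsto_integral_growth_dominated[OF g_cont C(2)])
    show "integrable lborel (\<lambda>x. growth q (2 * (\<bar>u x\<bar> + \<bar>w x\<bar>)))" by (rule integrable_growth_sum[OF u])
    show "\<bar>a n * u x + b n * w x\<bar> \<le> 2 * (\<bar>u x\<bar> + \<bar>w x\<bar>)" for n x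
    proof -
      have "\<bar>a n * u x\<bar> \<le> 2 * \<bar>u x\<bar>" unfolding abs_mult by (rule mult_right_mono[OF bd(1)]) simp
      moreover have "\<bar>b n * w x\<bar> \<le> 2 * \<bar>w x\<bar>" unfolding abs_mult by (rule mult_right_mono[OF bd(2)]) simp
      ultimately show ?thesis
        using abs_triangle_ineq[of "a n * u x" "b n * w x"] by (simp add: distrib_left)
    qed
    show "AE x in lborel. (\<lambda>n. a n * u x + b n * w x) \<longlonglongrightarrow> a0 * u x + b0 * w x"
      by (intro AE_I2 tendsto_intros a b)
  qed (use q_gt C in auto)
  then show "(\<lambda>n. J (\<lambda>x. a n * u x + b n * w x)) \<longlonglongrightarrow> J (\<lambda>x. a0 * u x + b0 * w x)"
    unfolding J_def by (intro tendsto_diff tendsto_mult tendsto_M Elim) simp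
qed

text \<open>If \<open>J v < 0\<close>, continuity lets \<open>v\<close> shrink slightly without
  leaving the constraint set, but \<open>K\<close> is strictly increasing, so \<open>G\<close> would
  drop.\<close>

lemma minimizer_J_eq_0:
  assumes v: "v \<in> constraint_set" and min: "\<And>u. u \<in> constraint_set \<Longrightarrow> G v \<le> G u"
  shows "J v = 0"
proof (rule ccontr)
  assume "J v \<noteq> 0"
  have v': "v \<in> Hs s" "radial v" "0 < E v" "J v \<le> 0" using v by (auto simp: constraint_set_def)
  then have "J v < 0" using \<open>J v \<noteq> 0\<close> by simp
  define a where "a n = 1 - 1 / real (Suc (Suc n))" for n
  have a: "0 < a n" "a n < 1" for n by (auto simp: a_def)
  have "a \<longlonglongrightarrow> 1 - 0" unfolding a_def
    by (intro tendsto_diff tendsto_const LIMSEQ_Suc[OF LIMSEQ_Suc[OF lim_1_over_n]])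
  then have "(\<lambda>n. J (\<lambda>x. a n * v x + 0 * v x)) \<longlonglongrightarrow> J (\<lambda>x. 1 * v x + 0 * v x)"
  proof (intro tendsto_J v' tendsto_const)
    show "\<bar>a n\<bar> \<le> 2" for n using a[of n] by linarith
  qed auto
  then have "eventually (\<lambda>n. J (\<lambda>x. a n * v x + 0 * v x) < 0) sequentially"
    using \<open>J v < 0\<close> by (intro order_tendstoD) auto
  then obtain n where n: "J (\<lambda>x. a n * v x) < 0" by (auto simp: eventually_sequentially)
  let ?u = "\<lambda>x. a n * v x"
  have Eu: "E ?u = (a n)\<^sup>2 * E v" by (rule Hs_energy_scale[OF v'(1)])
  have "?u \<in> constraint_set"
    using Hs_scale[OF v'(1)] radial_scale[OF v'(2)] v'(3) n a[of n] Eu by (simp add: constraint_set_def)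
  then have "G v \<le> G ?u" by (rule min)
  moreover have "G ?u < G v"
  proof -
    have "(a n)\<^sup>2 < 1" using a[of n] by (simp add: power_less_one_iff)
    then have "(a n)\<^sup>2 * E v < 1 * E v" using v'(3) by (intro mult_strict_right_mono)
    then have "K (E ?u) < K (E v)" unfolding Eu using v'(3) by (intro K_strict) auto
    moreover have "(\<integral>x. H (?u x) \<partial>lborel) \<le> (\<integral>x. H (v x) \<partial>lborel)"
      using a[of n] by (intro integral_mono integrable_little_growth[OF little_growth_H] Hs_scale v' H_scale_le) auto
    ultimately show ?thesis by (simp add: G_def)
  qed
  ultimately show False by simp
qed

end

section \<open>The minimizer is a weak solution\<close>

lemma mean_value_between:
  fixes \<Phi> \<phi> :: "real \<Rightarrow> real"
  assumes d: "\<And>x. min a b \<le> x \<Longrightarrow> x \<le> max a b \<Longrightarrow> (\<Phi> has_real_derivative \<phi> x) (at x)"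
  shows "\<exists>\<xi>. \<bar>\<xi> - a\<bar> \<le> \<bar>b - a\<bar> \<and> \<Phi> b - \<Phi> a = \<phi> \<xi> * (b - a)"
proof (cases a b rule: linorder_cases)
  case less
  then obtain z where "a < z" "z < b" "\<Phi> b - \<Phi> a = (b - a) * \<phi> z"
    using MVT2[of a b \<Phi> \<phi>] d by auto
  then show ?thesis by (intro exI[of _ z]) (auto simp: mult.commute)
next
  case equal
  then show ?thesis by auto
next
  case greater
  then obtain z where "b < z" "z < a" "\<Phi> a - \<Phi> b = (a - b) * \<phi> z"
    using MVT2[of b a \<Phi> \<phi>] d by auto
  then show ?thesis by (intro exI[of _ z]) (auto simp: algebra_simps)
qed

locale kirchhoff_minimizer = kirchhoff +
  fixes v
  assumes v_mem: "v \<in> constraint_set" and v_min: "\<And>u. u \<in> constraint_set \<Longrightarrow> G v \<le> G u"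
begin

lemma v_Hs: "v \<in> Hs s" and v_radial: "radial v" and E_v: "0 < E v"
  using v_mem by (auto simp: constraint_set_def)

lemma J_v: "J v = 0" using minimizer_J_eq_0[OF v_mem v_min] .

text \<open>The derivative of \<open>I\<close> at \<open>v\<close>; the weak equation is its
  vanishing on the whole space.\<close>

definition L where "L w = M (E v) * B v w - (\<integral>x. f (v x) * w x \<partial>lborel)"

lemma integral_g_v: "(\<integral>x. g (v x) \<partial>lborel) = M (E v) * E v"
  using J_v by (simp add: J_def)

lemma integrable_g_v [simp]: "integrable lborel (\<lambda>x. g (v x))"
  by (rule integrable_little_growth[OF little_growth_g v_Hs])

lemma integrable_f_v_mult:
  assumes w: "w \<in> Hs s"
  shows "integrable lborel (\<lambda>x. f (v x) * w x)"
proof -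
  note [measurable] = Hs_borel[OF v_Hs] Hs_borel[OF w] continuous_borel_compose[OF f_cont]
  obtain C where C: "0 < C" "\<And>a b y. \<bar>a\<bar> \<le> y \<Longrightarrow> \<bar>b\<bar> \<le> y \<Longrightarrow> \<bar>f a * b\<bar> \<le> C * growth q y"
    using f_mult_bound by blast
  show ?thesis
  proof (rule Bochner_Integration.integrable_bound)
    show "integrable lborel (\<lambda>x. C * growth q (2 * (\<bar>v x\<bar> + \<bar>w x\<bar>)))"
      using integrable_growth_sum[OF v_Hs w] by simp
    show "(\<lambda>x. f (v x) * w x) \<in> borel_measurable lborel" by measurable
    have "\<bar>f (v x) * w x\<bar> \<le> C * growth q (2 * (\<bar>v x\<bar> + \<bar>w x\<bar>))" for x by (intro C(2)) auto
    then show "AE x in lborel. norm (f (v x) * w x) \<le> norm (C * growth q (2 * (\<bar>v x\<bar> + \<bar>w x\<bar>)))"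
      using C(1) by (simp add: abs_of_nonneg)
  qed
qed

text \<open>\<open>Mh_scale_le\<close> and \<open>F_scale_ge\<close> produce the same factor (t^4 -
  1)/4, with coefficients that agree because \<open>J v = 0\<close>.\<close>

lemma I_scale_le:
  assumes t: "0 < t"
  shows "I (\<lambda>x. t * v x) \<le> I v"
proof -
  have iF: "integrable lborel (\<lambda>x. F (v x))" "integrable lborel (\<lambda>x. F (t * v x))"
    using integrable_little_growth[OF little_growth_F] v_Hs Hs_scale[OF v_Hs] by auto
  have "(\<integral>x. F (v x) \<partial>lborel) + (\<integral>x. g (v x) \<partial>lborel) * (t ^ 4 - 1) / 4
      = (\<integral>x. F (v x) + g (v x) * (t ^ 4 - 1) / 4 \<partial>lborel)" using iF by simp
  also have "\<dots> \<le> (\<integral>x. F (t * v x) \<partial>lborel)"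
    using iF t by (intro integral_mono F_scale_ge) auto
  finally show ?thesis
    using Mh_scale_le[OF t E_v] unfolding I_def Hs_energy_scale[OF v_Hs] integral_g_v by linarith
qed

text \<open>The strict sign comes from the Kirchhoff term through \<open>M_ratio_strict\<close>; the
  comparison for \<open>g\<close> is not strict.\<close>

lemma J_scale_neg:
  assumes t: "1 < t"
  shows "J (\<lambda>x. t * v x) < 0"
proof -
  have "E v < t\<^sup>2 * E v" using t E_v by simp
  then have "M (t\<^sup>2 * E v) * E v / (t\<^sup>2 * E v) < M (E v)" using E_v by (intro M_ratio_strict)
  then have "M (t\<^sup>2 * E v) < M (E v) * t\<^sup>2" using E_v t by (simp add: pos_divide_less_eq)
  then have "M (t\<^sup>2 * E v) * (t\<^sup>2 * E v) < M (E v) * t\<^sup>2 * (t\<^sup>2 * E v)"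
    using E_v t by (intro mult_strict_right_mono) auto
  also have "\<dots> = t ^ 4 * (\<integral>x. g (v x) \<partial>lborel)"
    by (simp add: integral_g_v power4_eq_xxxx power2_eq_square mult_ac)
  also have "\<dots> = (\<integral>x. t ^ 4 * g (v x) \<partial>lborel)" by simp
  also have "\<dots> \<le> (\<integral>x. g (t * v x) \<partial>lborel)"
    using t by (intro integral_mono g_scale_ge integrable_little_growth[OF little_growth_g] Hs_scale[OF v_Hs]) auto
  finally show ?thesis by (simp add: J_def Hs_energy_scale[OF v_Hs])
qed

lemma J_scale_pos:
  assumes t: "0 < t" "t < 1"
  shows "0 < J (\<lambda>x. t * v x)"
proof -
  have t2: "0 < t\<^sup>2 * E v" "t\<^sup>2 * E v < E v" using t E_v by (auto simp: power_less_one_iff)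
  have "(\<integral>x. g (t * v x) \<partial>lborel) \<le> (\<integral>x. t ^ 4 * g (v x) \<partial>lborel)"
    using t by (intro integral_mono g_scale_le integrable_little_growth[OF little_growth_g] Hs_scale[OF v_Hs]) auto
  also have "\<dots> = M (E v) * t\<^sup>2 * (t\<^sup>2 * E v)"
    by (simp add: integral_g_v power4_eq_xxxx power2_eq_square mult_ac)
  also have "\<dots> < M (t\<^sup>2 * E v) * (t\<^sup>2 * E v)"
  proof (rule mult_strict_right_mono[OF _ t2(1)])
    show "M (E v) * t\<^sup>2 < M (t\<^sup>2 * E v)" using M_ratio_strict[OF t2] E_v by simp
  qed
  finally show ?thesis by (simp add: J_def Hs_energy_scale[OF v_Hs])
qed

text \<open>The strict signs of \<open>J\<close> at (1 - d) v and (1 + d) v survive a small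
  perturbation e w, and the intermediate value theorem on the ray through v + e w gives the zero.
  This yields no rate for t - 1, which is why the comparison that follows is with t v and not with
  v.\<close>

lemma nehari_projection:
  assumes w: "w \<in> Hs s" and d: "0 < d" "d < 1"
  shows "\<exists>e t. 0 < e \<and> e \<le> d \<and> 1 - d \<le> t \<and> t \<le> 1 + d \<and>
    0 < E (\<lambda>x. t * v x + (t * e) * w x) \<and> J (\<lambda>x. t * v x + (t * e) * w x) = 0"
proof -
  define e where "e n = d / real (Suc n)" for n
  have e: "0 < e n" "e n \<le> d" for n using d by (auto simp: e_def divide_le_eq mult_le_cancel_left1)
  have e0: "e \<longlonglongrightarrow> 0"
    unfolding e_def using tendsto_mult[OF tendsto_const LIMSEQ_Suc[OF lim_1_over_n], of d] by simp
  have te: "\<bar>t * e n\<bar> \<le> 2" if "\<bar>t\<bar> \<le> 2" for t n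
    using mult_mono[OF that, of "\<bar>e n\<bar>" 1] e[of n] d by (simp add: abs_mult)
  have lim: "(\<lambda>n. J (\<lambda>x. t * v x + (t * e n) * w x)) \<longlonglongrightarrow> J (\<lambda>x. t * v x)" if t: "\<bar>t\<bar> \<le> 2" for t
  proof -
    have "(\<lambda>n. t * e n) \<longlonglongrightarrow> t * 0" by (intro tendsto_intros e0)
    then have "(\<lambda>n. J (\<lambda>x. t * v x + (t * e n) * w x)) \<longlonglongrightarrow> J (\<lambda>x. t * v x + (t * 0) * w x)"
      using t te by (intro tendsto_J v_Hs w) auto
    then show ?thesis by simp
  qed
  have "(\<lambda>n. E (\<lambda>x. 1 * v x + e n * w x)) \<longlonglongrightarrow> E (\<lambda>x. 1 * v x + 0 * w x)"
    using te[of 1] by (intro tendsto_J v_Hs w e0) auto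
  then have 1: "eventually (\<lambda>n. 0 < E (\<lambda>x. 1 * v x + e n * w x)) sequentially"
    using E_v by (intro order_tendstoD) auto
  have 2: "eventually (\<lambda>n. J (\<lambda>x. (1 + d) * v x + ((1 + d) * e n) * w x) < 0) sequentially"
    using J_scale_neg[of "1 + d"] d by (intro order_tendstoD(2)[OF lim]) auto
  have 3: "eventually (\<lambda>n. 0 < J (\<lambda>x. (1 - d) * v x + ((1 - d) * e n) * w x)) sequentially"
    using J_scale_pos[of "1 - d"] d by (intro order_tendstoD(1)[OF lim]) auto
  from eventually_conj[OF 1 eventually_conj[OF 2 3]] obtain n where n: "0 < E (\<lambda>x. 1 * v x + e n * w x)"
    "J (\<lambda>x. (1 + d) * v x + ((1 + d) * e n) * w x) < 0" "0 < J (\<lambda>x. (1 - d) * v x + ((1 - d) * e n) * w x)"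
    by (auto simp: eventually_sequentially)
  have "continuous_on {1 - d..1 + d} (\<lambda>t. J (\<lambda>x. t * v x + (t * e n) * w x))"
    unfolding continuous_on_sequentially o_def
  proof (intro allI ballI impI, elim conjE)
    fix a t assume t: "t \<in> {1 - d..1 + d}" "\<forall>n. a n \<in> {1 - d..1 + d}" "a \<longlonglongrightarrow> t"
    then have a2: "\<bar>a k\<bar> \<le> 2" for k using d by (auto simp: abs_le_iff dest!: spec[of _ k])
    show "(\<lambda>k. J (\<lambda>x. a k * v x + (a k * e n) * w x)) \<longlonglongrightarrow> J (\<lambda>x. t * v x + (t * e n) * w x)"
      by (intro tendsto_J v_Hs w t tendsto_mult tendsto_const a2 te)
  qed
  then obtain t where t: "1 - d \<le> t" "t \<le> 1 + d" "J (\<lambda>x. t * v x + (t * e n) * w x) = 0"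
    using IVT2'[of "\<lambda>t. J (\<lambda>x. t * v x + (t * e n) * w x)" "1 + d" 0 "1 - d"] n d by auto
  have "E (\<lambda>x. t * v x + (t * e n) * w x) = t\<^sup>2 * E (\<lambda>x. 1 * v x + e n * w x)"
    unfolding Hs_energy_lincomb[OF v_Hs w] by (simp add: power2_eq_square algebra_simps)
  then have "0 < E (\<lambda>x. t * v x + (t * e n) * w x)" using n(1) t d by simp
  then show ?thesis using t e[of n] by blast
qed

text \<open>The projections \<open>z n\<close> of \<open>v + e w\<close> onto the Nehari set satisfy \<open>I (t n v) \<le> I v \<le> I (z n)\<close>, and
  the difference quotient of \<open>I\<close> between \<open>t n v\<close> and \<open>z n\<close> tends to \<open>L w\<close>.\<close>
lemma L_radial_nonneg:
  assumes w: "w \<in> Hs s" "radial w"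
  shows "0 \<le> L w"
proof -
  note [measurable] = Hs_borel[OF v_Hs] Hs_borel[OF w(1)] continuous_borel_compose[OF f_cont] continuous_borel_compose[OF F_cont]
  define d where "d n = 1 / real (Suc (Suc n))" for n
  have d: "0 < d n" "d n < 1" for n by (auto simp: d_def)
  have d0: "d \<longlonglongrightarrow> 0" unfolding d_def by (rule LIMSEQ_Suc[OF LIMSEQ_Suc[OF lim_1_over_n]])
  \<comment> \<open>The pair encodes e as \<open>fst p\<close> and t as
    \<open>snd p\<close>.\<close>
  have "\<forall>n. \<exists>p. 0 < fst p \<and> fst p \<le> d n \<and> 1 - d n \<le> snd p \<and> snd p \<le> 1 + d n \<and>
    0 < E (\<lambda>x. snd p * v x + (snd p * fst p) * w x) \<and> J (\<lambda>x. snd p * v x + (snd p * fst p) * w x) = 0"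
    using nehari_projection[OF w(1) d] by simp
  then obtain p where p: "\<And>n. 0 < fst (p n)" "\<And>n. fst (p n) \<le> d n" "\<And>n. 1 - d n \<le> snd (p n)" "\<And>n. snd (p n) \<le> 1 + d n"
    "\<And>n. 0 < E (\<lambda>x. snd (p n) * v x + (snd (p n) * fst (p n)) * w x)" "\<And>n. J (\<lambda>x. snd (p n) * v x + (snd (p n) * fst (p n)) * w x) = 0"
    using choice[of "\<lambda>n p. 0 < fst p \<and> fst p \<le> d n \<and> 1 - d n \<le> snd p \<and> snd p \<le> 1 + d n \<and>
    0 < E (\<lambda>x. snd p * v x + (snd p * fst p) * w x) \<and> J (\<lambda>x. snd p * v x + (snd p * fst p) * w x) = 0"] by blast
  define t where "t n = snd (p n)" for n
  define h where "h n = snd (p n) * fst (p n)" for n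
  define z where "z n = (\<lambda>x. t n * v x + h n * w x)" for n
  have t: "0 < t n" "t n \<le> 2" for n using p(3,4)[of n] d[of n] by (auto simp: t_def)
  have h: "0 < h n" "h n \<le> 2" for n
  proof -
    show "0 < h n" using t(1)[of n] p(1)[of n] by (simp add: h_def t_def)
    have "h n \<le> 2 * 1" unfolding h_def using t[of n] p(1,2)[of n] d[of n] by (intro mult_mono) (auto simp: t_def)
    then show "h n \<le> 2" by simp
  qed
  have tlim: "t \<longlonglongrightarrow> 1"
  proof (rule tendsto_sandwich[where f = "\<lambda>n. 1 - d n" and h = "\<lambda>n. 1 + d n"])
    show "(\<lambda>n. 1 - d n) \<longlonglongrightarrow> 1" using tendsto_diff[OF tendsto_const d0, of 1] by simp
    show "(\<lambda>n. 1 + d n) \<longlonglongrightarrow> 1" using tendsto_add[OF tendsto_const d0, of 1] by simp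
  qed (use p in \<open>auto simp: t_def\<close>)
  have "(\<lambda>n. fst (p n)) \<longlonglongrightarrow> 0"
    by (rule tendsto_sandwich[OF _ _ tendsto_const d0]) (use p in \<open>auto intro!: always_eventually less_imp_le\<close>)
  from tendsto_mult[OF tlim this] have hlim: "h \<longlonglongrightarrow> 0" by (simp add: h_def[abs_def] t_def[abs_def])
  have z: "z n \<in> constraint_set" and Jz: "J (z n) = 0" and Ez: "0 < E (z n)" for n
    using p(5,6)[of n] Hs_lincomb[OF v_Hs w(1)] radial_lincomb[OF v_radial w(2)]
    by (auto simp: constraint_set_def z_def t_def h_def)
  have zH: "z n \<in> Hs s" for n using z[of n] by (simp add: constraint_set_def)
  have tvH: "(\<lambda>x. t n * v x) \<in> Hs s" for n by (rule Hs_scale[OF v_Hs])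
  have Iz: "I (\<lambda>x. t n * v x) \<le> I (z n)" for n
  proof -
    have "I (\<lambda>x. t n * v x) \<le> I v" by (rule I_scale_le[OF t(1)])
    also have "\<dots> = G v" using I_eq[OF v_Hs] J_v by simp
    also have "\<dots> \<le> G (z n)" by (rule v_min[OF z])
    also have "\<dots> = I (z n)" using I_eq[OF zH] Jz by simp
    finally show ?thesis .
  qed
  define e1 where "e1 n = E (\<lambda>x. t n * v x)" for n
  have e1: "e1 n = (t n)\<^sup>2 * E v" for n unfolding e1_def by (rule Hs_energy_scale[OF v_Hs])
  have Ez_eq: "E (z n) - e1 n = h n * (2 * t n * B v w + h n * E w)" for n
    unfolding e1 z_def Hs_energy_lincomb[OF v_Hs w(1)] by (simp add: power2_eq_square algebra_simps)
  have "\<exists>\<xi>. \<bar>\<xi> - e1 n\<bar> \<le> \<bar>E (z n) - e1 n\<bar> \<and> Mh (E (z n)) - Mh (e1 n) = M \<xi> * (E (z n) - e1 n) \<and> 0 \<le> \<xi>" for n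
  proof -
    have pos: "0 < min (e1 n) (E (z n))" using Ez[of n] E_v t[of n] by (simp add: e1)
    \<comment> \<open>The conditions on \<open>M\<close> concern nonnegative arguments and
      \<open>mean_value_between\<close> does not state the sign of its point. Composing with the
      absolute value makes the point replaceable by its absolute value.\<close>
    have "\<exists>\<xi>. \<bar>\<xi> - e1 n\<bar> \<le> \<bar>E (z n) - e1 n\<bar> \<and> Mh (E (z n)) - Mh (e1 n) = M \<bar>\<xi>\<bar> * (E (z n) - e1 n)"
      by (rule mean_value_between[where \<phi> = "\<lambda>x. M \<bar>x\<bar>"]) (use pos Mh_deriv in auto)
    then obtain \<xi> where \<xi>: "\<bar>\<xi> - e1 n\<bar> \<le> \<bar>E (z n) - e1 n\<bar>" "Mh (E (z n)) - Mh (e1 n) = M \<bar>\<xi>\<bar> * (E (z n) - e1 n)" by blast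
    have "\<bar>\<bar>\<xi>\<bar> - e1 n\<bar> \<le> \<bar>\<xi> - e1 n\<bar>" using pos by (auto simp: abs_if)
    then show ?thesis using \<xi> by (intro exI[of _ "\<bar>\<xi>\<bar>"]) auto
  qed
  then obtain \<xi> where \<xi>: "\<And>n. \<bar>\<xi> n - e1 n\<bar> \<le> \<bar>E (z n) - e1 n\<bar>" "\<And>n. Mh (E (z n)) - Mh (e1 n) = M (\<xi> n) * (E (z n) - e1 n)" "\<And>n. 0 \<le> \<xi> n"
    by metis
  have e1lim: "e1 \<longlonglongrightarrow> E v"
  proof -
    have "(\<lambda>n. (t n)\<^sup>2 * E v) \<longlonglongrightarrow> 1\<^sup>2 * E v" by (intro tendsto_intros tlim)
    then show ?thesis by (simp add: e1[abs_def])
  qed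
  have difflim: "(\<lambda>n. E (z n) - e1 n) \<longlonglongrightarrow> 0"
  proof -
    have "(\<lambda>n. h n * (2 * t n * B v w + h n * E w)) \<longlonglongrightarrow> 0 * (2 * 1 * B v w + 0 * E w)"
      by (intro tendsto_intros tlim hlim)
    then show ?thesis by (simp add: Ez_eq)
  qed
  have "(\<lambda>n. \<xi> n - e1 n) \<longlonglongrightarrow> 0"
    by (rule Lim_null_comparison[OF _ tendsto_rabs_zero[OF difflim]]) (use \<xi>(1) in auto)
  from tendsto_add[OF this e1lim] have \<xi>lim: "\<xi> \<longlonglongrightarrow> E v" by simp
  have D1: "(\<lambda>n. (Mh (E (z n)) / 2 - Mh (e1 n) / 2) / h n) \<longlonglongrightarrow> M (E v) * B v w"
  proof -
    have "(\<lambda>n. M (\<xi> n) * (2 * t n * B v w + h n * E w) / 2) \<longlonglongrightarrow> M (E v) * (2 * 1 * B v w + 0 * E w) / 2"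
      by (intro tendsto_intros tlim hlim tendsto_M \<xi> \<xi>lim) simp
    moreover have eq: "(Mh (E (z n)) / 2 - Mh (e1 n) / 2) / h n = M (\<xi> n) * (2 * t n * B v w + h n * E w) / 2" for n
    proof -
      have "Mh (E (z n)) / 2 - Mh (e1 n) / 2 = (Mh (E (z n)) - Mh (e1 n)) / 2" by simp
      also have "\<dots> = h n * (M (\<xi> n) * (2 * t n * B v w + h n * E w) / 2)" unfolding \<xi>(2) Ez_eq by simp
      finally show ?thesis using h(1)[of n] by simp
    qed
    ultimately show ?thesis unfolding eq by simp
  qed
  obtain C where C: "0 < C" "\<And>a b y. \<bar>a\<bar> \<le> y \<Longrightarrow> \<bar>b\<bar> \<le> y \<Longrightarrow> \<bar>f a * b\<bar> \<le> C * growth q y"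
    using f_mult_bound by blast
  have quot: "\<exists>\<xi>. \<bar>\<xi> - t n * v x\<bar> \<le> h n * \<bar>w x\<bar> \<and> (F (z n x) - F (t n * v x)) / h n = f \<xi> * w x" for n x
  proof -
    obtain \<xi> where "\<bar>\<xi> - t n * v x\<bar> \<le> \<bar>z n x - t n * v x\<bar>" "F (z n x) - F (t n * v x) = f \<xi> * (z n x - t n * v x)"
      using mean_value_between[of "t n * v x" "z n x" F f] F_deriv by blast
    then show ?thesis using h(1)[of n] by (intro exI[of _ \<xi>]) (auto simp: z_def abs_mult)
  qed
  have D2: "(\<lambda>n. \<integral>x. (F (z n x) - F (t n * v x)) / h n \<partial>lborel) \<longlonglongrightarrow> (\<integral>x. f (v x) * w x \<partial>lborel)"
  proof (rule integral_dominated_convergence[where w = "\<lambda>x. C * growth q (2 * (\<bar>v x\<bar> + \<bar>w x\<bar>))"])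
    show "(\<lambda>x. f (v x) * w x) \<in> borel_measurable lborel" by measurable
    show "(\<lambda>x. (F (z n x) - F (t n * v x)) / h n) \<in> borel_measurable lborel" for n
      unfolding z_def by measurable
    show "integrable lborel (\<lambda>x. C * growth q (2 * (\<bar>v x\<bar> + \<bar>w x\<bar>)))"
      using integrable_growth_sum[OF v_Hs w(1)] by simp
    show "AE x in lborel. (\<lambda>n. (F (z n x) - F (t n * v x)) / h n) \<longlonglongrightarrow> f (v x) * w x"
    proof (intro AE_I2)
      fix x
      have "\<forall>n. \<exists>\<xi>. \<bar>\<xi> - t n * v x\<bar> \<le> h n * \<bar>w x\<bar> \<and> (F (z n x) - F (t n * v x)) / h n = f \<xi> * w x"
        by (intro allI quot)
      from choice[OF this] obtain \<eta>
        where "\<forall>n. \<bar>\<eta> n - t n * v x\<bar> \<le> h n * \<bar>w x\<bar> \<and> (F (z n x) - F (t n * v x)) / h n = f (\<eta> n) * w x" ..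
      then have \<eta>: "\<bar>\<eta> n - t n * v x\<bar> \<le> h n * \<bar>w x\<bar>" "(F (z n x) - F (t n * v x)) / h n = f (\<eta> n) * w x" for n
        by auto
      have "(\<lambda>n. h n * \<bar>w x\<bar>) \<longlonglongrightarrow> 0" using tendsto_mult[OF hlim tendsto_const] by simp
      from Lim_null_comparison[OF _ this, of "\<lambda>n. \<eta> n - t n * v x"]
      have "(\<lambda>n. \<eta> n - t n * v x) \<longlonglongrightarrow> 0" using \<eta>(1) by simp
      from tendsto_add[OF this tendsto_mult[OF tlim tendsto_const[of "v x"]]]
      have "\<eta> \<longlonglongrightarrow> v x" by simp
      from continuous_tendsto_compose[OF f_cont this]
      show "(\<lambda>n. (F (z n x) - F (t n * v x)) / h n) \<longlonglongrightarrow> f (v x) * w x"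
        unfolding \<eta>(2) by (intro tendsto_mult tendsto_const)
    qed
    show "AE x in lborel. norm ((F (z n x) - F (t n * v x)) / h n) \<le> C * growth q (2 * (\<bar>v x\<bar> + \<bar>w x\<bar>))" for n
    proof (intro AE_I2)
      fix x
      obtain \<eta> where \<eta>: "\<bar>\<eta> - t n * v x\<bar> \<le> h n * \<bar>w x\<bar>" "(F (z n x) - F (t n * v x)) / h n = f \<eta> * w x"
        using quot by blast
      have "\<bar>t n * v x\<bar> \<le> 2 * \<bar>v x\<bar>" using t[of n] by (simp add: abs_mult mult_right_mono)
      moreover have "h n * \<bar>w x\<bar> \<le> 2 * \<bar>w x\<bar>" using h[of n] by (simp add: mult_right_mono)
      ultimately have "\<bar>\<eta>\<bar> \<le> 2 * (\<bar>v x\<bar> + \<bar>w x\<bar>)" using \<eta>(1) unfolding distrib_left by linarith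
      then show "norm ((F (z n x) - F (t n * v x)) / h n) \<le> C * growth q (2 * (\<bar>v x\<bar> + \<bar>w x\<bar>))"
        unfolding \<eta>(2) real_norm_def by (intro C(2)) auto
    qed
  qed
  have "0 \<le> (Mh (E (z n)) / 2 - Mh (e1 n) / 2) / h n - (\<integral>x. (F (z n x) - F (t n * v x)) / h n \<partial>lborel)" for n
  proof -
    have "(\<integral>x. (F (z n x) - F (t n * v x)) / h n \<partial>lborel)
        = ((\<integral>x. F (z n x) \<partial>lborel) - (\<integral>x. F (t n * v x) \<partial>lborel)) / h n"
      using integrable_little_growth[OF little_growth_F zH] integrable_little_growth[OF little_growth_F tvH] by simp
    then have "(Mh (E (z n)) / 2 - Mh (e1 n) / 2) / h n - (\<integral>x. (F (z n x) - F (t n * v x)) / h n \<partial>lborel)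
        = (I (z n) - I (\<lambda>x. t n * v x)) / h n"
      by (simp add: I_def e1_def[symmetric] diff_divide_distrib)
    then show ?thesis using Iz[of n] h(1)[of n] by simp
  qed
  then show ?thesis
    unfolding L_def using tendsto_diff[OF D1 D2] by (intro LIMSEQ_le_const) auto
qed

section \<open>From radial directions to all directions\<close>

lemma L_lincomb:
  assumes "u \<in> Hs s" "w \<in> Hs s"
  shows "L (\<lambda>x. a * u x + b * w x) = a * L u + b * L w"
proof -
  have "(\<integral>x. f (v x) * (a * u x + b * w x) \<partial>lborel) = (\<integral>x. a * (f (v x) * u x) + b * (f (v x) * w x) \<partial>lborel)"
    by (simp add: algebra_simps)
  moreover have "B v (\<lambda>x. a * u x + b * w x) = a * B v u + b * B v w"
    using Hs_form_lincomb[OF assms v_Hs, of V0 a b] by (simp add: Hs_form_commute)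
  ultimately show ?thesis
    using integrable_f_v_mult[OF assms(1)] integrable_f_v_mult[OF assms(2)]
    by (simp add: L_def algebra_simps)
qed

lemma L_scale: "u \<in> Hs s \<Longrightarrow> L (\<lambda>x. a * u x) = a * L u"
  using L_lincomb[of u u a 0] by simp

lemma L_radial:
  assumes w: "w \<in> Hs s" "radial w"
  shows "L w = 0"
  using L_radial_nonneg[OF w] L_radial_nonneg[OF Hs_scale[OF w(1)] radial_scale[OF w(2)], of "-1"]
    L_scale[OF w(1), of "-1"] by simp

lemma L_bounded: "\<exists>C. \<forall>u\<in>Hs s. \<bar>L u\<bar> \<le> C * sqrt (E u)"
proof -
  obtain C where C: "0 < C" "\<And>a b y. \<bar>a\<bar> \<le> y \<Longrightarrow> \<bar>b\<bar> \<le> y \<Longrightarrow> \<bar>f a * b\<bar> \<le> C * growth q y"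
    using f_mult_bound by blast
  \<comment> \<open>16 is the square of the factor 4 from \<open>growth_sum_le\<close>; the bound
    covers both 4 v and 4 u when E u \<le> 1.\<close>
  obtain S where S: "0 < S" "\<And>u. u \<in> Hs s \<Longrightarrow> E u \<le> 16 * (E v + 1) \<Longrightarrow> (\<integral>x. growth q (u x) \<partial>lborel) \<le> S"
    using growth_bounded by metis
  define D where "D = M (E v) * (E v + 1) + C * (S + S)"
  have 1: "\<bar>L u\<bar> \<le> D" if u: "u \<in> Hs s" and Eu: "E u \<le> 1" for u
  proof -
    have Eu16: "16 * E u \<le> 16 * (E v + 1)" using Eu E_nonneg[of v] unfolding distrib_left by linarith
    have "\<bar>2 * B v u\<bar> \<le> E v + E u"
      using E_nonneg[of "\<lambda>x. v x - u x"] E_nonneg[of "\<lambda>x. 1 * v x + 1 * u x"]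
      unfolding Hs_energy_diff[OF v_Hs u] Hs_energy_lincomb[OF v_Hs u] by simp
    then have "\<bar>B v u\<bar> \<le> E v + 1" using Eu E_nonneg[of v] by linarith
    then have b: "\<bar>M (E v) * B v u\<bar> \<le> M (E v) * (E v + 1)"
      using M_pos[of "E v"] by (simp add: abs_mult)
    have "\<bar>\<integral>x. f (v x) * u x \<partial>lborel\<bar> \<le> (\<integral>x. \<bar>f (v x) * u x\<bar> \<partial>lborel)" by (rule integral_abs_bound)
    also have "\<dots> \<le> (\<integral>x. C * (growth q (4 * v x) + growth q (4 * u x)) \<partial>lborel)"
    proof (rule integral_mono)
      show "integrable lborel (\<lambda>x. \<bar>f (v x) * u x\<bar>)" using integrable_f_v_mult[OF u] by simp
      show "integrable lborel (\<lambda>x. C * (growth q (4 * v x) + growth q (4 * u x)))"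
        using integrable_growth[OF Hs_scale[OF v_Hs]] integrable_growth[OF Hs_scale[OF u]] by simp
      fix x
      have "\<bar>f (v x) * u x\<bar> \<le> C * growth q (2 * (\<bar>v x\<bar> + \<bar>u x\<bar>))" by (intro C(2)) auto
      also have "\<dots> \<le> C * (growth q (4 * v x) + growth q (4 * u x))"
        using C(1) q_gt by (intro mult_left_mono growth_sum_le) auto
      finally show "\<bar>f (v x) * u x\<bar> \<le> C * (growth q (4 * v x) + growth q (4 * u x))" .
    qed
    also have "\<dots> = C * ((\<integral>x. growth q (4 * v x) \<partial>lborel) + (\<integral>x. growth q (4 * u x) \<partial>lborel))"
      using integrable_growth[OF Hs_scale[OF v_Hs]] integrable_growth[OF Hs_scale[OF u]] by simp
    also have "\<dots> \<le> C * (S + S)"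
      using C(1) Eu16
      by (intro mult_left_mono add_mono S(2) Hs_scale v_Hs u) (auto simp: Hs_energy_scale v_Hs u)
    finally show ?thesis using b unfolding L_def D_def by linarith
  qed
  have "0 \<le> D" using M_pos[of "E v"] C S E_nonneg[of v] by (simp add: D_def)
  have "\<bar>L u\<bar> \<le> (D + \<bar>D\<bar>) * sqrt (E u)" if u: "u \<in> Hs s" for u
  proof (cases "E u = 0")
    case True
    \<comment> \<open>All multiples of \<open>u\<close> have energy 0, so the unit bound applies to
      each of them and forces \<open>L u = 0\<close>.\<close>
    have "\<bar>L u\<bar> * k \<le> D" if "0 < k" for k
      using 1[OF Hs_scale[OF u, of k]] that True by (simp add: Hs_energy_scale[OF u] L_scale[OF u] abs_mult mult.commute)
    from this[of "(D + 1) / \<bar>L u\<bar>"] have "L u = 0" using \<open>0 \<le> D\<close> by (cases "L u = 0") auto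
    then show ?thesis using True by simp
  next
    case False
    then have e: "0 < E u" using E_nonneg[of u] by linarith
    have "\<bar>L (\<lambda>x. (1 / sqrt (E u)) * u x)\<bar> \<le> D"
    proof (rule 1[OF Hs_scale[OF u]])
      show "E (\<lambda>x. (1 / sqrt (E u)) * u x) \<le> 1"
        unfolding Hs_energy_scale[OF u] using e by (simp add: power_divide)
    qed
    then have "\<bar>L u\<bar> \<le> D * sqrt (E u)"
      unfolding L_scale[OF u] using e by (simp add: abs_mult field_simps)
    also have "\<dots> \<le> (D + \<bar>D\<bar>) * sqrt (E u)" by (intro mult_right_mono) auto
    finally show ?thesis .
  qed
  then show ?thesis by blast
qed

lemma L_orthogonal:
  assumes w: "w \<in> Hs s" and r: "orthogonal_transformation r"
  shows "L (\<lambda>x. w (r x)) = L w"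
proof -
  note [measurable] = Hs_borel[OF v_Hs] Hs_borel[OF w] continuous_borel_compose[OF f_cont]
    orthogonal_measurable[OF r]
  have vr: "AE x in lborel. v (r x) = v x" by (rule radialD[OF v_radial r])
  have "B v (\<lambda>x. w (r x)) = B (\<lambda>x. v (r x)) (\<lambda>x. w (r x))"
    using vr by (intro Hs_form_cong_AE) auto
  also have "\<dots> = B v w" by (rule Hs_form_orthogonal[OF r v_Hs w])
  finally have 1: "B v (\<lambda>x. w (r x)) = B v w" .
  have "(\<integral>x. f (v x) * w (r x) \<partial>lborel) = (\<integral>x. f (v (r x)) * w (r x) \<partial>lborel)"
    using vr by (intro integral_cong_AE) (auto elim!: eventually_mono)
  also have "\<dots> = (\<integral>x. f (v x) * w x \<partial>lborel)"
    by (rule integral_orthogonal[OF r, of "\<lambda>x. f (v x) * w x"]) measurable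
  finally show ?thesis using 1 by (simp add: L_def)
qed

text \<open>Symmetric criticality without averaging over the group: if \<open>L\<close> did not vanish, the unique
  element of least energy in \<open>{L = 1}\<close> would be invariant under rotations, but \<open>L\<close> vanishes on radial functions.\<close>
lemma L_eq_0:
  assumes \<phi>: "\<phi> \<in> Hs s"
  shows "L \<phi> = 0"
proof (rule ccontr)
  assume nz: "L \<phi> \<noteq> 0"
  define T where "T = {w \<in> Hs s. L w = 1}"
  have "(\<lambda>x. (1 / L \<phi>) * \<phi> x) \<in> T" using Hs_scale[OF \<phi>, of "1 / L \<phi>"] L_scale[OF \<phi>, of "1 / L \<phi>"] nz by (simp add: T_def)
  then have ne: "E ` T \<noteq> {}" by auto
  have bdd: "bdd_below (E ` T)" by (intro bdd_belowI[of _ 0]) auto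
  define c where "c = Inf (E ` T)"
  have c_le: "c \<le> E w" if "w \<in> T" for w unfolding c_def using that bdd by (intro cInf_lower) auto
  \<comment> \<open>The midpoint stays in the affine set \<open>T\<close>, so its energy is at least
    \<open>c\<close>.\<close>
  have mid: "E (\<lambda>x. u x - w x) \<le> 2 * E u + 2 * E w - 4 * c" if "u \<in> T" "w \<in> T" for u w
  proof -
    have uw: "u \<in> Hs s" "w \<in> Hs s" "L u = 1" "L w = 1" using that by (auto simp: T_def)
    have "(\<lambda>x. 1/2 * u x + 1/2 * w x) \<in> T"
      using Hs_lincomb[OF uw(1,2), of "1/2" "1/2"] L_lincomb[OF uw(1,2), of "1/2" "1/2"] uw(3,4) by (simp add: T_def)
    from c_le[OF this] show ?thesis unfolding Hs_energy_parallelogram[OF uw(1,2)] by simp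
  qed
  have "\<forall>n. \<exists>w. w \<in> T \<and> E w < c + 1 / real (Suc n)"
  proof
    fix n
    have "Inf (E ` T) < c + 1 / real (Suc n)" by (simp add: c_def)
    then show "\<exists>w. w \<in> T \<and> E w < c + 1 / real (Suc n)" using cInf_less_iff[OF ne bdd] by auto
  qed
  from choice[OF this] obtain u where u: "\<And>n. u n \<in> T" "\<And>n. E (u n) < c + 1 / real (Suc n)" by blast
  have uH: "u n \<in> Hs s" and uL: "L (u n) = 1" for n using u(1)[of n] by (auto simp: T_def)
  have "E (u n) \<le> c + 1" for n
  proof -
    have "1 / real (Suc n) \<le> 1" by simp
    then show ?thesis using u(2)[of n] by linarith
  qed
  then obtain r w where r: "strict_mono (r :: nat \<Rightarrow> nat)" and w: "w \<in> Hs s"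
    and lim: "AE x in lborel. (\<lambda>n. u (r n) x) \<longlonglongrightarrow> w x"
    using rellich[where u = u, OF uH] by blast
  have rn: "E (u (r n)) \<le> c + 1 / real (Suc n)" for n
  proof -
    have "n \<le> r n" using strict_mono_imp_increasing[OF r] by simp
    then have "1 / real (Suc (r n)) \<le> 1 / real (Suc n)" by (intro divide_left_mono) auto
    then show ?thesis using u(2)[of "r n"] by linarith
  qed
  have inv0: "(\<lambda>n. 1 / real (Suc n)) \<longlonglongrightarrow> 0" by (rule LIMSEQ_Suc[OF lim_1_over_n])
  have Elim: "(\<lambda>n. E (u (r n))) \<longlonglongrightarrow> c"
  proof (rule tendsto_sandwich[where f = "\<lambda>_. c" and h = "\<lambda>n. c + 1 / real (Suc n)"])
    show "(\<lambda>n. c + 1 / real (Suc n)) \<longlonglongrightarrow> c" using tendsto_add[OF tendsto_const inv0, of c] by simp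
  qed (use rn c_le u in auto)
  have Ew: "E w \<le> c" using E_fatou[OF uH Hs_borel[OF w] lim Elim] by simp
  \<comment> \<open>Convergence almost everywhere alone does not give \<open>L w = 1\<close>. Fatou
    in the second index of the Cauchy estimate \<open>mid\<close> upgrades it to convergence in
    energy, for which \<open>L_bounded\<close> suffices.\<close>
  have diff: "E (\<lambda>x. u (r n) x - w x) \<le> 4 * (1 / real (Suc n))" for n
  proof -
    have "(\<lambda>x. u (r n) x - w x) \<in> Hs s \<and> E (\<lambda>x. u (r n) x - w x) \<le> 4 * (1 / real (Suc n))"
    proof (rule E_fatou_bound[where u = "\<lambda>m x. u (r n) x - u (r (m + n)) x"])
      show "(\<lambda>x. u (r n) x - u (r (m + n)) x) \<in> Hs s" for m by (rule Hs_diff[OF uH uH])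
      show "(\<lambda>x. u (r n) x - w x) \<in> borel_measurable borel" by (rule Hs_borel[OF Hs_diff[OF uH w]])
      show "AE x in lborel. (\<lambda>m. u (r n) x - u (r (m + n)) x) \<longlonglongrightarrow> u (r n) x - w x"
        using lim
      proof eventually_elim
        case (elim x)
        show ?case by (intro tendsto_diff tendsto_const LIMSEQ_ignore_initial_segment[OF elim])
      qed
      show "E (\<lambda>x. u (r n) x - u (r (m + n)) x) \<le> 4 * (1 / real (Suc n))" for m
      proof -
        have "1 / real (Suc (m + n)) \<le> 1 / real (Suc n)" by (intro divide_left_mono) auto
        then show ?thesis using mid[OF u(1)[of "r n"] u(1)[of "r (m + n)"]] rn[of n] rn[of "m + n"] by linarith
      qed
    qed
    then show ?thesis by simp
  qed
  obtain C where C: "\<And>u. u \<in> Hs s \<Longrightarrow> \<bar>L u\<bar> \<le> C * sqrt (E u)" using L_bounded by blast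
  have "(\<lambda>n. 1 - L w) \<longlonglongrightarrow> 0"
  proof (rule Lim_null_comparison[where g = "\<lambda>n. \<bar>C\<bar> * sqrt (4 * (1 / real (Suc n)))"])
    have "\<bar>1 - L w\<bar> \<le> \<bar>C\<bar> * sqrt (4 * (1 / real (Suc n)))" for n
    proof -
      have "L (\<lambda>x. u (r n) x - w x) = 1 - L w" using L_lincomb[OF uH[of "r n"] w, of 1 "-1"] uL by simp
      then have "\<bar>1 - L w\<bar> \<le> C * sqrt (E (\<lambda>x. u (r n) x - w x))" using C[OF Hs_diff[OF uH w], of "r n"] by simp
      also have "\<dots> \<le> \<bar>C\<bar> * sqrt (4 * (1 / real (Suc n)))"
        using diff[of n] by (intro mult_mono) (auto intro: real_sqrt_le_mono)
      finally show ?thesis .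
    qed
    then show "eventually (\<lambda>n. norm (1 - L w) \<le> \<bar>C\<bar> * sqrt (4 * (1 / real (Suc n)))) sequentially" by simp
    have "(\<lambda>n. \<bar>C\<bar> * sqrt (4 * (1 / real (Suc n)))) \<longlonglongrightarrow> \<bar>C\<bar> * sqrt (4 * 0)"
      by (intro tendsto_mult tendsto_const tendsto_real_sqrt inv0)
    then show "(\<lambda>n. \<bar>C\<bar> * sqrt (4 * (1 / real (Suc n)))) \<longlonglongrightarrow> 0" by simp
  qed
  then have Lw: "L w = 1" by (simp add: LIMSEQ_const_iff)
  then have wT: "w \<in> T" using w by (simp add: T_def)
  have "radial w"
    unfolding radial_def
  proof (intro allI impI)
    fix g :: "point \<Rightarrow> point" assume g: "orthogonal_transformation g"
    have wg: "(\<lambda>x. w (g x)) \<in> Hs s" by (rule Hs_orthogonal[OF g w])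
    then have "(\<lambda>x. w (g x)) \<in> T" using L_orthogonal[OF w g] Lw by (simp add: T_def)
    moreover have "E (\<lambda>x. w (g x)) = E w"
      unfolding Hs_energy_eq_form by (rule Hs_form_orthogonal[OF g w w])
    ultimately have "E (\<lambda>x. w (g x) - w x) \<le> 0" using mid[OF _ wT] Ew by fastforce
    then have "E (\<lambda>x. w (g x) - w x) = 0" using E_nonneg[of "\<lambda>x. w (g x) - w x"] by linarith
    then show "AE x in lborel. w (g x) = w x" using E_eq_0_iff[OF Hs_diff[OF wg w]] by simp
  qed
  then show False using L_radial[OF w] Lw by simp
qed

lemma weak_solution_v: "weak_solution s V0 M f v"
  unfolding weak_solution_def
proof (intro conjI ballI v_Hs)
  fix \<phi> assume \<phi>: "\<phi> \<in> Hs s"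
  show "integrable lborel2 (gagliardo_kernel s v \<phi>)" by (rule Hs_integrable_kernel[OF v_Hs \<phi>])
  show "integrable lborel (\<lambda>x. v x * \<phi> x)" by (rule Hs_integrable_mult[OF v_Hs \<phi>])
  show "integrable lborel (\<lambda>x. f (v x) * \<phi> x)" by (rule integrable_f_v_mult[OF \<phi>])
  show "M (E v) * ((\<integral>z. gagliardo_kernel s v \<phi> z \<partial>lborel2) + (\<integral>x. V0 * v x * \<phi> x \<partial>lborel)) = (\<integral>x. f (v x) * \<phi> x \<partial>lborel)"
    using L_eq_0[OF \<phi>] by (simp add: L_def Hs_form_def mult.assoc)
qed

end

section \<open>Positivity\<close>

lemma Hs_max_zero:
  assumes u: "u \<in> Hs s"
  shows "(\<lambda>x. max 0 (u x)) \<in> Hs s"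
proof -
  note [measurable] = Hs_borel[OF u]
  have "integrable lborel (\<lambda>x. (max 0 (u x))\<^sup>2)"
    by (rule Bochner_Integration.integrable_bound[OF Hs_square[OF u]]) (auto simp: max_def)
  moreover have "integrable lborel2 (gagliardo_kernel s (\<lambda>x. max 0 (u x)) (\<lambda>x. max 0 (u x)))"
  proof (rule Bochner_Integration.integrable_bound[OF Hs_gagliardo[OF u]])
    have "gagliardo_kernel s (\<lambda>x. max 0 (u x)) (\<lambda>x. max 0 (u x)) z \<le> gagliardo_kernel s u u z" for z
    proof -
      have "\<bar>max 0 (u (fst z)) - max 0 (u (snd z))\<bar> \<le> \<bar>u (fst z) - u (snd z)\<bar>" by auto
      then have "(max 0 (u (fst z)) - max 0 (u (snd z)))\<^sup>2 \<le> (u (fst z) - u (snd z))\<^sup>2"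
        by (simp only: abs_le_square_iff)
      then show ?thesis
        unfolding gagliardo_kernel_weight power2_eq_square[symmetric] by (intro mult_right_mono) auto
    qed
    then show "AE z in lborel2. norm (gagliardo_kernel s (\<lambda>x. max 0 (u x)) (\<lambda>x. max 0 (u x)) z)
        \<le> norm (gagliardo_kernel s u u z)" by simp
  qed measurable
  ultimately show ?thesis by (simp add: Hs_def)
qed

text \<open>Exhaustion by balls. Having all large radii available lets two different sets be cut by
  the same ball.\<close>

lemma emeasure_inter_cball_pos:
  fixes A :: "nat \<Rightarrow> point set"
  assumes [measurable]: "\<And>n. A n \<in> sets (lborel :: point measure)"
    and "\<not> (AE x in lborel. \<forall>n. x \<notin> A n)"
  shows "\<exists>n N. \<forall>m\<ge>N. 0 < emeasure lborel (A n \<inter> cball 0 (real m))"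
proof (rule ccontr)
  assume neg: "\<not> ?thesis"
  have [measurable]: "cball (0 :: point) r \<in> sets borel" for r by simp
  have *: "AE x in lborel. x \<notin> A n \<inter> cball 0 (real m)" for n m
  proof -
    obtain m' where m': "m \<le> m'" "emeasure lborel (A n \<inter> cball 0 (real m')) = 0"
      using neg by (auto simp: not_less)
    have "A n \<inter> cball 0 (real m) \<subseteq> A n \<inter> cball 0 (real m')" using m'(1) by auto
    moreover have "A n \<inter> cball 0 (real m') \<in> null_sets lborel" using m'(2) by (auto simp: null_sets_def)
    ultimately show ?thesis by (intro AE_I') auto
  qed
  have "AE x in lborel. \<forall>n m. x \<notin> A n \<inter> cball 0 (real m)"
    by (intro AE_all_countable[THEN iffD2] allI *)
  then have "AE x in lborel. \<forall>n. x \<notin> A n"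
  proof eventually_elim
    case (elim x)
    obtain m :: nat where "norm x \<le> real m" using real_arch_simple by blast
    then show ?case using elim by auto
  qed
  then show False using assms(2) by contradiction
qed

text \<open>The positive part is nondecreasing and 1-Lipschitz, so D^2 \<le> ((p - a) - (r - b)) D.
  Hence the left side is at most (p - r) D - D^2, and completing the square removes D. It is used
  with a, b values of u/e and p, r values of the cut-off.\<close>

lemma truncated_product_le:
  fixes a b p r :: real
  shows "(a - b) * (max 0 (p - a) - max 0 (r - b)) \<le> (p - r)\<^sup>2 / 4"
proof -
  define D where "D = max 0 (p - a) - max 0 (r - b)"
  have "D * D \<le> ((p - a) - (r - b)) * D"
  proof (cases "0 \<le> D")
    case True
    show ?thesis
    proof (cases "D = 0")
      case False
      then have "D \<le> (p - a) - (r - b)" using True unfolding D_def by (auto simp: max_def split: if_splits)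
      then show ?thesis using True by (rule mult_right_mono)
    qed simp
  next
    case False
    then have "(p - a) - (r - b) \<le> D" unfolding D_def by (auto simp: max_def split: if_splits)
    then show ?thesis using False by (intro mult_right_mono_neg) auto
  qed
  moreover have "0 \<le> ((p - r) / 2 - D)\<^sup>2" by simp
  moreover have "((p - r) / 2 - D)\<^sup>2 = (p - r)\<^sup>2 / 4 - (p - r) * D + D * D"
    by (simp add: power2_diff[of "(p - r) / 2"] power_divide power2_eq_square[of D])
  moreover have "(a - b) * D = (p - r) * D - ((p - a) - (r - b)) * D" by (simp add: algebra_simps)
  ultimately have "(a - b) * D \<le> (p - r)\<^sup>2 / 4" by linarith
  then show ?thesis by (simp add: D_def)
qed

context sobolev
begin

text \<open>Testing with \<open>max 0 (\<psi> - u / e)\<close>: the local terms are of order \<open>e\<close>, but the interaction of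
  the zero set of \<open>u\<close> with \<open>{u \<ge> \<delta>}\<close> contributes a fixed negative amount.\<close>
lemma strong_maximum_principle:
  assumes u: "u \<in> Hs s" and u0: "\<And>x. 0 \<le> u x" and Eu: "E u \<noteq> 0"
    and super: "\<And>\<phi>. \<phi> \<in> Hs s \<Longrightarrow> (\<And>x. 0 \<le> \<phi> x) \<Longrightarrow> 0 \<le> B u \<phi>"
  shows "AE x in lborel. 0 < u x"
proof (rule ccontr)
  assume "\<not> (AE x in lborel. 0 < u x)"
  note [measurable] = Hs_borel[OF u]
  have [measurable]: "cball (0 :: point) r \<in> sets borel" for r by simp
  define Z where "Z = {x. u x = 0}"
  have Z_meas [measurable]: "Z \<in> sets lborel" unfolding Z_def by measurable
  have "\<not> (AE x in lborel. \<forall>n::nat. x \<notin> Z)"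
    using \<open>\<not> (AE x in lborel. 0 < u x)\<close> u0 by (simp add: Z_def less_le)
  then obtain N1 where N1: "\<And>m. N1 \<le> m \<Longrightarrow> 0 < emeasure lborel (Z \<inter> cball 0 (real m))"
    using emeasure_inter_cball_pos[of "\<lambda>n::nat. Z"] Z_meas by auto
  define Y where "Y n = {x. 1 / real (Suc n) \<le> u x}" for n
  have Y_meas [measurable]: "Y n \<in> sets lborel" for n unfolding Y_def by measurable
  have "\<not> (AE x in lborel. \<forall>n. x \<notin> Y n)"
  proof
    assume "AE x in lborel. \<forall>n. x \<notin> Y n"
    then have "AE x in lborel. u x = 0"
    proof eventually_elim
      case (elim x)
      show ?case
      proof (rule ccontr)
        assume "u x \<noteq> 0"
        then have "0 < u x" using u0[of x] by simp
        then obtain n where "1 / real (Suc n) < u x" using nat_approx_posE by blast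
        then show False using elim by (auto simp: Y_def dest: spec[of _ n])
      qed
    qed
    then show False using E_eq_0_iff[OF u] Eu by simp
  qed
  then obtain j N2 where N2: "\<And>m. N2 \<le> m \<Longrightarrow> 0 < emeasure lborel (Y j \<inter> cball 0 (real m))"
    using emeasure_inter_cball_pos[of Y] Y_meas by blast
  define N where "N = max N1 N2"
  define Z' Y' where "Z' = Z \<inter> cball 0 (real N)" and "Y' = Y j \<inter> cball 0 (real N)"
  have [measurable]: "Z' \<in> sets lborel" "Y' \<in> sets lborel" unfolding Z'_def Y'_def by measurable
  have fin: "emeasure lborel (A \<inter> cball (0 :: point) (real N)) < \<infinity>" if "A \<in> sets lborel" for A
  proof -
    have "emeasure lborel (A \<inter> cball (0 :: point) (real N)) \<le> emeasure lborel (cball (0 :: point) (real N))"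
      by (intro emeasure_mono) auto
    also have "\<dots> < \<infinity>" using emeasure_bounded_finite[of "cball (0 :: point) (real N)"] by simp
    finally show ?thesis .
  qed
  define \<delta> where "\<delta> = 1 / real (Suc j)"
  have \<delta>: "0 < \<delta>" by (simp add: \<delta>_def)
  have ZY: "emeasure lborel2 (Z' \<times> Y') = emeasure lborel Z' * emeasure lborel Y'"
    by (rule lborel.emeasure_pair_measure_Times) measurable
  have pos: "0 < emeasure lborel Z'" "0 < emeasure lborel Y'"
    using N1[of N] N2[of N] by (auto simp: N_def Z'_def Y'_def)
  have fin': "emeasure lborel Z' < \<infinity>" "emeasure lborel Y' < \<infinity>" unfolding Z'_def Y'_def by (rule fin, rule Z_meas, rule fin, rule Y_meas)
  have ZYfin: "emeasure lborel2 (Z' \<times> Y') < \<infinity>" unfolding ZY using fin' by (simp add: ennreal_mult_less_top)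
  have ZYpos: "0 < measure lborel2 (Z' \<times> Y')"
    unfolding measure_def ZY enn2real_positive_iff using pos fin' by (simp add: ennreal_zero_less_mult_iff ennreal_mult_less_top)
  have ZYint: "integrable lborel2 (indicator (Z' \<times> Y') :: _ \<Rightarrow> real)"
    by (rule integrable_real_indicator[OF pair_measureI ZYfin]) measurable
  define p where "p = 3 + 2 * s"
  \<comment> \<open>Two points of the ball have distance at most 2N, so this is below
    \<open>u y\<close> times the kernel weight on Z' x Y'; the + 1 keeps the base positive.\<close>
  define \<kappa> where "\<kappa> = \<delta> * (2 * real N + 1) powr (- p)"
  have \<kappa>: "0 < \<kappa>" using \<delta> by (simp add: \<kappa>_def)
  \<comment> \<open>The radius N + 1 makes the tent equal to 1 on the ball of radius N, so the test
    function is 1 on \<open>Z'\<close>; for e \<le> \<delta> it is 0 on \<open>Y'\<close>.\<close>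
  define \<psi> where "\<psi> = tent (real N + 1)"
  have \<psi>: "\<psi> \<in> Hs s" unfolding \<psi>_def by (rule tent_Hs[OF s_pos s_less])
  have \<psi>b: "0 \<le> \<psi> x" "\<psi> x \<le> 1" for x using tent_bounds by (auto simp: \<psi>_def)
  have main: "\<kappa> * measure lborel2 (Z' \<times> Y') \<le> e * E \<psi>" if e: "0 < e" "e \<le> \<delta>" for e
  proof -
    define \<phi> where "\<phi> x = max 0 (\<psi> x - u x / e)" for x
    have \<phi>: "\<phi> \<in> Hs s"
      using Hs_max_zero[OF Hs_lincomb[OF \<psi> u, of 1 "- 1 / e"]] by (simp add: \<phi>_def[abs_def])
    have \<phi>0: "0 \<le> \<phi> x" "\<phi> x \<le> \<psi> x" for x
      using u0[of x] e \<psi>b[of x] by (auto simp: \<phi>_def)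
    have ker: "gagliardo_kernel s u \<phi> z \<le> e * gagliardo_kernel s \<psi> \<psi> z - \<kappa> * indicator (Z' \<times> Y') z" for z
    proof (cases "z \<in> Z' \<times> Y'")
      case True
      then obtain x y where z: "z = (x, y)" and xy: "u x = 0" "norm x \<le> real N" "\<delta> \<le> u y" "norm y \<le> real N"
        by (auto simp: Z'_def Y'_def Z_def Y_def \<delta>_def)
      have "\<psi> x = 1" using xy(2) by (simp add: \<psi>_def tent_def)
      then have \<phi>x: "\<phi> x = 1" using xy(1) by (simp add: \<phi>_def)
      have "1 \<le> u y / e" using xy(3) e by simp
      then have \<phi>y: "\<phi> y = 0" using \<psi>b(2)[of y] by (simp add: \<phi>_def)
      have "x \<noteq> y" using xy \<delta> by auto
      then have n: "0 < norm (x - y)" by simp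
      have "norm (x - y) \<le> 2 * real N + 1" using norm_triangle_ineq4[of x y] xy by linarith
      then have "(2 * real N + 1) powr (- p) \<le> norm (x - y) powr (- p)"
        using n s_pos by (intro powr_mono2') (auto simp: p_def)
      then have "\<kappa> \<le> u y * norm (x - y) powr (- p)"
        unfolding \<kappa>_def using xy(3) \<delta> by (intro mult_mono) auto
      moreover have "gagliardo_kernel s u \<phi> z = - (u y * norm (x - y) powr (- p))"
        unfolding powr_minus by (simp add: z gagliardo_kernel_def xy(1) \<phi>x \<phi>y p_def divide_inverse)
      ultimately have "gagliardo_kernel s u \<phi> z \<le> - \<kappa>" by simp
      moreover have "0 \<le> e * gagliardo_kernel s \<psi> \<psi> z" using e by simp
      ultimately show ?thesis using True by simp
    next
      case False
      obtain x y where z: "z = (x, y)" by (metis surj_pair)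
      have "e * ((u x / e - u y / e) * (\<phi> x - \<phi> y)) \<le> e * ((\<psi> x - \<psi> y)\<^sup>2 / 4)"
        unfolding \<phi>_def using e by (intro mult_left_mono truncated_product_le) auto
      also have "\<dots> \<le> e * (\<psi> x - \<psi> y)\<^sup>2" using e by simp
      also have "e * ((u x / e - u y / e) * (\<phi> x - \<phi> y)) = (u x - u y) * (\<phi> x - \<phi> y)"
        using e by (simp add: diff_divide_distrib[symmetric])
      finally have "(u x - u y) * (\<phi> x - \<phi> y) * weight s z \<le> e * (\<psi> x - \<psi> y)\<^sup>2 * weight s z"
        by (intro mult_right_mono) auto
      then show ?thesis using False by (simp add: z gagliardo_kernel_weight power2_eq_square mult_ac)
    qed
    have "(\<integral>z. gagliardo_kernel s u \<phi> z \<partial>lborel2) \<le> (\<integral>z. e * gagliardo_kernel s \<psi> \<psi> z - \<kappa> * indicator (Z' \<times> Y') z \<partial>lborel2)"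
      using Hs_integrable_kernel[OF u \<phi>] Hs_gagliardo[OF \<psi>] ZYint by (intro integral_mono ker) auto
    also have "\<dots> = e * (\<integral>z. gagliardo_kernel s \<psi> \<psi> z \<partial>lborel2) - \<kappa> * measure lborel2 (Z' \<times> Y')"
      using Hs_gagliardo[OF \<psi>] ZYint by (simp add: space_pair_measure)
    finally have 1: "(\<integral>z. gagliardo_kernel s u \<phi> z \<partial>lborel2) \<le> e * (\<integral>z. gagliardo_kernel s \<psi> \<psi> z \<partial>lborel2) - \<kappa> * measure lborel2 (Z' \<times> Y')" .
    have "(\<integral>x. u x * \<phi> x \<partial>lborel) \<le> (\<integral>x. e * (\<psi> x)\<^sup>2 \<partial>lborel)"
    proof (rule integral_mono)
      show "integrable lborel (\<lambda>x. u x * \<phi> x)" by (rule Hs_integrable_mult[OF u \<phi>])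
      show "integrable lborel (\<lambda>x. e * (\<psi> x)\<^sup>2)" using Hs_square[OF \<psi>] by simp
      fix x
      show "u x * \<phi> x \<le> e * (\<psi> x)\<^sup>2"
      proof (cases "u x \<le> e * \<psi> x")
        case True
        then have "u x * \<phi> x \<le> (e * \<psi> x) * \<psi> x" using u0[of x] \<phi>0[of x] e \<psi>b[of x] by (intro mult_mono) auto
        then show ?thesis by (simp add: power2_eq_square mult.assoc)
      next
        case False
        then have "\<psi> x \<le> u x / e" using e by (simp add: pos_le_divide_eq mult.commute)
        then have "\<phi> x = 0" by (simp add: \<phi>_def)
        then show ?thesis using e by simp
      qed
    qed
    then have "V0 * (\<integral>x. u x * \<phi> x \<partial>lborel) \<le> V0 * (e * (\<integral>x. (\<psi> x)\<^sup>2 \<partial>lborel))"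
      using V0_pos by simp
    moreover have "0 \<le> B u \<phi>" by (rule super[OF \<phi> \<phi>0(1)])
    ultimately have "0 \<le> e * (\<integral>z. gagliardo_kernel s \<psi> \<psi> z \<partial>lborel2) - \<kappa> * measure lborel2 (Z' \<times> Y') + V0 * (e * (\<integral>x. (\<psi> x)\<^sup>2 \<partial>lborel))"
      using 1 unfolding Hs_form_def by linarith
    then show ?thesis by (simp add: E_alt algebra_simps)
  qed
  define c where "c = \<kappa> * measure lborel2 (Z' \<times> Y')"
  have c: "0 < c" using \<kappa> ZYpos by (simp add: c_def)
  \<comment> \<open>The + 1 allows division by \<open>k\<close>; with e \<le> c / (2 k) the
    inequality \<open>main\<close> would give c \<le> c / 2.\<close>
  define k where "k = E \<psi> + 1"
  define e where "e = min \<delta> (c / (2 * k))"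
  have E1: "0 < k" "E \<psi> \<le> k" using E_nonneg[of \<psi>] unfolding k_def by linarith+
  have e: "0 < e" "e \<le> \<delta>" using c \<delta> E1 by (auto simp: e_def)
  have "c \<le> e * E \<psi>" using main[OF e] by (simp add: c_def)
  also have "\<dots> \<le> e * k" using e E1 by simp
  also have "\<dots> \<le> c / (2 * k) * k" using E1 by (intro mult_right_mono) (auto simp: e_def)
  also have "\<dots> = c / 2" using E1 by simp
  finally show False using c by simp
qed

end

context kirchhoff_minimizer
begin

text \<open>\<open>f (v x)\<close> vanishes wherever the negative part does not, so the nonlinear
  term drops out of the equation, while the form of \<open>v\<close> with its negative part is at
  most minus the energy of that part.\<close>

lemma v_nonneg: "AE x in lborel. 0 \<le> v x"
proof -
  define \<phi> where "\<phi> x = max 0 (- v x)" for x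
  have \<phi>: "\<phi> \<in> Hs s" using Hs_max_zero[OF Hs_scale[OF v_Hs, of "-1"]] by (simp add: \<phi>_def[abs_def])
  have z: "f (v x) * \<phi> x = 0" for x using f_nonpos[of "v x"] by (cases "v x \<le> 0") (auto simp: \<phi>_def)
  have "(\<integral>x. f (v x) * \<phi> x \<partial>lborel) = 0"
    by (rule integral_eq_zero_AE, rule AE_I2, rule z)
  then have "M (E v) * B v \<phi> = 0" using L_eq_0[OF \<phi>] by (simp add: L_def)
  then have B0: "B v \<phi> = 0" using M_pos[of "E v"] by simp
  have "gagliardo_kernel s v \<phi> z \<le> - gagliardo_kernel s \<phi> \<phi> z" for z
  proof -
    have *: "(a - b) * (max 0 (- a) - max 0 (- b)) \<le> - (max 0 (- a) - max 0 (- b)) * (max 0 (- a) - max 0 (- b))" for a b :: real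
      by (auto simp: max_def algebra_simps mult_nonneg_nonpos mult_nonneg_nonpos2)
    show ?thesis
      unfolding gagliardo_kernel_weight \<phi>_def minus_mult_left by (rule mult_right_mono[OF * weight_nonneg])
  qed
  then have "(\<integral>z. gagliardo_kernel s v \<phi> z \<partial>lborel2) \<le> (\<integral>z. - gagliardo_kernel s \<phi> \<phi> z \<partial>lborel2)"
    using Hs_integrable_kernel[OF v_Hs \<phi>] Hs_gagliardo[OF \<phi>] by (intro integral_mono) auto
  moreover have "(\<integral>x. v x * \<phi> x \<partial>lborel) = (\<integral>x. - ((\<phi> x)\<^sup>2) \<partial>lborel)"
    by (rule Bochner_Integration.integral_cong) (auto simp: \<phi>_def max_def power2_eq_square)
  ultimately have "E \<phi> \<le> 0" using B0 by (simp add: Hs_form_def E_alt)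
  then have "E \<phi> = 0" using E_nonneg[of \<phi>] by linarith
  then have "AE x in lborel. \<phi> x = 0" using E_eq_0_iff[OF \<phi>] by simp
  then show ?thesis by eventually_elim (auto simp: \<phi>_def max_def split: if_splits)
qed

lemma v_pos: "AE x in lborel. 0 < v x"
proof -
  \<comment> \<open>The maximum principle asks for nonnegativity at every point, so \<open>v\<close>
    is first changed on a null set.\<close>
  define u where "u x = max 0 (v x)" for x
  have u: "u \<in> Hs s" using Hs_max_zero[OF v_Hs] by (simp add: u_def[abs_def])
  note [measurable] = Hs_borel[OF v_Hs] Hs_borel[OF u]
  have uv: "AE x in lborel. v x = u x" using v_nonneg by eventually_elim (simp add: u_def)
  have "AE x in lborel. 0 < u x"
  proof (rule strong_maximum_principle[OF u])
    show "0 \<le> u x" for x by (simp add: u_def)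
    have "E u = E v" unfolding Hs_energy_eq_form using uv by (intro Hs_form_cong_AE) auto
    then show "E u \<noteq> 0" using E_v by simp
    fix \<phi> assume \<phi>: "\<phi> \<in> Hs s" "\<And>x. 0 \<le> \<phi> x"
    note [measurable] = Hs_borel[OF \<phi>(1)]
    have "0 \<le> (\<integral>x. f (v x) * \<phi> x \<partial>lborel)" using \<phi>(2) f_nonneg by simp
    then have "0 \<le> M (E v) * B v \<phi>" using L_eq_0[OF \<phi>(1)] by (simp add: L_def)
    then have "0 \<le> B v \<phi>" using M_pos[of "E v"] by (simp add: zero_le_mult_iff)
    moreover have "B v \<phi> = B u \<phi>" using uv by (intro Hs_form_cong_AE) auto
    ultimately show "0 \<le> B u \<phi>" by simp
  qed
  then show ?thesis using uv by eventually_elim simp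
qed

end

theorem theorem4p6:
  fixes s V0 m0 :: real and M f :: "real \<Rightarrow> real"
  assumes s: "3/4 < s" "s < 1"
    and V0: "V0 > 0"
    and M_cont: "continuous_on {0..} M"
    and M_nonneg: "\<forall>t\<ge>0. M t \<ge> 0"
    and m0: "m0 > 0"
    and M1: "\<forall>t\<ge>0. M t \<ge> m0"
    and M2: "mono_on {0..} M"
    and M3: "\<forall>t1 t2. t1 \<ge> t2 \<and> t2 > 0 \<longrightarrow> M t1 / t1 - M t2 / t2 \<le> m0 * (1 / t1 - 1 / t2)"
    and f_cont: "continuous_on UNIV f"
    and f_neg: "\<forall>t<0. f t = 0"
    and f1: "((\<lambda>t. f t / t ^ 3) \<longlongrightarrow> 0) (at_right 0)"
    and f2: "\<exists>q. 4 < q \<and> q < 6 / (3 - 2 * s) \<and> ((\<lambda>t. f t / t powr (q - 1)) \<longlongrightarrow> 0) at_top"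
    and f3: "\<exists>\<theta>. 4 < \<theta> \<and> \<theta> < 6 / (3 - 2 * s) \<and>
               (\<forall>t>0. 0 < \<theta> * integral {0..t} f \<and> \<theta> * integral {0..t} f \<le> f t * t)"
    and f4: "mono_on {0<..} (\<lambda>t. f t / t ^ 3)"
  shows "\<exists>u. weak_solution s V0 M f u \<and> (AE x in lborel. u x > 0)"
proof -
  obtain q where q: "4 < q" "q < 6 / (3 - 2 * s)" "((\<lambda>t. f t / t powr (q - 1)) \<longlongrightarrow> 0) at_top"
    using f2 by blast
  obtain \<theta> where \<theta>: "4 < \<theta>" "\<forall>t>0. 0 < \<theta> * integral {0..t} f \<and> \<theta> * integral {0..t} f \<le> f t * t"
    using f3 by blast
  interpret kirchhoff s V0 q M f m0 \<theta>
    by unfold_locales (use assms q \<theta> in auto)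
  obtain v where v: "v \<in> constraint_set" "\<And>u. u \<in> constraint_set \<Longrightarrow> G v \<le> G u"
    using minimizer_exists by blast
  interpret kirchhoff_minimizer s V0 q M f m0 \<theta> v
    by unfold_locales (rule v(1), rule v(2))
  show ?thesis using weak_solution_v v_pos by blast
qed

end
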